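(* Let $\Xi=(\Xi_t)_{t\in[0,1]}$ be a centered Gauss-Markov process with $\Xi_0=0$, non-degenerate on $(0,1)$, with covariance kernel $K_\Xi(s,t)=u(s)v(t)$ for $0\le s\le t\le1$, and let $q=u/v$. Let $L>0$ and $\beta>1/2$, and assume that a) $q\in C^1([0,1])$ and $0<\inf_{t\in[0,1]}q'(t)\le\sup_{t\in[0,1]}q'(t)\le C<\infty$ for some constant $C$, b) $\inf_{t\in[0,1]}v(t)>0$, and c) $v'$ and $q'$ are Hölder continuous on $[0,1]$ with index $\gamma>1/2$. Then, for the Sobolev ellipsoid $\Theta(\beta,L)$ and the experiments $\mathfrak E_{1,n},\mathfrak E_{2,n}$ defined in the context, $$\Delta\bigl(\mathfrak E_{1,n}(\Theta(\beta,L)),\mathfrak E_{2,n}(\Theta(\beta,L))\bigr)\to0\quad\text{as } n\to\infty,$$ i.e. the two sequences of experiments are asymptotically equivalent.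
   Context: Process. A Gauss-Markov process is a process that is both Gaussian and Markov; non-degenerate on $(0,1)$ means $\operatorname{Var}(\Xi_t)>0$ for $t\in(0,1)$. $K_\Xi(s,t)=\operatorname{Cov}(\Xi_s,\Xi_t)$. $\Xi$ is taken with continuous sample paths. Sobolev ellipsoid. With $\mathbf e_k(x)=\exp(-2\pi \mathrm i kx)$, $k\in\mathbb Z$, $$\Theta(\beta,L)=\Bigl\{f(\cdot)=\sum_{k=-\infty}^{\infty}\theta_k\mathbf e_k(\cdot):\ \theta_k=\overline{\theta_{-k}}\ \text{ and }\ \sum_{k=-\infty}^\infty(1+|k|)^{2\beta}|\theta_k|^2\le L^2\Bigr\},$$ a set of real-valued functions on $[0,1]$; for $\beta>1/2$ the series converges absolutely and uniformly, and $f$ denotes the resulting continuous function. Experiments. Let $t_{i,n}=i/n$. For a class $\Theta$ of functions, $\mathfrak E_{1,n}(\Theta)=(\mathbb R^n,\mathcal B(\mathbb R^n),(\mathbf P^f_{1,n})_{f\in\Theta})$, where $\mathbf P^f_{1,n}$ is the law of $(Y_{1,n},\dots,Y_{n,n})$ with $Y_{i,n}=f(t_{i,n})+\sqrt n\,(\Xi_{t_{i,n}}-\Xi_{t_{i-1,n}})$, $i=1,\dots,n$. $\mathfrak E_{2,n}(\Theta)=(C([0,1],\mathbb R),\mathcal B(C([0,1],\mathbb R)),(\mathbf P^f_{2,n})_{f\in\Theta})$, where $\mathbf P^f_{2,n}$ is the law of the process $Y_t=\int_0^t f(s)\,\mathrm ds+\frac1{\sqrt n}\Xi_t$, $t\in[0,1]$.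 Le Cam distance. For two experiments $\mathfrak E_i=(\mathcal X_i,\mathscr X_i,(\mathbf P_{i,\theta})_{\theta\in\Theta})$, $i=1,2$, with the same parameter set, $\delta(\mathfrak E_1,\mathfrak E_2)=\inf_K\sup_{\theta\in\Theta}\|K\mathbf P_{1,\theta}-\mathbf P_{2,\theta}\|_{\mathrm{TV}}$, the infimum being over all Markov kernels $K:\mathcal X_1\times\mathscr X_2\to[0,1]$, where $K\mathbf P(A)=\int K(x,A)\,\mathbf P(\mathrm dx)$ and $\|\mathbf P-\mathbf Q\|_{\mathrm{TV}}=\sup_A|\mathbf P(A)-\mathbf Q(A)|$; and $\Delta(\mathfrak E_1,\mathfrak E_2)=\max\{\delta(\mathfrak E_1,\mathfrak E_2),\delta(\mathfrak E_2,\mathfrak E_1)\}$. *)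

theory Defs
  imports "HOL-Probability.Probability"
begin

subsection \<open>Gauss-Markov processes\<close>

definition covariance :: "'a measure \<Rightarrow> ('a \<Rightarrow> real) \<Rightarrow> ('a \<Rightarrow> real) \<Rightarrow> real" where
  "covariance M X Y =
     (\<integral>\<omega>. (X \<omega> - (\<integral>\<omega>'. X \<omega>' \<partial>M)) * (Y \<omega> - (\<integral>\<omega>'. Y \<omega>' \<partial>M)) \<partial>M)"

text \<open>Point masses count as (degenerate) Gaussian laws.\<close>

definition gaussian_rv :: "'a measure \<Rightarrow> ('a \<Rightarrow> real) \<Rightarrow> bool" where
  "gaussian_rv M X \<longleftrightarrow> X \<in> borel_measurable M \<and>
     ((\<exists>\<mu> \<sigma>. 0 < \<sigma> \<and> distributed M lborel X (normal_density \<mu> \<sigma>)) \<or>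
      (\<exists>\<mu>. AE \<omega> in M. X \<omega> = \<mu>))"

text \<open>A process is Gaussian if all its finite-dimensional marginals are multivariate normal,
  i.e. if all finite linear combinations are normal, possibly degenerate.\<close>

definition gaussian_process :: "'a measure \<Rightarrow> real set \<Rightarrow> (real \<Rightarrow> 'a \<Rightarrow> real) \<Rightarrow> bool" where
  "gaussian_process M T X \<longleftrightarrow>
     (\<forall>J c. finite J \<and> J \<subseteq> T \<longrightarrow> gaussian_rv M (\<lambda>\<omega>. \<Sum>t\<in>J. c t * X t \<omega>))"

text \<open>The sigma-algebra generated by \<open>X r\<close>, \<open>r \<in> T\<close>, \<open>r \<le> s\<close>.\<close>

definition natural_filtration ::
    "'a measure \<Rightarrow> real set \<Rightarrow> (real \<Rightarrow> 'a \<Rightarrow> real) \<Rightarrow> real \<Rightarrow> 'a measure" where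
  "natural_filtration M T X s =
     vimage_algebra (space M) (\<lambda>\<omega>. \<lambda>r\<in>T \<inter> {..s}. X r \<omega>) (\<Pi>\<^sub>M r\<in>T \<inter> {..s}. borel)"

definition markov_process :: "'a measure \<Rightarrow> real set \<Rightarrow> (real \<Rightarrow> 'a \<Rightarrow> real) \<Rightarrow> bool" where
  "markov_process M T X \<longleftrightarrow>
     (\<forall>t\<in>T. X t \<in> borel_measurable M) \<and>
     (\<forall>s\<in>T. \<forall>t\<in>T. \<forall>B\<in>sets borel. s \<le> t \<longrightarrow>
        (AE \<omega> in M.
           real_cond_exp M (natural_filtration M T X s) (\<lambda>\<omega>'. indicator B (X t \<omega>')) \<omega> =
           real_cond_exp M (vimage_algebra (space M) (X s) borel)
             (\<lambda>\<omega>'. indicator B (X t \<omega>')) \<omega>))"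

definition gauss_markov_process ::
    "'a measure \<Rightarrow> real set \<Rightarrow> (real \<Rightarrow> 'a \<Rightarrow> real) \<Rightarrow> bool" where
  "gauss_markov_process M T X \<longleftrightarrow> gaussian_process M T X \<and> markov_process M T X"


subsection \<open>Function classes\<close>

definition holder_continuous_on :: "real \<Rightarrow> real set \<Rightarrow> (real \<Rightarrow> real) \<Rightarrow> bool" where
  "holder_continuous_on \<gamma> S f \<longleftrightarrow>
     (\<exists>H. \<forall>s\<in>S. \<forall>t\<in>S. \<bar>f s - f t\<bar> \<le> H * \<bar>s - t\<bar> powr \<gamma>)"

definition fourier_e :: "int \<Rightarrow> real \<Rightarrow> complex" where
  "fourier_e k x = exp (- (2 * of_real pi * \<i> * of_int k * of_real x))"

text \<open>Functions on \<open>[0,1]\<close> are represented by functions that are \<open>undefined\<close> outside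
  \<open>[0,1]\<close>. The Fourier series is summed pointwise, which is the intended meaning
  for \<open>\<beta> > 1/2\<close>, where it converges absolutely and uniformly.\<close>

definition sobolev_ellipsoid :: "real \<Rightarrow> real \<Rightarrow> (real \<Rightarrow> real) set" where
  "sobolev_ellipsoid \<beta> L =
     {f \<in> extensional {0..1}. \<exists>\<theta> :: int \<Rightarrow> complex.
        (\<forall>k. \<theta> k = cnj (\<theta> (- k))) \<and>
        (\<lambda>k. (1 + \<bar>real_of_int k\<bar>) powr (2 * \<beta>) * (cmod (\<theta> k))\<^sup>2) summable_on UNIV \<and>
        (\<Sum>\<^sub>\<infinity>k. (1 + \<bar>real_of_int k\<bar>) powr (2 * \<beta>) * (cmod (\<theta> k))\<^sup>2) \<le> L\<^sup>2 \<and>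
        (\<forall>x\<in>{0..1}. ((\<lambda>k. \<theta> k * fourier_e k x) has_sum complex_of_real (f x)) UNIV)}"


subsection \<open>Statistical experiments and the Le Cam distance\<close>

record ('x, 'p) stat_experiment =
  sample_space :: "'x measure"  \<comment> \<open>only its carrier and sigma-algebra matter\<close>
  parameters :: "'p set"
  law :: "'p \<Rightarrow> 'x measure"

text \<open>For measures on the same sigma-algebra. Values are extended nonnegative reals, so that
  the suprema and infima below need no boundedness or nonemptiness conditions.\<close>

definition total_variation :: "'x measure \<Rightarrow> 'x measure \<Rightarrow> ennreal" where
  "total_variation P Q = (SUP A\<in>sets P. ennreal \<bar>measure P A - measure Q A\<bar>)"

text \<open>Markov kernels from \<open>X\<close> to \<open>Y\<close> are the measurable maps from \<open>X\<close> into
  \<open>prob_algebra Y\<close>, and \<open>bind P K\<close> is the measure \<open>A \<mapsto> \<integral> K(x,A) P(dx)\<close>.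
  The experiments are meant to have the same parameter set.\<close>

definition deficiency :: "('x, 'p) stat_experiment \<Rightarrow> ('y, 'p) stat_experiment \<Rightarrow> ennreal" where
  "deficiency E F =
     (INF K \<in> sample_space E \<rightarrow>\<^sub>M prob_algebra (sample_space F).
        SUP \<theta> \<in> parameters E. total_variation (bind (law E \<theta>) K) (law F \<theta>))"

definition le_cam_distance :: "('x, 'p) stat_experiment \<Rightarrow> ('y, 'p) stat_experiment \<Rightarrow> ennreal" where
  "le_cam_distance E F = max (deficiency E F) (deficiency F E)"


subsection \<open>The two experiments\<close>

text \<open>\<open>\<real>\<^sup>n\<close> is the set of functions on \<open>{1..n}\<close>; its Borel sigma-algebra is the
  product sigma-algebra.\<close>

definition experiment1 ::
    "'a measure \<Rightarrow> (real \<Rightarrow> 'a \<Rightarrow> real) \<Rightarrow> nat \<Rightarrow> (real \<Rightarrow> real) set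
       \<Rightarrow> (nat \<Rightarrow> real, real \<Rightarrow> real) stat_experiment" where
  "experiment1 M \<Xi> n \<Theta> =
     \<lparr> sample_space = (\<Pi>\<^sub>M i\<in>{1..n}. borel),
       parameters = \<Theta>,
       law = (\<lambda>f. distr M (\<Pi>\<^sub>M i\<in>{1..n}. borel)
         (\<lambda>\<omega>. \<lambda>i\<in>{1..n}. f (real i / real n)
            + sqrt (real n) * (\<Xi> (real i / real n) \<omega> - \<Xi> (real (i - 1) / real n) \<omega>))) \<rparr>"

text \<open>\<open>C([0,1],\<real>)\<close> with the supremum metric and its Borel sigma-algebra.\<close>

definition C01_metric :: "(real \<Rightarrow> real) metric" where
  "C01_metric = cfunspace (top_of_set {0..1}) euclidean_metric"

definition C01_borel :: "(real \<Rightarrow> real) measure" where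
  "C01_borel = sigma (mspace C01_metric) {U. openin (mtopology_of C01_metric) U}"

definition experiment2 ::
    "'a measure \<Rightarrow> (real \<Rightarrow> 'a \<Rightarrow> real) \<Rightarrow> nat \<Rightarrow> (real \<Rightarrow> real) set
       \<Rightarrow> (real \<Rightarrow> real, real \<Rightarrow> real) stat_experiment" where
  "experiment2 M \<Xi> n \<Theta> =
     \<lparr> sample_space = C01_borel,
       parameters = \<Theta>,
       law = (\<lambda>f. distr M C01_borel
         (\<lambda>\<omega>. \<lambda>t\<in>{0..1}. integral {0..t} f + 1 / sqrt (real n) * \<Xi> t \<omega>)) \<rparr>"

end

theory Submission
  imports Defs
begin

text \<open>The covariance says that \<open>\<Xi>\<^sub>t = v(t) W(q(t))\<close> in law, with \<open>W\<close> a Brownian motion, so the increments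
  of \<open>\<Xi> / v\<close> are independent. Hence \<open>\<Xi>\<close> splits into the interpolation of its values at the grid
  points \<open>i/n\<close>, linear in the time scale \<open>q\<close>, and a bridge that is independent of these values. Given
  the discrete data, adding an independent copy of the bridge to the interpolated partial sums produces a
  path distributed as \<open>F\<^sub>n + \<Xi> / \<surd>n\<close>, where \<open>F\<^sub>n\<close> interpolates the Riemann sums of \<open>f\<close>; conversely the
  rescaled grid increments of \<open>F\<^sub>n + \<Xi> / \<surd>n\<close> have exactly the law of the discrete data. Both deficiencies
  are therefore at most the total variation distance between the laws of \<open>F\<^sub>n + \<Xi> / \<surd>n\<close> and
  \<open>F + \<Xi> / \<surd>n\<close> with \<open>F(t) = \<integral>\<^sub>0\<^sup>t f\<close>. By Cameron--Martin this is bounded by \<open>\<surd>n\<close> times the norm of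
  \<open>(F\<^sub>n - F) / v\<close> in the reproducing kernel Hilbert space. The square of that norm is
  \<open>O(n\<^sup>-\<^sup>2\<^sup>\<beta> + n\<^sup>-\<^sup>2\<^sup>\<gamma>)\<close> uniformly over the ellipsoid (for \<open>\<beta>, \<gamma> \<le> 1\<close>, to which one can reduce), by
  Hoelder continuity of the weights and an aliasing estimate for the sampled Fourier series.\<close>

subsection \<open>Characteristic functions of random vectors\<close>

text \<open>Pointwise, a function of the ellipsoid with \<open>\<beta> \<le> 1\<close> is in general
  only Hoelder of order \<open>\<beta> - 1/2\<close>, too little against the factor
  \<open>sqrt n\<close>. The sampling error is therefore measured in mean square over the cells,
  with a common offset in all of them, where the full order \<open>\<beta>\<close> is available.
  Moreover, the drift has to be interpolated after division by \<open>v\<close>, to fit the exact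
  splitting of the noise; the price is a product-rule error containing increments of
  \<open>v'\<close> and \<open>q'\<close>, which is where \<open>\<gamma> > 1/2\<close> enters.
  Shifts are treated for events at finitely many times only. Their bound does not depend on the
  times, so it passes to all Borel sets of paths through the algebra of cylinders. The norm of the
  shift is handled by a function \<open>e\<close> with
  \<open>(H t - H s)^2 \<le> (q t - q s) * (e t - e s)\<close>, an inequality that adds up over any
  finite set of times. Independence is expressed as equality of laws with a product space; for
  Gaussian vectors this is a matter of second moments and characteristic functions.\<close>

lemma weighted_char_unique_real:
  fixes X :: "'a \<Rightarrow> real" and Y :: "'b \<Rightarrow> real"
  assumes "prob_space M" "prob_space N"
    and [measurable]: "X \<in> borel_measurable M" "Y \<in> borel_measurable N"
      "\<rho> \<in> borel_measurable M" "\<sigma> \<in> borel_measurable N"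
    and \<rho>: "\<And>x. 1 \<le> \<rho> x" "\<And>x. \<rho> x \<le> 3" and \<sigma>: "\<And>x. 1 \<le> \<sigma> x" "\<And>x. \<sigma> x \<le> 3"
    and eq: "\<And>s. (\<integral>\<omega>. iexp (s * X \<omega>) * complex_of_real (\<rho> \<omega>) \<partial>M)
       = (\<integral>\<omega>. iexp (s * Y \<omega>) * complex_of_real (\<sigma> \<omega>) \<partial>N)"
    and [measurable]: "A \<in> sets borel"
  shows "(\<integral>\<omega>. indicator A (X \<omega>) * \<rho> \<omega> \<partial>M) = (\<integral>\<omega>. indicator A (Y \<omega>) * \<sigma> \<omega> \<partial>N)"
proof -
  interpret M: prob_space M by fact
  interpret N: prob_space N by fact
  define p where "p = (\<integral>\<omega>. \<rho> \<omega> \<partial>M)"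
  have bd: "integrable M \<rho>" "integrable N \<sigma>"
    using \<rho> \<sigma> by (auto intro!: M.integrable_const_bound[where B=3] N.integrable_const_bound[where B=3] AE_I2 
      simp: abs_le_iff) (smt (verit))+
  \<comment> \<open>At \<open>s = 0\<close> the hypothesis says that both weights have the same
    total mass, so one constant normalises both to probability densities; the lower bound 1 on the
    weights keeps it positive.\<close>
  have p: "p = (\<integral>\<omega>. \<sigma> \<omega> \<partial>N)"
    using eq[of 0] unfolding p_def by simp
  have "1 \<le> p" unfolding p_def using \<rho> bd by (intro M.integral_ge_const) auto
  then have p0: "0 < p" by simp
  define M1 where "M1 = distr (density M (\<lambda>x. ennreal (\<rho> x / p))) borel X"
  define N1 where "N1 = distr (density N (\<lambda>x. ennreal (\<sigma> x / p))) borel Y"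
  have pos: "0 \<le> \<rho> x / p" "0 \<le> \<sigma> y / p" for x y
    using \<rho>(1)[of x] \<sigma>(1)[of y] p0 by auto
  have "prob_space (density M (\<lambda>x. ennreal (\<rho> x / p)))"
    by (rule prob_spaceI) (use p0 pos bd in \<open>simp add: emeasure_density nn_integral_eq_integral p_def[symmetric]\<close>)
  then have r1: "real_distribution M1"
    unfolding M1_def real_distribution_def real_distribution_axioms_def
    by (auto intro!: prob_space.prob_space_distr)
  have "prob_space (density N (\<lambda>x. ennreal (\<sigma> x / p)))"
    by (rule prob_spaceI) (use p0 pos bd in \<open>simp add: emeasure_density nn_integral_eq_integral p[symmetric]\<close>)
  then have r2: "real_distribution N1"
    unfolding N1_def real_distribution_def real_distribution_axioms_def
    by (auto intro!: prob_space.prob_space_distr)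
  have "char M1 = char N1"
  proof
    fix t
    have "char M1 t = (\<integral>\<omega>. (\<rho> \<omega> / p) *\<^sub>R iexp (t * X \<omega>) \<partial>M)"
      unfolding char_def M1_def by (subst integral_distr, simp, simp, subst integral_density) (use pos in auto)
    also have "\<dots> = (\<integral>\<omega>. iexp (t * X \<omega>) * complex_of_real (\<rho> \<omega>) \<partial>M) / complex_of_real p"
      by (subst integral_divide_zero[symmetric]) (simp add: scaleR_conv_of_real field_simps)
    also have "\<dots> = (\<integral>\<omega>. (\<sigma> \<omega> / p) *\<^sub>R iexp (t * Y \<omega>) \<partial>N)"
      unfolding eq by (subst integral_divide_zero[symmetric]) (simp add: scaleR_conv_of_real field_simps)
    also have "\<dots> = char N1 t"
      unfolding char_def N1_def by (subst integral_distr, simp, simp, subst integral_density) (use pos in auto)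
    finally show "char M1 t = char N1 t" .
  qed
  then have "M1 = N1" by (rule Levy_uniqueness[OF r1 r2])
  then have "(\<integral>x. indicator A x \<partial>M1) = (\<integral>x. indicator A x \<partial>N1 :: real)" by simp
  moreover have "(\<integral>x. indicator A x \<partial>M1) = (\<integral>\<omega>. indicator A (X \<omega>) * \<rho> \<omega> \<partial>M) / p"
    unfolding M1_def by (subst integral_distr, simp, simp, subst integral_density) 
       (use pos in \<open>auto simp: mult.commute\<close>)
  moreover have "(\<integral>x. indicator A x \<partial>N1) = (\<integral>\<omega>. indicator A (Y \<omega>) * \<sigma> \<omega> \<partial>N) / p"
    unfolding N1_def by (subst integral_distr, simp, simp, subst integral_density) 
       (use pos in \<open>auto simp: mult.commute\<close>)
  ultimately show ?thesis using p0 by simp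
qed

text \<open>A complex weight reduces to the positive weights \<open>2 + Re w\<close> and \<open>2 + Im w\<close>.\<close>

lemma weighted_char_unique:
  fixes X :: "'a \<Rightarrow> real" and Y :: "'b \<Rightarrow> real" and w :: "'a \<Rightarrow> complex" and z :: "'b \<Rightarrow> complex"
  assumes MN: "prob_space M" "prob_space N"
    and meas[measurable]: "X \<in> borel_measurable M" "Y \<in> borel_measurable N"
      "w \<in> borel_measurable M" "z \<in> borel_measurable N"
    and w: "\<And>x. cmod (w x) \<le> 1" and z: "\<And>x. cmod (z x) \<le> 1"
    and eq1: "\<And>s. (\<integral>\<omega>. iexp (s * X \<omega>) \<partial>M) = (\<integral>\<omega>. iexp (s * Y \<omega>) \<partial>N)"
    and eq: "\<And>s. (\<integral>\<omega>. iexp (s * X \<omega>) * w \<omega> \<partial>M) = (\<integral>\<omega>. iexp (s * Y \<omega>) * z \<omega> \<partial>N)"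
    and A[measurable]: "A \<in> sets borel"
  shows "(\<integral>\<omega>. indicator A (X \<omega>) * w \<omega> \<partial>M) = (\<integral>\<omega>. indicator A (Y \<omega>) * z \<omega> \<partial>N)"
proof -
  interpret M: prob_space M by fact
  interpret N: prob_space N by fact
  have [measurable]: "(\<lambda>x. cnj (w x)) \<in> borel_measurable M" "(\<lambda>x. cnj (z x)) \<in> borel_measurable N"
    by (auto intro!: measurable_compose[of _ _ borel cnj] borel_measurable_continuous_onI continuous_intros)
  have i1: "integrable M (\<lambda>\<omega>. iexp (s * X \<omega>) * g \<omega>)" if "g \<in> borel_measurable M" "\<And>x. cmod (g x) \<le> B" for s g B
    using that by (intro M.integrable_const_bound[where B=B] AE_I2) (auto simp: norm_mult)
  have i2: "integrable N (\<lambda>\<omega>. iexp (s * Y \<omega>) * g \<omega>)" if "g \<in> borel_measurable N" "\<And>x. cmod (g x) \<le> B" for s g B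
    using that by (intro N.integrable_const_bound[where B=B] AE_I2) (auto simp: norm_mult)
  \<comment> \<open>The real and imaginary parts are combinations of \<open>w\<close> and its
    conjugate, whose transform at \<open>s\<close> is the conjugate of that of \<open>w\<close> at
    \<open>-s\<close>.\<close>
  have cnjeq: "(\<integral>\<omega>. iexp (s * X \<omega>) * cnj (w \<omega>) \<partial>M) = (\<integral>\<omega>. iexp (s * Y \<omega>) * cnj (z \<omega>) \<partial>N)" for s
  proof -
    have "(\<integral>\<omega>. iexp (s * X \<omega>) * cnj (w \<omega>) \<partial>M) = (\<integral>\<omega>. cnj (iexp (-s * X \<omega>) * w \<omega>) \<partial>M)"
      by (intro Bochner_Integration.integral_cong) (auto simp: exp_cnj)
    also have "\<dots> = (\<integral>\<omega>. cnj (iexp (-s * Y \<omega>) * z \<omega>) \<partial>N)"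
      by (simp only: Bochner_Integration.integral_cnj eq[of "-s"])
    also have "\<dots> = (\<integral>\<omega>. iexp (s * Y \<omega>) * cnj (z \<omega>) \<partial>N)"
      by (intro Bochner_Integration.integral_cong) (auto simp: exp_cnj)
    finally show ?thesis .
  qed
  have lin1: "(\<integral>\<omega>. iexp (s * X \<omega>) * (a + b * w \<omega> + c * cnj (w \<omega>)) \<partial>M)
     = a * (\<integral>\<omega>. iexp (s * X \<omega>) \<partial>M) + b * (\<integral>\<omega>. iexp (s * X \<omega>) * w \<omega> \<partial>M) 
       + c * (\<integral>\<omega>. iexp (s * X \<omega>) * cnj (w \<omega>) \<partial>M)" for s a b c
    using i1[of w 1 s] i1[of "\<lambda>x. cnj (w x)" 1 s] i1[of "\<lambda>x. 1" 1 s] w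
    by (simp add: algebra_simps mult.left_commute[of _ b] mult.left_commute[of _ c] mult.left_commute[of _ a])
  have lin2: "(\<integral>\<omega>. iexp (s * Y \<omega>) * (a + b * z \<omega> + c * cnj (z \<omega>)) \<partial>N)
     = a * (\<integral>\<omega>. iexp (s * Y \<omega>) \<partial>N) + b * (\<integral>\<omega>. iexp (s * Y \<omega>) * z \<omega> \<partial>N) 
       + c * (\<integral>\<omega>. iexp (s * Y \<omega>) * cnj (z \<omega>) \<partial>N)" for s a b c
    using i2[of z 1 s] i2[of "\<lambda>x. cnj (z x)" 1 s] i2[of "\<lambda>x. 1" 1 s] z
    by (simp add: algebra_simps mult.left_commute[of _ b] mult.left_commute[of _ c] mult.left_commute[of _ a])
  have bdd: "\<bar>Re (w x)\<bar> \<le> 1" "\<bar>Im (w x)\<bar> \<le> 1" "\<bar>Re (z y)\<bar> \<le> 1" "\<bar>Im (z y)\<bar> \<le> 1" for x y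
    using abs_Re_le_cmod[of "w x"] abs_Im_le_cmod[of "w x"] abs_Re_le_cmod[of "z y"] abs_Im_le_cmod[of "z y"] w[of x] z[of y]
    by linarith+
  have Re: "complex_of_real (2 + Re c) = 2 + (1/2) * c + (1/2) * cnj c" for c
    by (simp add: complex_eq_iff)
  have Im: "complex_of_real (2 + Im c) = 2 + (-\<i>/2) * c + (\<i>/2) * cnj c" for c
    by (simp add: complex_eq_iff)
  \<comment> \<open>The constant weight is needed to remove the summand 2 that made the weights
    positive.\<close>
  have one: "(\<integral>\<omega>. indicator A (X \<omega>) * 1 \<partial>M) = (\<integral>\<omega>. indicator A (Y \<omega>) * 1 \<partial>N :: real)"
    by (rule weighted_char_unique_real[OF MN meas(1,2)]) (auto simp: eq1 simp del: of_real_mult)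
  have re: "(\<integral>\<omega>. indicator A (X \<omega>) * (2 + Re (w \<omega>)) \<partial>M) = (\<integral>\<omega>. indicator A (Y \<omega>) * (2 + Re (z \<omega>)) \<partial>N)"
  proof (rule weighted_char_unique_real[OF MN meas(1,2)])
    show "1 \<le> 2 + Re (w x)" "2 + Re (w x) \<le> 3" for x using bdd(1)[of x] by linarith+
    show "1 \<le> 2 + Re (z x)" "2 + Re (z x) \<le> 3" for x using bdd(3)[of x] by linarith+
  qed (simp_all only: Re lin1 lin2 eq1 eq cnjeq, measurable)
  have im: "(\<integral>\<omega>. indicator A (X \<omega>) * (2 + Im (w \<omega>)) \<partial>M) = (\<integral>\<omega>. indicator A (Y \<omega>) * (2 + Im (z \<omega>)) \<partial>N)"
  proof (rule weighted_char_unique_real[OF MN meas(1,2)])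
    show "1 \<le> 2 + Im (w x)" "2 + Im (w x) \<le> 3" for x using bdd(2)[of x] by linarith+
    show "1 \<le> 2 + Im (z x)" "2 + Im (z x) \<le> 3" for x using bdd(4)[of x] by linarith+
  qed (simp_all only: Im lin1 lin2 eq1 eq cnjeq, measurable)
  have j: "integrable M (\<lambda>\<omega>. indicator A (X \<omega>) * g \<omega> :: real)" if "g \<in> borel_measurable M" "\<And>x. \<bar>g x\<bar> \<le> 1" for g
    using that by (intro M.integrable_const_bound[where B=1] AE_I2) (auto simp: indicator_def)
  have j': "integrable N (\<lambda>\<omega>. indicator A (Y \<omega>) * g \<omega> :: real)" if "g \<in> borel_measurable N" "\<And>x. \<bar>g x\<bar> \<le> 1" for g
    using that by (intro N.integrable_const_bound[where B=1] AE_I2) (auto simp: indicator_def)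
  have re': "(\<integral>\<omega>. indicator A (X \<omega>) * Re (w \<omega>) \<partial>M) = (\<integral>\<omega>. indicator A (Y \<omega>) * Re (z \<omega>) \<partial>N)"
    using re one j[of "\<lambda>x. 1"] j[of "\<lambda>x. Re (w x)"] j'[of "\<lambda>x. 1"] j'[of "\<lambda>x. Re (z x)"] bdd
    by (simp add: algebra_simps)
  have im': "(\<integral>\<omega>. indicator A (X \<omega>) * Im (w \<omega>) \<partial>M) = (\<integral>\<omega>. indicator A (Y \<omega>) * Im (z \<omega>) \<partial>N)"
    using im one j[of "\<lambda>x. 1"] j[of "\<lambda>x. Im (w x)"] j'[of "\<lambda>x. 1"] j'[of "\<lambda>x. Im (z x)"] bdd
    by (simp add: algebra_simps)
  have k: "integrable M (\<lambda>\<omega>. indicator A (X \<omega>) * w \<omega>)" "integrable N (\<lambda>\<omega>. indicator A (Y \<omega>) * z \<omega>)"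
    using w z
    by (intro M.integrable_const_bound[where B=1] N.integrable_const_bound[where B=1] AE_I2; 
        auto simp: indicator_def norm_mult)+
  have ii: "Re (indicator B x * c) = indicator B x * Re c" "Im (indicator B x * c) = indicator B x * Im c" for B :: "real set" and x c
    by (auto simp: indicator_def)
  show ?thesis
    using re' im' integral_Re[OF k(1)] integral_Im[OF k(1)] integral_Re[OF k(2)] integral_Im[OF k(2)]
    unfolding ii by (simp add: complex_eq_iff)
qed

lemma measure_rectangle:
  fixes X :: "'i \<Rightarrow> 'a \<Rightarrow> real"
  assumes J: "finite J" and X: "\<And>i. i \<in> J \<Longrightarrow> X i \<in> borel_measurable M"
    and A: "\<And>i. i \<in> J \<Longrightarrow> A i \<in> sets (borel :: real measure)"
  shows "complex_of_real (measure M ((\<lambda>\<omega>. \<lambda>i\<in>J. X i \<omega>) -` Pi\<^sub>E J A \<inter> space M))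
    = (\<integral>\<omega>. (\<Prod>i\<in>J. indicator (A i) (X i \<omega>)) \<partial>M)"
proof -
  let ?S = "(\<lambda>\<omega>. \<lambda>i\<in>J. X i \<omega>) -` Pi\<^sub>E J A \<inter> space M"
  have "Pi\<^sub>E J A \<in> sets (\<Pi>\<^sub>M i\<in>J. borel)" using A J by (intro sets_PiM_I_finite) auto
  from measurable_sets[OF measurable_restrict[OF X] this]
  have "complex_of_real (measure M ?S) = complex_of_real (\<integral>\<omega>. indicator ?S \<omega> \<partial>M)" by simp
  also have "\<dots> = (\<integral>\<omega>. complex_of_real (indicator ?S \<omega>) \<partial>M)"
    by (rule integral_complex_of_real[symmetric])
  also have "\<dots> = (\<integral>\<omega>. (\<Prod>i\<in>J. indicator (A i) (X i \<omega>)) \<partial>M)"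
  proof (rule Bochner_Integration.integral_cong[OF refl])
    fix \<omega> assume "\<omega> \<in> space M"
    then show "complex_of_real (indicator ?S \<omega>) = (\<Prod>i\<in>J. indicator (A i) (X i \<omega>))"
      using J by (auto simp: indicator_def PiE_iff prod_zero_iff)
  qed
  finally show ?thesis .
qed

text \<open>Levy's theorem is applied to one coordinate at a time. In a mixed transform with
  indicators on \<open>K\<close> and exponentials on \<open>J - K\<close>, the product of the
  factors other than that of \<open>j\<close> is a complex weight of modulus at most 1, and weighted
  uniqueness turns the exponential in \<open>X j\<close> into an indicator. At \<open>K = J\<close>
  only rectangles remain.\<close>

theorem char_function_unique_PiM:
  fixes X :: "'i \<Rightarrow> 'a \<Rightarrow> real" and Y :: "'i \<Rightarrow> 'b \<Rightarrow> real"
  assumes MN: "prob_space M" "prob_space N" and J: "finite J"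
    and X: "\<And>i. i \<in> J \<Longrightarrow> X i \<in> borel_measurable M" 
    and Y: "\<And>i. i \<in> J \<Longrightarrow> Y i \<in> borel_measurable N"
    and eq: "\<And>t. (\<integral>\<omega>. iexp (\<Sum>i\<in>J. t i * X i \<omega>) \<partial>M) = (\<integral>\<omega>. iexp (\<Sum>i\<in>J. t i * Y i \<omega>) \<partial>N)"
  shows "distr M (\<Pi>\<^sub>M i\<in>J. borel) (\<lambda>\<omega>. \<lambda>i\<in>J. X i \<omega>) = distr N (\<Pi>\<^sub>M i\<in>J. borel) (\<lambda>\<omega>. \<lambda>i\<in>J. Y i \<omega>)"
proof -
  interpret M: prob_space M by fact
  interpret N: prob_space N by fact
  \<comment> \<open>Zero coefficients outside \<open>K\<close> give the marginals; the singletons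
    supply the unweighted hypothesis of \<open>weighted_char_unique\<close>.\<close>
  have eqJ: "(\<integral>\<omega>. iexp (\<Sum>i\<in>K. t i * X i \<omega>) \<partial>M) = (\<integral>\<omega>. iexp (\<Sum>i\<in>K. t i * Y i \<omega>) \<partial>N)" if "K \<subseteq> J" for K t
  proof -
    have "(\<Sum>i\<in>J. (if i \<in> K then t i else 0) * f i) = (\<Sum>i\<in>K. t i * f i)" for f :: "'i \<Rightarrow> real"
      using that J by (intro sum.mono_neutral_cong_right) auto
    then show ?thesis using eq[of "\<lambda>i. if i \<in> K then t i else 0"] by simp
  qed
  have step: "(\<integral>\<omega>. (\<Prod>i\<in>K. indicator (A i) (X i \<omega>)) * iexp (\<Sum>i\<in>J-K. t i * X i \<omega>) \<partial>M) 
     = (\<integral>\<omega>. (\<Prod>i\<in>K. indicator (A i) (Y i \<omega>)) * iexp (\<Sum>i\<in>J-K. t i * Y i \<omega>) \<partial>N)"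
    if "finite K" "K \<subseteq> J" "\<And>i. i \<in> K \<Longrightarrow> A i \<in> sets borel" for K t A
    using that
  proof (induction K arbitrary: t)
    case empty
    then show ?case using eq by simp
  next
    case (insert j K)
    have [measurable]: "X j \<in> borel_measurable M" "Y j \<in> borel_measurable N" using insert X Y by auto
    have mA: "A i \<in> sets borel" if "i \<in> K" for i using insert that by auto
    have mX: "(\<lambda>\<omega>. indicator (A i) (X i \<omega>) :: complex) \<in> borel_measurable M"
      "(\<lambda>\<omega>. indicator (A i) (Y i \<omega>) :: complex) \<in> borel_measurable N" if "i \<in> K" for i
      using that insert.prems 
      by (auto intro!: measurable_compose[OF X borel_measurable_indicator[OF mA]] measurable_compose[OF Y borel_measurable_indicator[OF mA]])
    have m[measurable]: "(\<lambda>\<omega>. (\<Prod>i\<in>K. indicator (A i) (X i \<omega>)) * iexp (\<Sum>i\<in>J-insert j K. t i * X i \<omega>)) \<in> borel_measurable M"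
      "(\<lambda>\<omega>. (\<Prod>i\<in>K. indicator (A i) (Y i \<omega>)) * iexp (\<Sum>i\<in>J-insert j K. t i * Y i \<omega>)) \<in> borel_measurable N"
      using X Y mX by (auto intro!: borel_measurable_times borel_measurable_prod measurable_compose[of _ _ borel iexp] borel_measurable_sum)
    have le: "cmod ((\<Prod>i\<in>K. indicator (A i) (x i)) * iexp r) \<le> 1" for x :: "'i \<Rightarrow> real" and r
    proof -
      have "cmod (\<Prod>i\<in>K. indicator (A i) (x i)) \<le> 1"
        unfolding prod_norm[symmetric] by (intro prod_le_1) (auto simp: indicator_def)
      then show ?thesis by (simp add: norm_mult)
    qed
    have Jd: "J - K = insert j (J - insert j K)" using insert by auto
    have "(\<integral>\<omega>. indicator (A j) (X j \<omega>) * ((\<Prod>i\<in>K. indicator (A i) (X i \<omega>)) * iexp (\<Sum>i\<in>J-insert j K. t i * X i \<omega>)) \<partial>M)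
      = (\<integral>\<omega>. indicator (A j) (Y j \<omega>) * ((\<Prod>i\<in>K. indicator (A i) (Y i \<omega>)) * iexp (\<Sum>i\<in>J-insert j K. t i * Y i \<omega>)) \<partial>N)"
    proof (rule weighted_char_unique[OF MN _ _ m le le])
      show "(\<integral>\<omega>. iexp (s * X j \<omega>) \<partial>M) = (\<integral>\<omega>. iexp (s * Y j \<omega>) \<partial>N)" for s
        using eqJ[of "{j}" "\<lambda>_. s"] insert.prems by simp
    next
      fix s
      have e: "(\<Prod>i\<in>K. indicator (A i) (x i)) * iexp (\<Sum>i\<in>J-K. (t(j:=s)) i * x i)
        = iexp (s * x j) * ((\<Prod>i\<in>K. indicator (A i) (x i)) * iexp (\<Sum>i\<in>J-insert j K. t i * x i))" for x :: "'i \<Rightarrow> real"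
      proof -
        have "(\<Sum>i\<in>J-K. (t(j:=s)) i * x i) = s * x j + (\<Sum>i\<in>J-insert j K. t i * x i)"
          unfolding Jd using J by (subst sum.insert) (auto intro!: sum.cong)
        then show ?thesis by (simp add: ring_distribs exp_add)
      qed
      show "(\<integral>\<omega>. iexp (s * X j \<omega>) * ((\<Prod>i\<in>K. indicator (A i) (X i \<omega>)) * iexp (\<Sum>i\<in>J-insert j K. t i * X i \<omega>)) \<partial>M)
        = (\<integral>\<omega>. iexp (s * Y j \<omega>) * ((\<Prod>i\<in>K. indicator (A i) (Y i \<omega>)) * iexp (\<Sum>i\<in>J-insert j K. t i * Y i \<omega>)) \<partial>N)"
        using insert.IH[of "t(j:=s)"] insert.prems unfolding e by auto
    qed (use insert in auto)
    then show ?case using insert.hyps by (simp add: mult.assoc)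
  qed
  have mX: "(\<lambda>\<omega>. \<lambda>i\<in>J. X i \<omega>) \<in> M \<rightarrow>\<^sub>M (\<Pi>\<^sub>M i\<in>J. borel)" using X by (rule measurable_restrict)
  have mY: "(\<lambda>\<omega>. \<lambda>i\<in>J. Y i \<omega>) \<in> N \<rightarrow>\<^sub>M (\<Pi>\<^sub>M i\<in>J. borel)" using Y by (rule measurable_restrict)
  show ?thesis
  proof (rule measure_eqI_PiM_finite[OF J])
    fix A assume A: "\<And>i. i \<in> J \<Longrightarrow> A i \<in> sets (borel::real measure)"
    let ?S = "Pi\<^sub>E J A"
    have S: "?S \<in> sets (\<Pi>\<^sub>M i\<in>J. borel)" using A J by (intro sets_PiM_I_finite) auto
    have "complex_of_real (measure M ((\<lambda>\<omega>. \<lambda>i\<in>J. X i \<omega>) -` ?S \<inter> space M)) = (\<integral>\<omega>. (\<Prod>i\<in>J. indicator (A i) (X i \<omega>)) \<partial>M)"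
      by (rule measure_rectangle[OF J X A])
    also have "\<dots> = (\<integral>\<omega>. (\<Prod>i\<in>J. indicator (A i) (Y i \<omega>)) \<partial>N)"
      using step[of J A, OF J subset_refl A] by simp
    also have "\<dots> = complex_of_real (measure N ((\<lambda>\<omega>. \<lambda>i\<in>J. Y i \<omega>) -` ?S \<inter> space N))"
      by (rule measure_rectangle[OF J Y A, symmetric])
    finally have "measure M ((\<lambda>\<omega>. \<lambda>i\<in>J. X i \<omega>) -` ?S \<inter> space M) = measure N ((\<lambda>\<omega>. \<lambda>i\<in>J. Y i \<omega>) -` ?S \<inter> space N)"
      by (simp only: of_real_eq_iff)
    then show "emeasure (distr M (\<Pi>\<^sub>M i\<in>J. borel) (\<lambda>\<omega>. \<lambda>i\<in>J. X i \<omega>)) ?S = emeasure (distr N (\<Pi>\<^sub>M i\<in>J. borel) (\<lambda>\<omega>. \<lambda>i\<in>J. Y i \<omega>)) ?S"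
      using mX mY S by (simp add: emeasure_distr M.emeasure_eq_measure N.emeasure_eq_measure)
  next
    show "range (\<lambda>_::nat. \<Pi>\<^sub>E i\<in>J. UNIV::real set) \<subseteq> prod_algebra J (\<lambda>_. borel)"
      using J by (auto intro!: prod_algebraI_finite)
    show "(\<Union>i::nat. \<Pi>\<^sub>E i\<in>J. UNIV::real set) = space (\<Pi>\<^sub>M i\<in>J. borel)" by (simp add: space_PiM)
    show "emeasure (distr M (\<Pi>\<^sub>M i\<in>J. borel) (\<lambda>\<omega>. \<lambda>i\<in>J. X i \<omega>)) (\<Pi>\<^sub>E i\<in>J. UNIV::real set) \<noteq> \<infinity>" for i :: nat
      by (subst emeasure_distr[OF mX]) (use J in \<open>auto intro!: sets_PiM_I_finite\<close>)
  qed auto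
qed

subsection \<open>The Borel sigma-algebra of the space of continuous paths\<close>

lemma mspace_C01: "mspace C01_metric = {f \<in> extensional {0..1}. continuous_on {0..1} f}"
proof -
  have "bounded (f ` {0..1})" if "continuous_on {0..1} f" for f :: "real \<Rightarrow> real"
    using compact_continuous_image[OF that compact_Icc] compact_imp_bounded by blast
  then show ?thesis
    unfolding C01_metric_def
    by (auto simp: mbounded_iff_bounded)
qed

lemma mdist_C01_le:
  assumes "f \<in> mspace C01_metric" "g \<in> mspace C01_metric"
  shows "mdist C01_metric f g \<le> a \<longleftrightarrow> (\<forall>x\<in>{0..1}. \<bar>f x - g x\<bar> \<le> a)"
proof -
  have "mdist C01_metric f g \<le> a \<longleftrightarrow> (\<forall>x\<in>topspace (top_of_set {0..1}). mdist euclidean_metric (f x) (g x) \<le> a)"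
    unfolding C01_metric_def
    by (rule cfunspace_mdist_le[OF assms[unfolded C01_metric_def]]) simp
  then show ?thesis by (simp add: dist_real_def)
qed

lemma space_C01: "space C01_borel = mspace C01_metric"
  and sets_C01: "sets C01_borel = sigma_sets (mspace C01_metric) {U. openin (mtopology_of C01_metric) U}"
proof -
  have "{U. openin (mtopology_of C01_metric) U} \<subseteq> Pow (mspace C01_metric)"
    by (auto dest!: openin_subset)
  then show "space C01_borel = mspace C01_metric"
   "sets C01_borel = sigma_sets (mspace C01_metric) {U. openin (mtopology_of C01_metric) U}"
    unfolding C01_borel_def by (auto simp: space_measure_of sets_measure_of)
qed

text \<open>Bernstein polynomials with rational coefficients show that \<open>C([0,1])\<close> is separable.\<close>

lemma C01_separable:
  "\<exists>D. countable D \<and> D \<subseteq> mspace C01_metric \<and>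
     (\<forall>f\<in>mspace C01_metric. \<forall>e>0. \<exists>g\<in>D. mdist C01_metric f g \<le> e)"
proof -
  \<comment> \<open>\<open>rs\<close> lists the \<open>n + 1\<close> coefficients of a polynomial of
    degree \<open>n\<close>, whence the \<open>- 1\<close>; lists of rationals are countable, and so
    is \<open>range B\<close>.\<close>
  define B where "B rs = (\<lambda>x\<in>{0..1}. \<Sum>k<length rs. real_of_rat (rs ! k) * Bernstein (length rs - 1) k x)" for rs
  have cont: "continuous_on S (\<lambda>x. Bernstein n k x)" for S :: "real set" and n k
    unfolding Bernstein_def by (intro continuous_intros)
  have BC: "B rs \<in> mspace C01_metric" for rs
  proof -
    have "continuous_on {0..1} (\<lambda>x. \<Sum>k<length rs. real_of_rat (rs ! k) * Bernstein (length rs - 1) k x)"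
      by (intro continuous_intros cont)
    then have "continuous_on {0..1} (B rs)"
      by (rule continuous_on_eq) (auto simp: B_def)
    then show ?thesis unfolding mspace_C01 by (auto simp: B_def)
  qed
  have "\<exists>rs. mdist C01_metric f (B rs) \<le> e" if f: "f \<in> mspace C01_metric" and e: "e > 0" for f e
  proof -
    from f have cf: "continuous_on {0..1} f" by (auto simp: mspace_C01)
    obtain n where n: "\<And>x. x \<in> {0..1} \<Longrightarrow> \<bar>f x - (\<Sum>k\<le>n. f(k/n) * Bernstein n k x)\<bar> < e/2"
      using Bernstein_Weierstrass[OF cf, of "e/2"] e by (auto)
    have "\<exists>r. \<bar>f (real k / real n) - real_of_rat r\<bar> < e/2" for k
    proof -
      obtain q where "q \<in> \<rat>" "f (real k / real n) - e/2 < q" "q < f (real k / real n) + e/2"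
        using Rats_dense_in_real[of "f (real k / real n) - e/2" "f (real k / real n) + e/2"] e by auto
      then show ?thesis unfolding Rats_def by (auto simp only: abs_less_iff) (smt (verit) field_sum_of_halves)
    qed
    then obtain r where r: "\<And>k. \<bar>f (real k / real n) - real_of_rat (r k)\<bar> < e/2" by metis
    have "\<bar>f x - B (map r [0..<Suc n]) x\<bar> \<le> e" if x: "x \<in> {0..1}" for x
    proof -
      have Bx: "B (map r [0..<Suc n]) x = (\<Sum>k\<le>n. real_of_rat (r k) * Bernstein n k x)"
        using x unfolding B_def by (auto simp: lessThan_Suc_atMost simp del: upt_Suc intro!: sum.cong)
      have "\<bar>(\<Sum>k\<le>n. f(k/n) * Bernstein n k x) - (\<Sum>k\<le>n. real_of_rat (r k) * Bernstein n k x)\<bar>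
        = \<bar>\<Sum>k\<le>n. (f(k/n) - real_of_rat (r k)) * Bernstein n k x\<bar>"
        by (simp add: sum_subtractf left_diff_distrib)
      also have "\<dots> \<le> (\<Sum>k\<le>n. \<bar>f(k/n) - real_of_rat (r k)\<bar> * Bernstein n k x)"
        using x Bernstein_nonneg[of x n] by (intro order.trans[OF sum_abs] sum_mono) (auto simp: abs_mult)
      also have "\<dots> \<le> (\<Sum>k\<le>n. e/2 * Bernstein n k x)"
        using x Bernstein_nonneg[of x n] r by (intro sum_mono mult_right_mono) (auto intro: less_imp_le)
      also have "\<dots> = e/2" unfolding sum_distrib_left[symmetric] sum_Bernstein by simp
      finally show ?thesis using n[OF x] Bx by linarith
    qed
    then show ?thesis using mdist_C01_le[OF f BC] by blast
  qed
  then show ?thesis using BC by (intro exI[of _ "range B"]) auto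
qed

lemma C01_eval_measurable:
  assumes t: "t \<in> {0..1}"
  shows "(\<lambda>x. x t) \<in> borel_measurable C01_borel"
proof (rule borel_measurableI)
  fix S :: "real set" assume S: "open S"
  have "openin (mtopology_of C01_metric) {x \<in> mspace C01_metric. x t \<in> S}"
  proof -
    interpret C: Metric_space "mspace C01_metric" "mdist C01_metric" by simp
    have "\<exists>r>0. C.mball f r \<subseteq> {x \<in> mspace C01_metric. x t \<in> S}" if f: "f \<in> mspace C01_metric" "f t \<in> S" for f
    proof -
      obtain e where e: "e > 0" "\<And>y. dist y (f t) < e \<Longrightarrow> y \<in> S" using S f unfolding open_dist by blast
      have "g t \<in> S" if "g \<in> mspace C01_metric" "mdist C01_metric f g < e" for g
        using mdist_C01_le[OF f(1) that(1), of "mdist C01_metric f g"] t that(2)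
        by (intro e(2)) (force simp: dist_real_def abs_minus_commute)
      then show ?thesis using e by (intro exI[of _ e]) auto
    qed
    then show ?thesis unfolding mtopology_of_def C.openin_mtopology by auto
  qed
  moreover have "(\<lambda>x. x t) -` S \<inter> space C01_borel = {x \<in> mspace C01_metric. x t \<in> S}"
    by (auto simp: space_C01)
  ultimately show "(\<lambda>x. x t) -` S \<inter> space C01_borel \<in> sets C01_borel"
    by (simp add: sets_C01 sigma_sets.Basic)
qed

text \<open>The finite set \<open>J\<close> varies with the event, so these events form an algebra,
  on which probabilities are determined by finite-dimensional marginals.\<close>

definition cylinders :: "(real \<Rightarrow> real) set set" where
  "cylinders = {{x \<in> mspace C01_metric. restrict x J \<in> E} |J E.
     finite J \<and> J \<subseteq> {0..1} \<and> E \<in> sets (\<Pi>\<^sub>M i\<in>J. borel)}"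

lemma cylinders_sets: "cylinders \<subseteq> sets C01_borel"
proof
  fix A assume "A \<in> cylinders"
  then obtain J E where A: "A = {x \<in> mspace C01_metric. restrict x J \<in> E}" and J: "finite J" "J \<subseteq> {0..1}"
    and E: "E \<in> sets (\<Pi>\<^sub>M i\<in>J. borel)" by (auto simp: cylinders_def)
  have m: "(\<lambda>x. \<lambda>i\<in>J. x i) \<in> C01_borel \<rightarrow>\<^sub>M (\<Pi>\<^sub>M i\<in>J. borel)"
    using J by (intro measurable_restrict C01_eval_measurable) auto
  have "A = (\<lambda>x. \<lambda>i\<in>J. x i) -` E \<inter> space C01_borel"
    unfolding A by (auto simp: space_C01)
  then show "A \<in> sets C01_borel" using measurable_sets[OF m E] by simp
qed

text \<open>By continuity of the paths a closed ball is a countable intersection of conditions at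
  single rational times, and an open set is a countable union of closed balls with centres in a
  countable dense set.\<close>

lemma sets_C01_cylinders: "sets C01_borel = sigma_sets (mspace C01_metric) cylinders"
proof
  let ?S = "sigma_sets (mspace C01_metric) cylinders"
  show "?S \<subseteq> sets C01_borel"
    using cylinders_sets sets.sigma_sets_subset[of cylinders C01_borel] by (simp add: space_C01)
  have sub: "cylinders \<subseteq> Pow (mspace C01_metric)" by (auto simp: cylinders_def)
  interpret S: sigma_algebra "mspace C01_metric" ?S
    by (rule sigma_algebra_sigma_sets[OF sub])
  interpret C: Metric_space "mspace C01_metric" "mdist C01_metric" by simp
  have pt: "{x \<in> mspace C01_metric. \<bar>x t - a\<bar> \<le> r} \<in> ?S" if "t \<in> {0..1}" for t a r
  proof (rule sigma_sets.Basic)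
    have "{x \<in> mspace C01_metric. \<bar>x t - a\<bar> \<le> r} = {x \<in> mspace C01_metric. restrict x {t} \<in> (\<Pi>\<^sub>E i\<in>{t}. {a-r..a+r})}"
      by (auto simp: abs_le_iff)
    moreover have "(\<Pi>\<^sub>E i\<in>{t}. {a-r..a+r}) \<in> sets (\<Pi>\<^sub>M i\<in>{t}. borel)"
      by (intro sets_PiM_I_finite) auto
    ultimately show "{x \<in> mspace C01_metric. \<bar>x t - a\<bar> \<le> r} \<in> cylinders"
      unfolding cylinders_def using that by blast
  qed
  have ball: "{x \<in> mspace C01_metric. mdist C01_metric f x \<le> r} \<in> ?S" if f: "f \<in> mspace C01_metric" for f r
  proof -
    define Q where "Q = \<rat> \<inter> {0..1::real}"
    have Q: "countable Q" "Q \<noteq> {}" unfolding Q_def using countable_rat by (auto intro!: exI[of _ 0])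
    have clQ: "closure Q = {0..1}"
    proof -
      have "closure ({0<..<1} \<inter> \<rat>) = closure {0<..<1::real}"
        by (rule closure_open_Int_superset) (auto simp: Rats_closure_real)
      then have "{0..1} \<subseteq> closure Q" 
        unfolding Q_def by (metis (no_types, lifting) Int_commute Int_mono atLeastAtMost_subseteq_atLeastLessThan_iff closure_greaterThanLessThan closure_mono greaterThanLessThan_subseteq_atLeastAtMost_iff order_refl zero_less_one)
      moreover have "closure Q \<subseteq> {0..1}" by (rule closure_minimal) (auto simp: Q_def)
      ultimately show ?thesis by auto
    qed
    have "{x \<in> mspace C01_metric. mdist C01_metric f x \<le> r} = (\<Inter>t\<in>Q. {x \<in> mspace C01_metric. \<bar>x t - f t\<bar> \<le> r})" (is "?L = ?R")
    proof
      show "?L \<subseteq> ?R" using mdist_C01_le[OF f] by (auto simp: Q_def abs_minus_commute)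
      show "?R \<subseteq> ?L"
      proof
        fix x assume x: "x \<in> ?R"
        then have xm: "x \<in> mspace C01_metric" using Q by auto
        have "\<bar>x t - f t\<bar> \<le> r" if "t \<in> {0..1}" for t
        proof (rule continuous_le_on_closure[of Q "\<lambda>t. \<bar>x t - f t\<bar>" t r])
          show "continuous_on (closure Q) (\<lambda>t. \<bar>x t - f t\<bar>)"
            unfolding clQ using f xm by (auto simp: mspace_C01 intro!: continuous_intros)
        qed (use clQ that x in auto)
        then show "x \<in> ?L" using mdist_C01_le[OF f xm] xm by (auto simp: abs_minus_commute)
      qed
    qed
    also have "\<dots> \<in> ?S" using Q by (intro S.countable_INT') (auto intro!: pt simp: Q_def)
    finally show ?thesis .
  qed
  obtain D where D: "countable D" "D \<subseteq> mspace C01_metric" 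
    "\<And>f e. f \<in> mspace C01_metric \<Longrightarrow> e > 0 \<Longrightarrow> \<exists>g\<in>D. mdist C01_metric f g \<le> e"
    using C01_separable by metis
  have "U \<in> ?S" if U: "openin (mtopology_of C01_metric) U" for U
  proof -
    let ?b = "\<lambda>g k. {x \<in> mspace C01_metric. mdist C01_metric g x \<le> 1 / real (Suc k)}"
    define I where "I = {(g,k). g \<in> D \<and> ?b g k \<subseteq> U}"
    have cI: "countable I"
      using D(1) by (intro countable_subset[of I "D \<times> (UNIV::nat set)"]) (auto simp: I_def)
    have Um: "U \<subseteq> mspace C01_metric" using U openin_subset by fastforce
    have "U = (\<Union>(g,k)\<in>I. ?b g k)"
    proof
      show "(\<Union>(g,k)\<in>I. ?b g k) \<subseteq> U" by (auto simp: I_def)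
      show "U \<subseteq> (\<Union>(g,k)\<in>I. ?b g k)"
      proof
        fix f assume f: "f \<in> U"
        with Um have fm: "f \<in> mspace C01_metric" by auto
        obtain e where e: "e > 0" "C.mball f e \<subseteq> U"
          using U f unfolding mtopology_of_def C.openin_mtopology by blast
        \<comment> \<open>The radius stays below \<open>e/2\<close> because the ball is centred at
          \<open>g\<close>, not at \<open>f\<close>: its points have distance at most twice the
          radius from \<open>f\<close>.\<close>
        obtain k where k: "1 / real (Suc k) < e / 2" using nat_approx_posE[of "e/2"] e by auto
        obtain g where g: "g \<in> D" "mdist C01_metric f g \<le> 1 / real (Suc k)" using D(3)[OF fm, of "1 / real (Suc k)"] by auto
        have gm: "g \<in> mspace C01_metric" using g D by auto
        have "?b g k \<subseteq> U"
        proof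
          fix x assume x: "x \<in> ?b g k"
          then have "mdist C01_metric f x < e" using C.triangle[OF fm gm, of x] g k by auto
          then show "x \<in> U" using e x fm by (auto simp: C.mball_def)
        qed
        moreover have "f \<in> ?b g k" using g fm by (simp add: C.commute)
        ultimately show "f \<in> (\<Union>(g,k)\<in>I. ?b g k)" using g by (auto simp: I_def)
      qed
    qed
    also have "\<dots> \<in> ?S"
      using D(2) by (intro S.countable_UN'[OF cI]) (auto intro!: ball simp: I_def)
    finally show ?thesis .
  qed
  then show "sets C01_borel \<subseteq> ?S"
    unfolding sets_C01 by (intro S.sigma_sets_subset) auto
qed

text \<open>For a union, both bases are pulled back to the product over
  \<open>J \<union> J'\<close>, where they can be united.\<close>

lemma algebra_cylinders: "algebra (mspace C01_metric) cylinders"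
  unfolding algebra_iff_Un
proof (intro conjI ballI)
  show "cylinders \<subseteq> Pow (mspace C01_metric)" by (auto simp: cylinders_def)
  show "{} \<in> cylinders" unfolding cylinders_def by (auto intro!: exI[of _ "{}"])
  fix A assume "A \<in> cylinders"
  then obtain J E where A: "A = {x \<in> mspace C01_metric. restrict x J \<in> E}" "finite J" "J \<subseteq> {0..1}" 
    and E: "E \<in> sets (\<Pi>\<^sub>M i\<in>J. borel)" by (auto simp: cylinders_def)
  have "mspace C01_metric - A = {x \<in> mspace C01_metric. restrict x J \<in> space (\<Pi>\<^sub>M i\<in>J. borel) - E}"
    using A by (auto simp: space_PiM)
  then show "mspace C01_metric - A \<in> cylinders"
    unfolding cylinders_def using A E by blast
  fix A' assume "A' \<in> cylinders"
  then obtain J' E' where A': "A' = {x \<in> mspace C01_metric. restrict x J' \<in> E'}" "finite J'" "J' \<subseteq> {0..1}" 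
    and E': "E' \<in> sets (\<Pi>\<^sub>M i\<in>J'. borel)" by (auto simp: cylinders_def)
  let ?K = "J \<union> J'"
  have 1: "(\<lambda>x. restrict x J) -` E \<inter> space (\<Pi>\<^sub>M i\<in>?K. borel) \<in> sets (\<Pi>\<^sub>M i\<in>?K. (borel::real measure))"
    by (rule measurable_sets[OF measurable_restrict_subset E]) auto
  have 2: "(\<lambda>x. restrict x J') -` E' \<inter> space (\<Pi>\<^sub>M i\<in>?K. borel) \<in> sets (\<Pi>\<^sub>M i\<in>?K. (borel::real measure))"
    by (rule measurable_sets[OF measurable_restrict_subset E']) auto
  have "A \<union> A' = {x \<in> mspace C01_metric. restrict x ?K \<in> ((\<lambda>x. restrict x J) -` E \<inter> space (\<Pi>\<^sub>M i\<in>?K. borel)) \<union> ((\<lambda>x. restrict x J') -` E' \<inter> space (\<Pi>\<^sub>M i\<in>?K. borel))}"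
    using A A' by (auto simp: space_PiM Int_absorb1)
  then show "A \<union> A' \<in> cylinders"
    unfolding cylinders_def using A A' 1 2 by blast
qed

lemma C01_measurableI:
  assumes "\<And>\<omega>. \<omega> \<in> space M \<Longrightarrow> X \<omega> \<in> mspace C01_metric"
    and "\<And>t. t \<in> {0..1} \<Longrightarrow> (\<lambda>\<omega>. X \<omega> t) \<in> borel_measurable M"
  shows "X \<in> M \<rightarrow>\<^sub>M C01_borel"
proof (rule measurable_sigma_sets[OF sets_C01_cylinders])
  show "cylinders \<subseteq> Pow (mspace C01_metric)" by (auto simp: cylinders_def)
  show "X \<in> space M \<rightarrow> mspace C01_metric" using assms by auto
  fix A assume "A \<in> cylinders"
  then obtain J E where A: "A = {x \<in> mspace C01_metric. restrict x J \<in> E}" and J: "finite J" "J \<subseteq> {0..1}" 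
    and E: "E \<in> sets (\<Pi>\<^sub>M i\<in>J. borel)" by (auto simp: cylinders_def)
  have m: "(\<lambda>\<omega>. \<lambda>i\<in>J. X \<omega> i) \<in> M \<rightarrow>\<^sub>M (\<Pi>\<^sub>M i\<in>J. borel)"
    using J assms(2) by (intro measurable_restrict) auto
  have "X -` A \<inter> space M = (\<lambda>\<omega>. \<lambda>i\<in>J. X \<omega> i) -` E \<inter> space M"
    unfolding A using assms(1) by auto
  then show "X -` A \<inter> space M \<in> sets M" using measurable_sets[OF m E] by simp
qed

section \<open>Approximating measurable sets by members of an algebra\<close>

text \<open>The sets that can be approximated in measure form a sigma-algebra containing
  \<open>G\<close>. A countable union is cut off after finitely many members by continuity from
  below, and these are approximated separately.\<close>

lemma approx_by_algebra:
  assumes alg: "algebra \<Omega> G" and fin: "finite_measure \<mu>" and s: "sets \<mu> = sigma_sets \<Omega> G"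
    and A: "A \<in> sets \<mu>" and e: "e > (0::real)"
  shows "\<exists>B\<in>G. measure \<mu> ((A - B) \<union> (B - A)) < e"
proof -
  interpret G: algebra \<Omega> G by fact
  interpret finite_measure \<mu> by fact
  have GS: "B \<in> sets \<mu>" if "B \<in> G" for B using that s by auto
  have G\<Omega>: "B \<subseteq> \<Omega>" if "B \<in> G" for B using that G.space_closed by auto
  have S\<Omega>: "B \<subseteq> \<Omega>" if "B \<in> sigma_sets \<Omega> G" for B 
    using sigma_sets_into_sp[OF G.space_closed that] .
  from A have "A \<in> sigma_sets \<Omega> G" using s by simp
  then show ?thesis using e
  proof (induction A arbitrary: e)
    case (Basic a)
    then show ?case by (intro bexI[of _ a]) auto
  next
    case Empty
    then show ?case by (intro bexI[of _ "{}"]) auto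
  next
    case (Compl a)
    then obtain B where B: "B \<in> G" "measure \<mu> ((a - B) \<union> (B - a)) < e" by blast
    have "(\<Omega> - a - (\<Omega> - B)) \<union> ((\<Omega> - B) - (\<Omega> - a)) = (a - B) \<union> (B - a)"
      using G\<Omega>[OF B(1)] S\<Omega>[OF Compl(1)] by auto
    then show ?case using B by (intro bexI[of _ "\<Omega> - B"]) auto
  next
    case (Union a)
    have am: "a i \<in> sets \<mu>" for i using Union s by auto
    have "(\<lambda>n. measure \<mu> (\<Union>i<n. a i)) \<longlonglongrightarrow> measure \<mu> (\<Union>n. \<Union>i<n. a i)"
    proof (rule finite_Lim_measure_incseq)
      show "incseq (\<lambda>n. \<Union>i<n. a i)" by (intro monoI UN_mono) auto
      show "range (\<lambda>n. \<Union>i<n. a i) \<subseteq> sets \<mu>" using am by auto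
    qed
    moreover have "(\<Union>n. \<Union>i<n. a i) = (\<Union>i. a i)" by auto
    ultimately have "(\<lambda>n. measure \<mu> (\<Union>i<n. a i)) \<longlonglongrightarrow> measure \<mu> (\<Union>i. a i)" by simp
    from LIMSEQ_D[OF this, of "e/2"] Union.prems obtain n where 
      n: "\<bar>measure \<mu> (\<Union>i<n. a i) - measure \<mu> (\<Union>i. a i)\<bar> < e/2" by (auto simp: real_norm_def)
    \<comment> \<open>Dividing by \<open>Suc n\<close> keeps the tolerance positive also for
      \<open>n = 0\<close>; the \<open>n\<close> errors add up to at most
      \<open>e/2\<close>.\<close>
    have "\<forall>i. \<exists>B\<in>G. measure \<mu> ((a i - B) \<union> (B - a i)) < e / (2 * real (Suc n))"
      using Union by simp
    then obtain B where B: "\<And>i. B i \<in> G" "\<And>i. measure \<mu> ((a i - B i) \<union> (B i - a i)) < e / (2 * real (Suc n))"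
      by metis
    let ?B = "\<Union>i<n. B i"
    have BG: "?B \<in> G" using B by (intro G.finite_UN) auto
    have Bm: "B i \<in> sets \<mu>" for i using B GS by auto
    have "((\<Union>i. a i) - ?B) \<union> (?B - (\<Union>i. a i)) \<subseteq> ((\<Union>i. a i) - (\<Union>i<n. a i)) \<union> (\<Union>i<n. (a i - B i) \<union> (B i - a i))"
      by auto
    then have "measure \<mu> (((\<Union>i. a i) - ?B) \<union> (?B - (\<Union>i. a i))) \<le> measure \<mu> (((\<Union>i. a i) - (\<Union>i<n. a i)) \<union> (\<Union>i<n. (a i - B i) \<union> (B i - a i)))"
      using am Bm by (intro finite_measure_mono) auto
    also have "\<dots> \<le> measure \<mu> ((\<Union>i. a i) - (\<Union>i<n. a i)) + measure \<mu> (\<Union>i<n. (a i - B i) \<union> (B i - a i))"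
      using am Bm by (intro measure_Un_le) auto
    also have "measure \<mu> ((\<Union>i. a i) - (\<Union>i<n. a i)) = measure \<mu> (\<Union>i. a i) - measure \<mu> (\<Union>i<n. a i)"
      using am by (intro finite_measure_Diff) auto
    also have "\<dots> < e/2" using n by linarith
    also have "measure \<mu> (\<Union>i<n. (a i - B i) \<union> (B i - a i)) \<le> (\<Sum>i<n. measure \<mu> ((a i - B i) \<union> (B i - a i)))"
      using am Bm by (intro finite_measure_subadditive_finite) auto
    also have "\<dots> \<le> (\<Sum>i<n. e / (2 * real (Suc n)))"
      using B by (intro sum_mono less_imp_le)
    also have "\<dots> \<le> e / 2"
      using Union.prems by (simp add: field_simps)
    finally show ?case using BG by (intro bexI[of _ ?B]) auto
  qed
qed

text \<open>One member of the algebra has to approximate \<open>A\<close> for \<open>P\<close> and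
  \<open>Q\<close> simultaneously; approximation with respect to the sum of the two measures
  achieves this.\<close>

lemma measure_diff_le_algebra:
  assumes alg: "algebra \<Omega> G" and P: "finite_measure P" and Q: "finite_measure Q"
    and sP: "sets P = sigma_sets \<Omega> G" and sQ: "sets Q = sigma_sets \<Omega> G"
    and le: "\<And>B. B \<in> G \<Longrightarrow> \<bar>measure P B - measure Q B\<bar> \<le> c" and A: "A \<in> sets P"
  shows "\<bar>measure P A - measure Q A\<bar> \<le> c"
proof (rule field_le_epsilon)
  fix e :: real assume e: "e > 0"
  interpret P: finite_measure P by fact
  interpret Q: finite_measure Q by fact
  define \<mu> where "\<mu> = measure_of (space P) (sets P) (\<lambda>A. emeasure P A + emeasure Q A)"
  have em: "emeasure \<mu> B = emeasure P B + emeasure Q B" if "B \<in> sets P" for B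
    unfolding \<mu>_def
  proof (rule emeasure_measure_of_sigma)
    show "sigma_algebra (space P) (sets P)" by (rule sets.sigma_algebra_axioms)
    show "positive (sets P) (\<lambda>A. emeasure P A + emeasure Q A)" by (simp add: positive_def)
    show "countably_additive (sets P) (\<lambda>A. emeasure P A + emeasure Q A)"
    proof (rule countably_additiveI)
      fix F :: "nat \<Rightarrow> _" assume F: "range F \<subseteq> sets P" "disjoint_family F" "\<Union> (range F) \<in> sets P"
      have "range F \<subseteq> sets Q" using F sP sQ by simp
      with F show "(\<Sum>i. emeasure P (F i) + emeasure Q (F i)) = emeasure P (\<Union> (range F)) + emeasure Q (\<Union> (range F))"
        by (simp add: suminf_add[symmetric] suminf_emeasure)
    qed
  qed fact
  have s\<mu>: "sets \<mu> = sets P" unfolding \<mu>_def by (simp add: sets.space_closed)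
  have sp\<mu>: "space \<mu> = space P" using sets_eq_imp_space_eq[OF s\<mu>] .
  have f\<mu>: "finite_measure \<mu>"
    by (rule finite_measureI) (simp add: sp\<mu> em P.emeasure_eq_measure Q.emeasure_eq_measure)
  have m: "measure \<mu> B = measure P B + measure Q B" if "B \<in> sets P" for B
  proof (rule measure_eq_emeasure_eq_ennreal)
    show "emeasure \<mu> B = ennreal (measure P B + measure Q B)"
      using em[OF that] unfolding P.emeasure_eq_measure Q.emeasure_eq_measure by simp
  qed simp
  obtain B where B: "B \<in> G" "measure \<mu> ((A - B) \<union> (B - A)) < e"
    using approx_by_algebra[OF alg f\<mu>, of A e] A s\<mu> sP e by auto
  have BP: "B \<in> sets P" "B \<in> sets Q" "A \<in> sets Q" using B sP sQ A by auto
  have d: "\<bar>measure R A - measure R B\<bar> \<le> measure R ((A - B) \<union> (B - A))" 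
    if R: "finite_measure R" "A \<in> sets R" "B \<in> sets R" for R
  proof -
    interpret R: finite_measure R by fact
    have "measure R A \<le> measure R (B \<union> ((A - B) \<union> (B - A)))" "measure R B \<le> measure R (A \<union> ((A - B) \<union> (B - A)))"
      using R by (auto intro!: R.finite_measure_mono)
    moreover have "measure R (B \<union> ((A - B) \<union> (B - A))) \<le> measure R B + measure R ((A - B) \<union> (B - A))"
      "measure R (A \<union> ((A - B) \<union> (B - A))) \<le> measure R A + measure R ((A - B) \<union> (B - A))"
      using R by (auto intro!: measure_Un_le)
    ultimately show ?thesis by linarith
  qed
  have "measure P ((A - B) \<union> (B - A)) + measure Q ((A - B) \<union> (B - A)) < e"
    using B m[of "(A - B) \<union> (B - A)"] A BP by auto
  then show "\<bar>measure P A - measure Q A\<bar> \<le> c + e"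
    using d[OF P A BP(1)] d[OF Q BP(3,2)] le[OF B(1)] by linarith
qed

text \<open>This is how a bound for finitely many times that is uniform in the times becomes a bound
  in total variation on path space.\<close>

lemma total_variation_C01_le:
  assumes P: "prob_space P" and Q: "prob_space Q" and s: "sets P = sets C01_borel" "sets Q = sets C01_borel"
    and le: "\<And>J E. finite J \<Longrightarrow> J \<subseteq> {0..1} \<Longrightarrow> E \<in> sets (\<Pi>\<^sub>M i\<in>J. borel) \<Longrightarrow>
      \<bar>measure P {x \<in> mspace C01_metric. restrict x J \<in> E} - measure Q {x \<in> mspace C01_metric. restrict x J \<in> E}\<bar> \<le> c"
  shows "total_variation P Q \<le> ennreal c"
  unfolding total_variation_def
proof (rule SUP_least)
  fix A assume A: "A \<in> sets P"
  have "\<bar>measure P A - measure Q A\<bar> \<le> c"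
  proof (rule measure_diff_le_algebra[OF algebra_cylinders])
    show "finite_measure P" "finite_measure Q" using P Q by (auto simp: prob_space_def)
    show "\<bar>measure P B - measure Q B\<bar> \<le> c" if "B \<in> cylinders" for B
      using that le unfolding cylinders_def by auto
  qed (use s A sets_C01_cylinders in auto)
  then show "ennreal \<bar>measure P A - measure Q A\<bar> \<le> ennreal c" by (rule ennreal_leI)
qed

subsection \<open>Sampling functions of the Sobolev ellipsoid\<close>

lemma summable_on_int_powr:
  assumes "a > 1"
  shows "(\<lambda>k. (1 + \<bar>real_of_int k\<bar>) powr (- a)) summable_on UNIV"
proof -
  let ?g = "\<lambda>k::int. (1 + \<bar>real_of_int k\<bar>) powr (- a)"
  have "summable (\<lambda>n::nat. real n powr (- a))"
    using assms by (simp add: summable_real_powr_iff)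
  then have "summable (\<lambda>n::nat. real (Suc n) powr (- a))"
    by (rule summable_Suc_iff[THEN iffD2])
  then have nat: "(\<lambda>n::nat. (1 + real n) powr (- a)) summable_on UNIV"
    by (subst summable_on_UNIV_nonneg_real_iff) (simp_all add: add.commute)
  have "?g summable_on range int"
    using nat by (subst summable_on_reindex) (auto simp: inj_on_def o_def)
  moreover have "?g summable_on range (\<lambda>n. - int n)"
    using nat by (subst summable_on_reindex) (auto simp: inj_on_def o_def)
  ultimately have "?g summable_on (range int \<union> range (\<lambda>n. - int n))"
    by (rule summable_on_union)
  moreover have "range int \<union> range (\<lambda>n. - int n) = UNIV"
    by (auto simp: image_iff) (metis int_cases2)
  ultimately show ?thesis by simp
qed

section \<open>Trigonometric sums over the grid\<close>

lemma fourier_e_iexp: "fourier_e k x = iexp (- 2 * pi * real_of_int k * x)"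
  unfolding fourier_e_def by (simp add: mult_ac)

lemma norm_fourier_e [simp]: "cmod (fourier_e k x) = 1"
  unfolding fourier_e_iexp by simp

lemma fourier_e_one [simp]: "fourier_e k 1 = 1"
  unfolding fourier_e_def exp_eq_1 by (auto intro!: exI[of _ "- k"])

lemma fourier_e_add: "fourier_e k (x + y) = fourier_e k x * fourier_e k y"
  unfolding fourier_e_def by (simp add: exp_add[symmetric] algebra_simps)

lemma continuous_on_fourier_e: "continuous_on S (fourier_e k)"
  unfolding fourier_e_def by (intro continuous_intros)

lemma norm_fourier_e_minus_one:
  "cmod (fourier_e k x - 1) \<le> 2" "cmod (fourier_e k x - 1) \<le> 2 * pi * \<bar>real_of_int k\<bar> * \<bar>x\<bar>"
proof -
  show "cmod (fourier_e k x - 1) \<le> 2" using norm_triangle_ineq4[of "fourier_e k x" 1] by simp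
  show "cmod (fourier_e k x - 1) \<le> 2 * pi * \<bar>real_of_int k\<bar> * \<bar>x\<bar>"
    using iexp_approx1[of "- 2 * pi * real_of_int k * x" 0] unfolding fourier_e_iexp by (simp add: abs_mult)
qed

text \<open>The summands are the powers of an \<open>n\<close>-th root of unity, whose sum over a
  full period vanishes unless the root is 1, that is, unless \<open>n\<close> divides
  \<open>k - l\<close>. A bound suffices because only moduli enter below.\<close>

lemma fourier_e_orthogonal:
  assumes n: "n \<ge> 1"
  shows "cmod (\<Sum>i=1..n. fourier_e k (real i / real n) * cnj (fourier_e l (real i / real n)))
      \<le> (if int n dvd k - l then real n else 0)"
proof -
  define z where "z = fourier_e (k - l) (1 / real n)"
  have pow: "fourier_e k (real i / real n) * cnj (fourier_e l (real i / real n)) = z ^ i" for i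
  proof -
    have "z ^ i = exp (of_nat i * (- (2 * of_real pi * \<i> * of_int (k - l) * of_real (1 / real n))))"
      unfolding z_def fourier_e_def by (rule exp_of_nat_mult[symmetric])
    also have "\<dots> = fourier_e k (real i / real n) * cnj (fourier_e l (real i / real n))"
      unfolding fourier_e_def by (simp add: exp_cnj exp_add[symmetric] algebra_simps diff_divide_distrib)
    finally show ?thesis by simp
  qed
  show ?thesis
  proof (cases "int n dvd k - l")
    case True
    have "cmod (\<Sum>i=1..n. z ^ i) \<le> (\<Sum>i=1..n. cmod (z ^ i))" by (rule norm_sum)
    also have "\<dots> = real n" by (simp add: norm_power z_def)
    finally show ?thesis using True by (simp add: pow)
  next
    case False
    have "z \<noteq> 1"
    proof
      assume "z = 1"
      then obtain m :: int where "- (2 * pi * real_of_int (k - l) / real n) = real_of_int (2 * m) * pi"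
        unfolding z_def fourier_e_def exp_eq_1 by auto
      then have "pi * (2 * real_of_int (k - l)) = pi * (2 * (- real_of_int m * real n))"
        using n by (simp add: field_simps)
      then have "real_of_int (k - l) = - real_of_int m * real n"
        unfolding mult_cancel_left by simp
      then have "real_of_int (k - l) = real_of_int (int n * (- m))" by simp
      then have "k - l = int n * (- m)" by (simp only: of_int_eq_iff)
      with False show False by simp
    qed
    have zn: "z ^ n = 1"
    proof -
      have "z ^ n = fourier_e k 1 * cnj (fourier_e l 1)" using pow[of n] n by simp
      also have "\<dots> = 1" by simp
      finally show ?thesis .
    qed
    have "(\<Sum>i=1..n. z ^ i) = (\<Sum>i<n. z ^ Suc i)"
      by (rule sum.reindex_bij_witness[of _ Suc "\<lambda>i. i - 1"]) auto
    also have "\<dots> = z * (\<Sum>i<n. z ^ i)" by (simp add: sum_distrib_left)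
    also have "(\<Sum>i<n. z ^ i) = 0" using \<open>z \<noteq> 1\<close> zn by (simp add: sum_gp_strict)
    finally show ?thesis using False by (simp add: pow)
  qed
qed

text \<open>Frequencies that agree modulo \<open>n\<close> cannot be told apart on the grid; after
  expanding the square, orthogonality leaves just these pairs.\<close>

lemma aliasing:
  assumes n: "n \<ge> 1" and F: "finite F"
  shows "(\<Sum>i=1..n. (cmod (\<Sum>k\<in>F. a k * fourier_e k (real i / real n)))\<^sup>2)
     \<le> real n * (\<Sum>k\<in>F. \<Sum>l\<in>{l\<in>F. int n dvd k - l}. cmod (a k) * cmod (a l))"
proof -
  let ?e = "\<lambda>k i. fourier_e k (real i / real n)"
  have "complex_of_real (\<Sum>i=1..n. (cmod (\<Sum>k\<in>F. a k * ?e k i))\<^sup>2)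
      = (\<Sum>i=1..n. \<Sum>k\<in>F. \<Sum>l\<in>F. a k * cnj (a l) * (?e k i * cnj (?e l i)))"
    by (simp only: of_real_sum complex_norm_square) (simp add: sum_product mult_ac)
  also have "\<dots> = (\<Sum>k\<in>F. \<Sum>i=1..n. \<Sum>l\<in>F. a k * cnj (a l) * (?e k i * cnj (?e l i)))"
    by (rule sum.swap)
  also have "\<dots> = (\<Sum>k\<in>F. \<Sum>l\<in>F. \<Sum>i=1..n. a k * cnj (a l) * (?e k i * cnj (?e l i)))"
    by (intro sum.cong refl sum.swap)
  also have "\<dots> = (\<Sum>k\<in>F. \<Sum>l\<in>F. a k * cnj (a l) * (\<Sum>i=1..n. ?e k i * cnj (?e l i)))"
    by (simp only: sum_distrib_left)
  finally have "cmod (complex_of_real (\<Sum>i=1..n. (cmod (\<Sum>k\<in>F. a k * ?e k i))\<^sup>2))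
     \<le> (\<Sum>k\<in>F. \<Sum>l\<in>F. cmod (a k * cnj (a l) * (\<Sum>i=1..n. ?e k i * cnj (?e l i))))"
    by (simp only:) (intro order.trans[OF norm_sum] sum_mono norm_sum)
  also have "\<dots> \<le> (\<Sum>k\<in>F. \<Sum>l\<in>F. if int n dvd k - l then real n * (cmod (a k) * cmod (a l)) else 0)"
  proof (intro sum_mono)
    fix k l
    have "cmod (a k * cnj (a l) * (\<Sum>i=1..n. ?e k i * cnj (?e l i))) 
      \<le> (cmod (a k) * cmod (a l)) * (if int n dvd k - l then real n else 0)"
      unfolding norm_mult[of "a k * cnj (a l)"] norm_mult[of "a k" "cnj (a l)"] complex_mod_cnj
      by (intro mult_left_mono fourier_e_orthogonal n) simp
    then show "cmod (a k * cnj (a l) * (\<Sum>i=1..n. ?e k i * cnj (?e l i))) 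
      \<le> (if int n dvd k - l then real n * (cmod (a k) * cmod (a l)) else 0)"
      by (auto split: if_splits simp: mult_ac)
  qed
  also have "\<dots> = real n * (\<Sum>k\<in>F. \<Sum>l\<in>{l\<in>F. int n dvd k - l}. cmod (a k) * cmod (a l))"
    using F by (simp add: sum.inter_filter sum_distrib_left if_distrib cong: if_cong)
  finally show ?thesis
    by (simp only: norm_of_real)
qed

text \<open>Below frequency \<open>n\<close> the bound linear in \<open>l\<close> is used, and
  \<open>2 - 2 * \<beta> \<ge> 0\<close> allows \<open>1 + |l|\<close> to be replaced by
  \<open>n\<close>; this is why \<open>\<beta>\<close> is capped at 1. From \<open>n\<close> on, the
  bound 2 and the decay of the weight suffice. The decay is kept in terms of \<open>l div n\<close>,
  so that the result can be summed over a residue class.\<close>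

lemma aliased_weight:
  assumes n: "n \<ge> 1" and \<beta>: "1/2 < \<beta>" "\<beta> \<le> 1"
    and c: "cmod c \<le> 2" "cmod c \<le> 2 * pi * \<bar>real_of_int l\<bar> / real n"
  shows "(cmod c)\<^sup>2 * (1 + \<bar>real_of_int l\<bar>) powr (- 2 * \<beta>)
     \<le> 36 * pi\<^sup>2 * real n powr (- 2 * \<beta>) * (1 + \<bar>real_of_int (l div int n)\<bar>) powr (- 2 * \<beta>)"
proof -
  let ?l = "\<bar>real_of_int l\<bar>" and ?r = "\<bar>real_of_int (l div int n)\<bar>"
  \<comment> \<open>The frequency in units of \<open>n\<close>, cut off below at 1. Since
    \<open>1 + |l div n| \<le> 3 * x\<close>, passing to quotients costs a factor
    \<open>3 powr (2 * \<beta>) \<le> 9\<close>.\<close>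
  define x where "x = max 1 (?l / real n)"
  have "real_of_int (l div int n) = of_int \<lfloor>real_of_int l / real n\<rfloor>"
    by (metis floor_divide_of_int_eq of_int_of_nat_eq)
  then have "?r \<le> \<bar>real_of_int l / real n\<bar> + 1" by linarith
  then have rx: "1 + ?r \<le> 3 * x" unfolding x_def by (simp add: abs_divide)
  have pi1: "1 \<le> pi\<^sup>2" using pi_ge_two by (simp add: one_le_power)
  have "x powr (- 2 * \<beta>) \<le> ((1 + ?r) / 3) powr (- 2 * \<beta>)"
    using rx \<beta> by (intro powr_mono2') auto
  also have "\<dots> = 3 powr (2 * \<beta>) * (1 + ?r) powr (- 2 * \<beta>)"
    by (subst powr_divide) (auto simp: powr_minus field_simps)
  also have "\<dots> \<le> 3 powr 2 * (1 + ?r) powr (- 2 * \<beta>)"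
    using \<beta> by (intro mult_right_mono powr_mono) auto
  finally have xr: "x powr (- 2 * \<beta>) \<le> 9 * (1 + ?r) powr (- 2 * \<beta>)" by simp
  have "(cmod c)\<^sup>2 * (1 + ?l) powr (- 2 * \<beta>) \<le> 4 * pi\<^sup>2 * real n powr (- 2 * \<beta>) * x powr (- 2 * \<beta>)"
  proof (cases "?l < real n")
    case True
    then have x1: "x = 1" using n by (simp add: x_def)
    have "1 + \<bar>l\<bar> \<le> int n" using True by linarith
    then have ln: "1 + ?l \<le> real n" by linarith
    have "(cmod c)\<^sup>2 \<le> (2 * pi * ?l / real n)\<^sup>2" using c by (intro power_mono) auto
    also have "\<dots> \<le> (2 * pi * (1 + ?l) / real n)\<^sup>2" by (intro power_mono divide_right_mono mult_left_mono) auto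
    also have "\<dots> = 4 * pi\<^sup>2 * real n powr (-2) * (1 + ?l) powr 2"
    proof -
      have "(2 * pi * (1 + ?l) / real n)\<^sup>2 = 4 * pi\<^sup>2 * (1 + ?l)\<^sup>2 / (real n)\<^sup>2"
        unfolding power_divide power_mult_distrib by simp
      moreover have "real n powr (-2) = 1 / (real n)\<^sup>2" using n by (simp add: powr_minus divide_simps)
      ultimately show ?thesis by simp
    qed
    finally have "(cmod c)\<^sup>2 * (1 + ?l) powr (- 2 * \<beta>) \<le> 4 * pi\<^sup>2 * real n powr (-2) * (1 + ?l) powr 2 * (1 + ?l) powr (- 2 * \<beta>)"
      by (intro mult_right_mono) auto
    also have "\<dots> = 4 * pi\<^sup>2 * real n powr (-2) * (1 + ?l) powr (2 - 2 * \<beta>)"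
      unfolding mult.assoc powr_add[symmetric] by simp
    also have "\<dots> \<le> 4 * pi\<^sup>2 * real n powr (-2) * real n powr (2 - 2 * \<beta>)"
      using ln \<beta> by (intro mult_left_mono powr_mono2) auto
    also have "\<dots> = 4 * pi\<^sup>2 * real n powr (- 2 * \<beta>)" by (simp add: powr_add[symmetric] mult.assoc)
    finally show ?thesis by (simp add: x1)
  next
    case False
    then have x: "?l = real n * x" "x \<ge> 1" using n by (auto simp: x_def field_simps max_def)
    have "(cmod c)\<^sup>2 \<le> 2\<^sup>2" using c by (intro power_mono) auto
    also have "(2::real)\<^sup>2 \<le> 4 * pi\<^sup>2" using pi1 by simp
    finally have 1: "(cmod c)\<^sup>2 \<le> 4 * pi\<^sup>2" .
    have "(1 + ?l) powr (- 2 * \<beta>) \<le> ?l powr (- 2 * \<beta>)" using False n \<beta> by (intro powr_mono2') auto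
    also have "\<dots> = real n powr (- 2 * \<beta>) * x powr (- 2 * \<beta>)" unfolding x(1) using x(2) by (subst powr_mult) auto
    finally have "(cmod c)\<^sup>2 * (1 + ?l) powr (- 2 * \<beta>) \<le> (4 * pi\<^sup>2) * (real n powr (- 2 * \<beta>) * x powr (- 2 * \<beta>))"
      using 1 by (intro mult_mono) auto
    then show ?thesis by (simp add: mult_ac)
  qed
  also have "\<dots> \<le> 4 * pi\<^sup>2 * real n powr (- 2 * \<beta>) * (9 * (1 + ?r) powr (- 2 * \<beta>))"
    by (intro mult_left_mono xr) auto
  finally show ?thesis by (simp add: mult_ac)
qed

definition sobolev_const :: "real \<Rightarrow> real" where
  "sobolev_const \<beta> = (\<Sum>\<^sub>\<infinity>k. (1 + \<bar>real_of_int k\<bar>) powr (- 2 * \<beta>))"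

lemma sobolev_const_ge:
  assumes "1/2 < \<beta>" "finite R"
  shows "(\<Sum>k\<in>R. (1 + \<bar>real_of_int k\<bar>) powr (- 2 * \<beta>)) \<le> sobolev_const \<beta>"
  unfolding sobolev_const_def
  using summable_on_int_powr[of "2 * \<beta>"] assms by (intro finite_sum_le_infsum) auto

text \<open>A Schur test with the Sobolev weights: the product of the terms \<open>k\<close> and
  \<open>l\<close> equals \<open>(x k * y l) * (x l * y k)\<close> and is split by the inequality
  between arithmetic and geometric mean. Then \<open>x\<close> carries the ellipsoid bound, while
  the squares of \<open>y\<close> over a residue class sum to order
  \<open>n powr (- 2 * \<beta>)\<close>.\<close>

lemma aliasing_bound:
  assumes n: "n \<ge> 1" and F: "finite F" and \<beta>: "1/2 < \<beta>" "\<beta> \<le> 1"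
    and c: "\<And>k. cmod (c k) \<le> 2" "\<And>k. cmod (c k) \<le> 2 * pi * \<bar>real_of_int k\<bar> / real n"
    and \<theta>: "(\<Sum>k\<in>F. (1 + \<bar>real_of_int k\<bar>) powr (2 * \<beta>) * (cmod (\<theta> k))\<^sup>2) \<le> L\<^sup>2"
  shows "(\<Sum>i=1..n. (cmod (\<Sum>k\<in>F. \<theta> k * c k * fourier_e k (real i / real n)))\<^sup>2)
     \<le> real n * (36 * pi\<^sup>2 * sobolev_const \<beta> * L\<^sup>2 * real n powr (- 2 * \<beta>))"
proof -
  define w where "w k = (1 + \<bar>real_of_int k\<bar>) powr \<beta>" for k
  have w0: "w k > 0" for k unfolding w_def by simp
  have w2: "(w k)\<^sup>2 = (1 + \<bar>real_of_int k\<bar>) powr (2 * \<beta>)" for k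
    unfolding w_def by (simp add: powr_power mult.commute)
  have w2': "1 / (w k)\<^sup>2 = (1 + \<bar>real_of_int k\<bar>) powr (- 2 * \<beta>)" for k
    unfolding w2 by (simp add: powr_minus divide_simps)
  define x where "x k = w k * cmod (\<theta> k)" for k
  define y where "y k = cmod (c k) / w k" for k
  define D where "D = 36 * pi\<^sup>2 * real n powr (- 2 * \<beta>) * sobolev_const \<beta>"
  have ysum: "(\<Sum>l\<in>{l\<in>F. int n dvd k - l}. (y l)\<^sup>2) \<le> D" for k
  proof -
    let ?G = "{l\<in>F. int n dvd k - l}"
    \<comment> \<open>Members of one residue class with equal quotients coincide, so the sum over
      the class becomes part of the series \<open>sobolev_const\<close>.\<close>
    have inj: "inj_on (\<lambda>l. l div int n) ?G"
    proof (rule inj_onI)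
      fix l l' assume l: "l \<in> ?G" "l' \<in> ?G" "l div int n = l' div int n"
      then have "l mod int n = l' mod int n" by (simp add: mod_eq_dvd_iff[symmetric])
      with l(3) show "l = l'" by (metis div_mult_mod_eq)
    qed
    have "(\<Sum>l\<in>?G. (y l)\<^sup>2) \<le> (\<Sum>l\<in>?G. 36 * pi\<^sup>2 * real n powr (- 2 * \<beta>) * (1 + \<bar>real_of_int (l div int n)\<bar>) powr (- 2 * \<beta>))"
    proof (rule sum_mono)
      fix l
      have "(y l)\<^sup>2 = (cmod (c l))\<^sup>2 * (1 / (w l)\<^sup>2)" by (simp add: y_def power_divide)
      also have "\<dots> \<le> 36 * pi\<^sup>2 * real n powr (- 2 * \<beta>) * (1 + \<bar>real_of_int (l div int n)\<bar>) powr (- 2 * \<beta>)"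
        unfolding w2' by (rule aliased_weight[OF n \<beta> c])
      finally show "(y l)\<^sup>2 \<le> 36 * pi\<^sup>2 * real n powr (- 2 * \<beta>) * (1 + \<bar>real_of_int (l div int n)\<bar>) powr (- 2 * \<beta>)" .
    qed
    also have "\<dots> = 36 * pi\<^sup>2 * real n powr (- 2 * \<beta>) * (\<Sum>r\<in>(\<lambda>l. l div int n) ` ?G. (1 + \<bar>real_of_int r\<bar>) powr (- 2 * \<beta>))"
      by (simp add: sum.reindex[OF inj] sum_distrib_left)
    also have "\<dots> \<le> D"
      unfolding D_def using F \<beta> by (intro mult_left_mono sobolev_const_ge) auto
    finally show ?thesis .
  qed
  have D0: "D \<ge> 0" using ysum[of 0] by (rule order.trans[rotated]) (auto intro: sum_nonneg)
  let ?S = "\<lambda>g. \<Sum>k\<in>F. \<Sum>l\<in>{l\<in>F. int n dvd k - l}. g k l"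
  have "?S (\<lambda>k l. cmod (\<theta> k * c k) * cmod (\<theta> l * c l)) \<le> ?S (\<lambda>k l. ((x k)\<^sup>2 * (y l)\<^sup>2 + (x l)\<^sup>2 * (y k)\<^sup>2) / 2)"
  proof (intro sum_mono)
    fix k l
    have "cmod (\<theta> k * c k) = x k * y k" for k using w0[of k] by (simp add: x_def y_def norm_mult)
    moreover have "2 * ((x k * y l) * (x l * y k)) \<le> (x k * y l)\<^sup>2 + (x l * y k)\<^sup>2" 
      using sum_squares_bound[of "x k * y l" "x l * y k"] by (simp add: mult.assoc)
    ultimately show "cmod (\<theta> k * c k) * cmod (\<theta> l * c l) \<le> ((x k)\<^sup>2 * (y l)\<^sup>2 + (x l)\<^sup>2 * (y k)\<^sup>2) / 2"
      by (simp add: power_mult_distrib mult_ac)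
  qed
  also have "\<dots> = (?S (\<lambda>k l. (x k)\<^sup>2 * (y l)\<^sup>2) + ?S (\<lambda>k l. (x l)\<^sup>2 * (y k)\<^sup>2)) / 2"
    by (simp add: sum.distrib[symmetric] sum_divide_distrib)
  also have "?S (\<lambda>k l. (x l)\<^sup>2 * (y k)\<^sup>2) = ?S (\<lambda>k l. (x k)\<^sup>2 * (y l)\<^sup>2)"
  proof -
    have "?S g = (\<Sum>k\<in>F. \<Sum>l\<in>F. if int n dvd k - l then g k l else 0)" for g :: "int \<Rightarrow> int \<Rightarrow> real"
      using F by (simp add: sum.inter_filter)
    then show ?thesis
      by (simp only:) (subst sum.swap, simp add: dvd_diff_commute cong: if_cong)
  qed
  also have "(?S (\<lambda>k l. (x k)\<^sup>2 * (y l)\<^sup>2) + ?S (\<lambda>k l. (x k)\<^sup>2 * (y l)\<^sup>2)) / 2 = (\<Sum>k\<in>F. (x k)\<^sup>2 * (\<Sum>l\<in>{l\<in>F. int n dvd k - l}. (y l)\<^sup>2))"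
    by (simp only: sum_distrib_left) simp
  also have "\<dots> \<le> (\<Sum>k\<in>F. (x k)\<^sup>2 * D)"
    by (intro sum_mono mult_left_mono ysum) auto
  also have "\<dots> = (\<Sum>k\<in>F. (1 + \<bar>real_of_int k\<bar>) powr (2 * \<beta>) * (cmod (\<theta> k))\<^sup>2) * D"
    by (simp add: x_def power_mult_distrib w2 sum_distrib_right)
  also have "\<dots> \<le> L\<^sup>2 * D" by (intro mult_right_mono \<theta> D0)
  finally have "?S (\<lambda>k l. cmod (\<theta> k * c k) * cmod (\<theta> l * c l)) \<le> L\<^sup>2 * D" .
  then have "real n * ?S (\<lambda>k l. cmod (\<theta> k * c k) * cmod (\<theta> l * c l)) \<le> real n * (L\<^sup>2 * D)"
    by (rule mult_left_mono) simp
  with aliasing[OF n F, of "\<lambda>k. \<theta> k * c k"] show ?thesis unfolding D_def by (simp add: mult_ac)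
qed

text \<open>Lets the smoothness be lowered to \<open>min \<beta> 1\<close>, the range in which the
  aliasing estimate applies.\<close>

lemma sobolev_ellipsoid_mono:
  assumes "\<beta> \<le> \<beta>'"
  shows "sobolev_ellipsoid \<beta>' L \<subseteq> sobolev_ellipsoid \<beta> L"
proof
  fix f assume f: "f \<in> sobolev_ellipsoid \<beta>' L"
  let ?g = "\<lambda>\<beta> \<theta> k. (1 + \<bar>real_of_int k\<bar>) powr (2 * \<beta>) * (cmod (\<theta> k))\<^sup>2"
  obtain \<theta> where \<theta>: "f \<in> extensional {0..1}" "\<forall>k. \<theta> k = cnj (\<theta> (- k))" 
    "?g \<beta>' \<theta> summable_on UNIV" "infsum (?g \<beta>' \<theta>) UNIV \<le> L\<^sup>2"
    "\<forall>x\<in>{0..1}. ((\<lambda>k. \<theta> k * fourier_e k x) has_sum complex_of_real (f x)) UNIV"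
    using f unfolding sobolev_ellipsoid_def by blast
  have le: "?g \<beta> \<theta> k \<le> ?g \<beta>' \<theta> k" for k
    using assms by (intro mult_right_mono powr_mono) auto
  have s: "?g \<beta> \<theta> summable_on UNIV"
    by (rule summable_on_comparison_test[OF \<theta>(3)]) (use le in auto)
  have "infsum (?g \<beta> \<theta>) UNIV \<le> infsum (?g \<beta>' \<theta>) UNIV"
    by (rule infsum_mono[OF s \<theta>(3)]) (rule le)
  with \<theta>(4) have "infsum (?g \<beta> \<theta>) UNIV \<le> L\<^sup>2" by linarith
  with \<theta> s show "f \<in> sobolev_ellipsoid \<beta> L" unfolding sobolev_ellipsoid_def by blast
qed

text \<open>A summable majorant of the coefficients gives the bound and uniform convergence. The
  increments with a common offset \<open>h\<close> are a Fourier series sampled on the grid; the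
  aliasing bound holds for its finite partial sums and passes to the limit.\<close>

lemma sobolev_properties:
  assumes \<beta>: "1/2 < \<beta>" "\<beta> \<le> 1" and f: "f \<in> sobolev_ellipsoid \<beta> L"
  shows sobolev_bounded: "\<And>x. x \<in> {0..1} \<Longrightarrow> \<bar>f x\<bar> \<le> (L\<^sup>2 + sobolev_const \<beta>) / 2"
    and sobolev_continuous: "continuous_on {0..1} f"
    and sobolev_increments: "\<And>n h. n \<ge> 1 \<Longrightarrow> 0 \<le> h \<Longrightarrow> h \<le> 1 / real n \<Longrightarrow>
      (\<Sum>i=1..n. (f (real (i - 1) / real n + h) - f (real i / real n))\<^sup>2)
        \<le> real n * (36 * pi\<^sup>2 * sobolev_const \<beta> * L\<^sup>2 * real n powr (- 2 * \<beta>))"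
proof -
  let ?w = "\<lambda>k::int. (1 + \<bar>real_of_int k\<bar>) powr (2 * \<beta>)"
  obtain \<theta> where \<theta>: "(\<lambda>k. ?w k * (cmod (\<theta> k))\<^sup>2) summable_on UNIV" "(\<Sum>\<^sub>\<infinity>k. ?w k * (cmod (\<theta> k))\<^sup>2) \<le> L\<^sup>2"
    and hs: "\<And>x. x \<in> {0..1} \<Longrightarrow> ((\<lambda>k. \<theta> k * fourier_e k x) has_sum complex_of_real (f x)) UNIV"
    using f unfolding sobolev_ellipsoid_def by blast
  have fin: "(\<Sum>k\<in>F. ?w k * (cmod (\<theta> k))\<^sup>2) \<le> L\<^sup>2" if "finite F" for F
    using finite_sum_le_infsum[OF \<theta>(1) that] \<theta>(2) by auto
  \<comment> \<open>The two terms come from \<open>2 * a * b \<le> a^2 + b^2\<close> with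
    \<open>a = w * |\<theta> k|\<close> and \<open>b = 1 / w\<close>, where
    \<open>w = (1 + |k|) powr \<beta>\<close>; the second one is summable because
    \<open>\<beta> > 1/2\<close>.\<close>
  define T where "T k = 1 / 2 * (?w k * (cmod (\<theta> k))\<^sup>2 + (1 + \<bar>real_of_int k\<bar>) powr (- 2 * \<beta>))" for k
  have le: "cmod (\<theta> k) \<le> T k" for k
  proof -
    define w where "w = (1 + \<bar>real_of_int k\<bar>) powr \<beta>"
    have w0: "w > 0" unfolding w_def by simp
    have w2: "w\<^sup>2 = ?w k" "(1 / w)\<^sup>2 = (1 + \<bar>real_of_int k\<bar>) powr (- 2 * \<beta>)"
      unfolding w_def by (simp_all add: powr_power mult.commute powr_minus divide_simps)
    have "2 * (w * cmod (\<theta> k)) * (1 / w) \<le> (w * cmod (\<theta> k))\<^sup>2 + (1 / w)\<^sup>2" by (rule sum_squares_bound)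
    then show ?thesis using w0 unfolding T_def w2[symmetric] by (simp add: power_mult_distrib)
  qed
  have s2: "(\<lambda>k. (1 + \<bar>real_of_int k\<bar>) powr (- 2 * \<beta>)) summable_on UNIV"
    using summable_on_int_powr[of "2 * \<beta>"] \<beta> by simp
  have Ts: "T summable_on UNIV"
    unfolding T_def by (intro summable_on_cmult_right summable_on_add \<theta>(1) s2)
  have Ti: "infsum T UNIV \<le> (L\<^sup>2 + sobolev_const \<beta>) / 2"
  proof -
    have "infsum T UNIV = ((\<Sum>\<^sub>\<infinity>k. ?w k * (cmod (\<theta> k))\<^sup>2) + sobolev_const \<beta>) / 2"
      unfolding T_def infsum_cmult_right' sobolev_const_def infsum_add[OF \<theta>(1) s2] by simp
    then show ?thesis using \<theta>(2) by simp
  qed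
  have T0: "T k \<ge> 0" for k using le[of k] norm_ge_zero order.trans by blast
  show "\<bar>f x\<bar> \<le> (L\<^sup>2 + sobolev_const \<beta>) / 2" if "x \<in> {0..1}" for x
  proof -
    have "cmod (complex_of_real (f x)) \<le> (L\<^sup>2 + sobolev_const \<beta>) / 2"
    proof (rule tendsto_upperbound[OF tendsto_norm[OF hs[OF that, unfolded has_sum_def]]])
      show "\<forall>\<^sub>F F in finite_subsets_at_top UNIV. cmod (\<Sum>k\<in>F. \<theta> k * fourier_e k x) \<le> (L\<^sup>2 + sobolev_const \<beta>) / 2"
      proof (rule eventually_finite_subsets_at_top_weakI)
        fix F :: "int set" assume F: "finite F"
        have "cmod (\<Sum>k\<in>F. \<theta> k * fourier_e k x) \<le> (\<Sum>k\<in>F. T k)"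
          using le by (intro order.trans[OF norm_sum] sum_mono) (simp add: norm_mult)
        also have "\<dots> \<le> infsum T UNIV" using T0 by (intro finite_sum_le_infsum Ts F) auto
        finally show "cmod (\<Sum>k\<in>F. \<theta> k * fourier_e k x) \<le> (L\<^sup>2 + sobolev_const \<beta>) / 2" using Ti by linarith
      qed
    qed simp
    then show ?thesis by simp
  qed
  have "uniform_limit {0..1} (\<lambda>F x. \<Sum>k\<in>F. \<theta> k * fourier_e k x) (\<lambda>x. complex_of_real (f x)) (finite_subsets_at_top UNIV)"
    by (rule Weierstrass_m_test_general'[OF _ hs Ts]) (use le in \<open>auto simp: norm_mult\<close>)
  then have "continuous_on {0..1} (\<lambda>x. complex_of_real (f x))"
    by (rule uniform_limit_theorem[rotated]) (auto intro!: always_eventually continuous_intros continuous_on_fourier_e)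
  from continuous_on_Re[OF this] show "continuous_on {0..1} f" by simp
  fix n :: nat and h :: real assume n: "n \<ge> 1" and h: "0 \<le> h" "h \<le> 1 / real n"
  \<comment> \<open>Going from \<open>i / n\<close> to \<open>(i - 1) / n + h\<close> is a
    translation by \<open>h - 1 / n\<close>, the same in all cells and of length at most
    \<open>1 / n\<close>. It multiplies the \<open>k\<close>-th coefficient by a factor;
    \<open>c k\<close> is this factor minus 1.\<close>
  define c where "c k = fourier_e k (h - 1 / real n) - 1" for k
  have c: "cmod (c k) \<le> 2" "cmod (c k) \<le> 2 * pi * \<bar>real_of_int k\<bar> / real n" for k
  proof -
    show "cmod (c k) \<le> 2" unfolding c_def by (rule norm_fourier_e_minus_one)
    have "cmod (c k) \<le> 2 * pi * \<bar>real_of_int k\<bar> * \<bar>h - 1 / real n\<bar>" unfolding c_def by (rule norm_fourier_e_minus_one)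
    also have "\<dots> \<le> 2 * pi * \<bar>real_of_int k\<bar> * (1 / real n)" using h by (intro mult_left_mono) auto
    finally show "cmod (c k) \<le> 2 * pi * \<bar>real_of_int k\<bar> / real n" by simp
  qed
  have lim: "((\<lambda>F. \<Sum>k\<in>F. \<theta> k * c k * fourier_e k (real i / real n)) \<longlongrightarrow> complex_of_real (f (real (i - 1) / real n + h) - f (real i / real n)))
      (finite_subsets_at_top UNIV)" if i: "i \<in> {1..n}" for i
  proof -
    have p: "real (i - 1) / real n + h = real i / real n + (h - 1 / real n)" using i n by (simp add: of_nat_diff field_simps)
    have "0 \<le> real (i - 1) / real n" by simp
    moreover have "real i / real n \<le> 1" using i n by simp
    ultimately have "0 \<le> real (i - 1) / real n + h" "real (i - 1) / real n + h \<le> 1" using h p by linarith+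
    then have in01: "real (i - 1) / real n + h \<in> {0..1}" "real i / real n \<in> {0..1}"
      using \<open>real i / real n \<le> 1\<close> by (simp_all only: atLeastAtMost_iff simp_thms) simp
    have e: "\<theta> k * c k * fourier_e k (real i / real n) = \<theta> k * fourier_e k (real (i - 1) / real n + h) - \<theta> k * fourier_e k (real i / real n)" for k
      unfolding p fourier_e_add c_def by (simp add: algebra_simps)
    show ?thesis
      unfolding e sum_subtractf of_real_diff using hs[OF in01(1)] hs[OF in01(2)] unfolding has_sum_def by (rule tendsto_diff)
  qed
  have "((\<lambda>F. \<Sum>i=1..n. (cmod (\<Sum>k\<in>F. \<theta> k * c k * fourier_e k (real i / real n)))\<^sup>2) \<longlongrightarrow> 
      (\<Sum>i=1..n. (cmod (complex_of_real (f (real (i - 1) / real n + h) - f (real i / real n))))\<^sup>2)) (finite_subsets_at_top UNIV)"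
    by (intro tendsto_sum tendsto_power tendsto_norm lim)
  then have "(\<Sum>i=1..n. (cmod (complex_of_real (f (real (i - 1) / real n + h) - f (real i / real n))))\<^sup>2)
      \<le> real n * (36 * pi\<^sup>2 * sobolev_const \<beta> * L\<^sup>2 * real n powr (- 2 * \<beta>))"
  proof (rule tendsto_upperbound)
    show "\<forall>\<^sub>F F in finite_subsets_at_top UNIV. (\<Sum>i=1..n. (cmod (\<Sum>k\<in>F. \<theta> k * c k * fourier_e k (real i / real n)))\<^sup>2)
      \<le> real n * (36 * pi\<^sup>2 * sobolev_const \<beta> * L\<^sup>2 * real n powr (- 2 * \<beta>))"
      by (rule eventually_finite_subsets_at_top_weakI) (rule aliasing_bound[OF n _ \<beta> c fin])
  qed simp
  then show "(\<Sum>i=1..n. (f (real (i - 1) / real n + h) - f (real i / real n))\<^sup>2)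
        \<le> real n * (36 * pi\<^sup>2 * sobolev_const \<beta> * L\<^sup>2 * real n powr (- 2 * \<beta>))"
    unfolding norm_of_real by simp
qed

subsection \<open>Gaussian spaces\<close>

lemma gaussian_rv_centered:
  assumes M: "prob_space M" and g: "gaussian_rv M X" and m0: "(\<integral>\<omega>. X \<omega> \<partial>M) = 0"
  shows gaussian_rv_square_integrable: "integrable M (\<lambda>\<omega>. (X \<omega>)\<^sup>2)"
    and gaussian_rv_char: "(\<integral>\<omega>. iexp (X \<omega>) \<partial>M) = exp (- (\<integral>\<omega>. (X \<omega>)\<^sup>2 \<partial>M) / 2)"
    and gaussian_rv_std: "(\<integral>\<omega>. (X \<omega>)\<^sup>2 \<partial>M) = 1 \<Longrightarrow> distributed M lborel X std_normal_density"
proof -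
  interpret prob_space M by fact
  have "integrable M (\<lambda>\<omega>. (X \<omega>)\<^sup>2) \<and> (\<integral>\<omega>. iexp (X \<omega>) \<partial>M) = exp (- (\<integral>\<omega>. (X \<omega>)\<^sup>2 \<partial>M) / 2) \<and>
     ((\<integral>\<omega>. (X \<omega>)\<^sup>2 \<partial>M) = 1 \<longrightarrow> distributed M lborel X std_normal_density)"
  proof (cases "\<exists>\<mu> \<sigma>. 0 < \<sigma> \<and> distributed M lborel X (normal_density \<mu> \<sigma>)")
    case True
    then obtain \<mu> \<sigma> where \<sigma>: "0 < \<sigma>" and D: "distributed M lborel X (normal_density \<mu> \<sigma>)" by blast
    have \<mu>: "\<mu> = 0" using normal_distributed_expectation[OF \<sigma> D] m0 by simp
    have var: "(\<integral>\<omega>. (X \<omega>)\<^sup>2 \<partial>M) = \<sigma>\<^sup>2" using normal_distributed_variance[OF \<sigma> D] m0 by simp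
    have i: "integrable M (\<lambda>\<omega>. (X \<omega>)\<^sup>2)"
      using integrable_normal_moment[OF \<sigma>, of \<mu> 2] \<mu>
      by (subst distributed_integrable[OF D, symmetric]) auto
    define Y where "Y \<omega> = X \<omega> / \<sigma>" for \<omega>
    have DY: "distributed M lborel Y std_normal_density"
      using D normal_standard_normal_convert[OF \<sigma>, of X \<mu>] unfolding Y_def \<mu> by simp
    have Y[measurable]: "Y \<in> borel_measurable M" using distributed_measurable[OF DY] by simp
    have dY: "distr M borel Y = density lborel std_normal_density"
      using distributed_distr_eq_density[OF DY] by (metis distr_cong sets_lborel)
    have "(\<integral>\<omega>. iexp (X \<omega>) \<partial>M) = (\<integral>\<omega>. iexp (\<sigma> * Y \<omega>) \<partial>M)" using \<sigma> by (simp add: Y_def)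
    also have "\<dots> = char (distr M borel Y) \<sigma>" unfolding char_def by (subst integral_distr) auto
    also have "\<dots> = exp (- (\<sigma>\<^sup>2) / 2)"
      unfolding dY using fun_cong[OF char_std_normal_distribution, of \<sigma>] by (simp add: exp_of_real)
    finally have "(\<integral>\<omega>. iexp (X \<omega>) \<partial>M) = exp (- (\<sigma>\<^sup>2) / 2)" .
    moreover have "\<sigma> = 1" if "\<sigma>\<^sup>2 = 1" using that \<sigma> by (simp add: power2_eq_1_iff)
    ultimately show ?thesis using i var D \<mu> by auto
  next
    case False
    then obtain c where c: "AE \<omega> in M. X \<omega> = c" and [measurable]: "X \<in> borel_measurable M" using g unfolding gaussian_rv_def by auto
    have "(\<integral>\<omega>. X \<omega> \<partial>M) = (\<integral>\<omega>. c \<partial>M)" by (intro integral_cong_AE c) auto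
    then have "c = 0" using m0 by (simp add: prob_space)
    then have ae: "AE \<omega> in M. X \<omega> = 0" using c by simp
    have i: "integrable M (\<lambda>\<omega>. (X \<omega>)\<^sup>2)"
      by (rule integrable_cong_AE[THEN iffD2, of _ _ "\<lambda>_. 0"]) (use ae in auto)
    have 2: "(\<integral>\<omega>. (X \<omega>)\<^sup>2 \<partial>M) = (\<integral>\<omega>. 0 \<partial>M)" by (intro integral_cong_AE) (use ae in auto)
    have 3: "(\<integral>\<omega>. iexp (X \<omega>) \<partial>M) = (\<integral>\<omega>. 1 \<partial>M)" by (intro integral_cong_AE) (use ae in auto)
    show ?thesis using i 2 3 by (simp add: prob_space)
  qed
  then show "integrable M (\<lambda>\<omega>. (X \<omega>)\<^sup>2)" "(\<integral>\<omega>. iexp (X \<omega>) \<partial>M) = exp (- (\<integral>\<omega>. (X \<omega>)\<^sup>2 \<partial>M) / 2)"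
    "(\<integral>\<omega>. (X \<omega>)\<^sup>2 \<partial>M) = 1 \<Longrightarrow> distributed M lborel X std_normal_density" by blast+
qed

lemma gaussian_rv_integrable:
  assumes M: "prob_space M" and g: "gaussian_rv M X"
  shows "integrable M X"
proof -
  interpret prob_space M by fact
  show ?thesis
  proof (cases "\<exists>\<mu> \<sigma>. 0 < \<sigma> \<and> distributed M lborel X (normal_density \<mu> \<sigma>)")
    case True
    then obtain \<mu> \<sigma> where \<sigma>: "0 < \<sigma>" and D: "distributed M lborel X (normal_density \<mu> \<sigma>)" by blast
    show ?thesis using integrable_normal_moment_nz_1[OF \<sigma>, of \<mu>]
      by (subst distributed_integrable[OF D, of "\<lambda>x. x", symmetric]) auto
  next
    case False
    then obtain c where c: "AE \<omega> in M. X \<omega> = c" and [measurable]: "X \<in> borel_measurable M" using g unfolding gaussian_rv_def by auto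
    show ?thesis by (rule integrable_cong_AE[THEN iffD2, of _ _ "\<lambda>_. c"]) (use c in auto)
  qed
qed

text \<open>Closure under linear combinations makes every joint characteristic function a function
  of second moments, so orthogonal families are independent. As the variables are centered,
  \<open>Cov\<close> can be the plain second moment.\<close>

locale gaussian_space = prob_space M for M :: "'a measure" +
  fixes S :: "('a \<Rightarrow> real) set"
  assumes gaussian: "X \<in> S \<Longrightarrow> gaussian_rv M X"
    and centered: "X \<in> S \<Longrightarrow> (\<integral>\<omega>. X \<omega> \<partial>M) = 0"
    and zero_mem: "(\<lambda>_. 0) \<in> S"
    and lin_mem: "X \<in> S \<Longrightarrow> Y \<in> S \<Longrightarrow> (\<lambda>\<omega>. a * X \<omega> + b * Y \<omega>) \<in> S"
begin

abbreviation Cov :: "('a \<Rightarrow> real) \<Rightarrow> ('a \<Rightarrow> real) \<Rightarrow> real" where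
  "Cov X Y \<equiv> \<integral>\<omega>. X \<omega> * Y \<omega> \<partial>M"

lemma meas: "X \<in> S \<Longrightarrow> X \<in> borel_measurable M"
  using gaussian by (auto simp: gaussian_rv_def)

lemma scale_mem: "X \<in> S \<Longrightarrow> (\<lambda>\<omega>. a * X \<omega>) \<in> S"
  using lin_mem[of X X a 0] by simp

lemma diff_mem: "X \<in> S \<Longrightarrow> Y \<in> S \<Longrightarrow> (\<lambda>\<omega>. X \<omega> - Y \<omega>) \<in> S"
  using lin_mem[of X Y 1 "-1"] by simp

lemma sum_mem:
  assumes "finite J" "\<And>i. i \<in> J \<Longrightarrow> X i \<in> S"
  shows "(\<lambda>\<omega>. \<Sum>i\<in>J. c i * X i \<omega>) \<in> S"
  using assms
proof (induction J)
  case empty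
  then show ?case by (simp add: zero_mem)
next
  case (insert j J)
  then show ?case using lin_mem[of "X j" "\<lambda>\<omega>. \<Sum>i\<in>J. c i * X i \<omega>" "c j" 1] by simp
qed

text \<open>By polarization from the second moments of \<open>X\<close>, \<open>Y\<close> and
  \<open>X + Y\<close>.\<close>

lemma integrable_mult: 
  assumes "X \<in> S" "Y \<in> S" shows "integrable M (\<lambda>\<omega>. X \<omega> * Y \<omega>)"
proof -
  have "integrable M (\<lambda>\<omega>. ((X \<omega> + Y \<omega>)\<^sup>2 - (X \<omega>)\<^sup>2 - (Y \<omega>)\<^sup>2) / 2)"
    using lin_mem[OF assms, of 1 1] assms
    by (intro Bochner_Integration.integrable_diff integrable_divide_zero gaussian_rv_square_integrable[OF prob_space_axioms gaussian centered]) auto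
  then show ?thesis by (simp add: power2_sum)
qed

lemma inner_sum_left:
  assumes "finite J" "\<And>i. i \<in> J \<Longrightarrow> X i \<in> S" "Y \<in> S"
  shows "(\<integral>\<omega>. (\<Sum>i\<in>J. c i * X i \<omega>) * Y \<omega> \<partial>M) = (\<Sum>i\<in>J. c i * Cov (X i) Y)"
proof -
  have "(\<integral>\<omega>. (\<Sum>i\<in>J. c i * X i \<omega>) * Y \<omega> \<partial>M) = (\<integral>\<omega>. (\<Sum>i\<in>J. c i * (X i \<omega> * Y \<omega>)) \<partial>M)"
    by (simp add: sum_distrib_right mult.assoc)
  also have "\<dots> = (\<Sum>i\<in>J. c i * Cov (X i) Y)"
    using assms by (subst Bochner_Integration.integral_sum) (auto intro!: integrable_mult)
  finally show ?thesis .
qed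

lemma char_eq: "X \<in> S \<Longrightarrow> (\<integral>\<omega>. iexp (X \<omega>) \<partial>M) = exp (- Cov X X / 2)"
  using gaussian_rv_char[OF prob_space_axioms gaussian centered] by (simp add: power2_eq_square)

text \<open>The part linear in \<open>Z\<close> and the residual are uncorrelated, so the
  characteristic function of their sum factorises and they may be taken from two copies of the
  probability space. This serves twice: to isolate the direction of a Cameron-Martin shift, and to
  split the process into grid values and bridge.\<close>

lemma decoupling:
  fixes X R :: "'i \<Rightarrow> 'a \<Rightarrow> real" and Z :: "'k \<Rightarrow> 'a \<Rightarrow> real"
  assumes J: "finite J" and I: "finite I" and X: "\<And>i. i \<in> J \<Longrightarrow> X i \<in> S" and Z: "\<And>k. k \<in> I \<Longrightarrow> Z k \<in> S"
    and R: "\<And>i \<omega>. i \<in> J \<Longrightarrow> R i \<omega> = X i \<omega> - (\<Sum>k\<in>I. a i k * Z k \<omega>)"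
    and orth: "\<And>i k. i \<in> J \<Longrightarrow> k \<in> I \<Longrightarrow> Cov (R i) (Z k) = 0"
  shows "distr M (\<Pi>\<^sub>M i\<in>J. borel) (\<lambda>\<omega>. \<lambda>i\<in>J. X i \<omega>) =
    distr (M \<Otimes>\<^sub>M M) (\<Pi>\<^sub>M i\<in>J. borel) (\<lambda>p. \<lambda>i\<in>J. (\<Sum>k\<in>I. a i k * Z k (fst p)) + R i (snd p))"
proof (rule char_function_unique_PiM[OF _ _ J])
  interpret P: pair_prob_space M M ..
  show "prob_space M" "prob_space (M \<Otimes>\<^sub>M M)" by unfold_locales
  show "X i \<in> borel_measurable M" if "i \<in> J" for i using that X meas by auto
  have RS: "R i \<in> S" if "i \<in> J" for i
  proof -
    have "R i = (\<lambda>\<omega>. X i \<omega> - (\<Sum>k\<in>I. a i k * Z k \<omega>))" using R[OF that] by (rule ext)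
    then show ?thesis using diff_mem[OF X[OF that] sum_mem[OF I Z, where c="a i"]] by simp
  qed
  have VS: "(\<lambda>\<omega>. \<Sum>k\<in>I. a i k * Z k \<omega>) \<in> S" for i by (rule sum_mem[OF I Z])
  note m = measurable_compose[OF measurable_fst] measurable_compose[OF measurable_snd]
  show "(\<lambda>p. (\<Sum>k\<in>I. a i k * Z k (fst p)) + R i (snd p)) \<in> borel_measurable (M \<Otimes>\<^sub>M M)" if "i \<in> J" for i
    by (intro borel_measurable_add m(1)[OF meas[OF VS]] m(2)[OF meas[OF RS[OF that]]])
  fix t :: "'i \<Rightarrow> real"
  define U where "U \<omega> = (\<Sum>i\<in>J. t i * R i \<omega>)" for \<omega>
  define V where "V \<omega> = (\<Sum>i\<in>J. t i * (\<Sum>k\<in>I. a i k * Z k \<omega>))" for \<omega>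
  have US: "U \<in> S" unfolding U_def by (rule sum_mem[OF J RS])
  have VS': "V \<in> S" unfolding V_def by (rule sum_mem[OF J VS])
  have UV: "Cov U V = 0"
  proof -
    have "Cov V (R i) = 0" if i: "i \<in> J" for i
    proof -
      have "(\<integral>\<omega>. (\<Sum>k\<in>I. a j k * Z k \<omega>) * R i \<omega> \<partial>M) = 0" for j
        by (subst inner_sum_left[OF I Z RS[OF i]]) (use orth[OF i] in \<open>auto simp: mult.commute[of "Z _ _"]\<close>)
      then show ?thesis unfolding V_def by (subst inner_sum_left[OF J VS RS[OF i]]) simp
    qed
    then show ?thesis unfolding U_def by (subst inner_sum_left[OF J RS VS']) (simp_all add: mult.commute)
  qed
  have SUM: "(\<Sum>i\<in>J. t i * X i \<omega>) = V \<omega> + U \<omega>" for \<omega>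
    unfolding U_def V_def sum.distrib[symmetric] by (intro sum.cong) (auto simp: R algebra_simps)
  have VU: "(\<lambda>\<omega>. V \<omega> + U \<omega>) \<in> S" using lin_mem[OF VS' US, of 1 1] by simp
  have "(\<integral>\<omega>. (V \<omega> + U \<omega>) * (V \<omega> + U \<omega>) \<partial>M) = (\<integral>\<omega>. V \<omega> * V \<omega> + 2 * (U \<omega> * V \<omega>) + U \<omega> * U \<omega> \<partial>M)"
    by (intro Bochner_Integration.integral_cong) (auto simp: algebra_simps)
  also have "\<dots> = Cov V V + Cov U U"
    using UV by (simp add: integrable_mult US VS')
  finally have "(\<integral>\<omega>. iexp (V \<omega> + U \<omega>) \<partial>M) = (\<integral>\<omega>. iexp (V \<omega>) \<partial>M) * (\<integral>\<omega>. iexp (U \<omega>) \<partial>M)"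
    unfolding char_eq[OF VU] char_eq[OF VS'] char_eq[OF US] by (simp add: exp_add[symmetric] diff_divide_distrib of_real_mult[symmetric] del: of_real_mult)
  also have "\<dots> = (\<integral>p. iexp (V (fst p)) * iexp (U (snd p)) \<partial>(M \<Otimes>\<^sub>M M))"
  proof -
    have [measurable]: "U \<in> borel_measurable M" "V \<in> borel_measurable M" using US VS' meas by auto
    have i: "integrable (M \<Otimes>\<^sub>M M) (\<lambda>p. iexp (V (fst p)) * iexp (U (snd p)))"
      by (intro P.P.integrable_const_bound[where B=1] AE_I2) (auto simp: norm_mult)
    show ?thesis
      by (subst P.integral_fst'[OF i, symmetric]) simp
  qed
  also have "\<dots> = (\<integral>p. iexp (\<Sum>i\<in>J. t i * ((\<Sum>k\<in>I. a i k * Z k (fst p)) + R i (snd p))) \<partial>(M \<Otimes>\<^sub>M M))"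
    unfolding U_def V_def by (simp add: exp_add[symmetric] algebra_simps sum.distrib)
  finally show "(\<integral>\<omega>. iexp (\<Sum>i\<in>J. t i * X i \<omega>) \<partial>M) 
    = (\<integral>p. iexp (\<Sum>i\<in>J. t i * ((\<Sum>k\<in>I. a i k * Z k (fst p)) + R i (snd p))) \<partial>(M \<Otimes>\<^sub>M M))"
    unfolding SUM .
qed

end

section \<open>Translates of normal laws\<close>

text \<open>The gain is largest on the half-line where the shifted density dominates. It begins at
  \<open>c/2\<close>, where both densities agree, and there the gain is the normal mass of an
  interval of length \<open>c\<close>, which is at most \<open>c\<close> as the density does not
  exceed 1.\<close>

lemma std_normal_shift_aux:
  fixes c :: real
  assumes c: "c \<ge> 0" and A[measurable]: "A \<in> sets borel"
  shows "measure std_normal_distribution {x. x + c \<in> A} \<le> measure std_normal_distribution A + c"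
proof -
  let ?N = "std_normal_distribution" and ?p = "std_normal_density"
  interpret N: real_distribution ?N by (rule real_dist_normal_dist)
  have i: "integrable lborel ?p" by (rule integrable_normal_density) simp
  have ic: "integrable lborel (\<lambda>x. ?p (x - c))"
    using lborel_integrable_real_affine[OF i, of 1 "-c"] by (simp add: algebra_simps)
  have N: "measure ?N B = (\<integral>x. indicator B x * ?p x \<partial>lborel)" if [measurable]: "B \<in> sets borel" for B
  proof -
    have "measure ?N B = (\<integral>x. indicator B x \<partial>?N)" by simp
    also have "\<dots> = (\<integral>x. indicator B x * ?p x \<partial>lborel)" by (subst integral_density) (auto simp: mult.commute)
    finally show ?thesis .
  qed
  have Nc: "measure ?N {x. x + c \<in> B} = (\<integral>x. indicator B x * ?p (x - c) \<partial>lborel)" if [measurable]: "B \<in> sets borel" for B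
  proof -
    have "measure ?N {x. x + c \<in> B} = (\<integral>x. indicator B (x + c) * ?p x \<partial>lborel)"
      by (subst N) (auto intro!: Bochner_Integration.integral_cong simp: indicator_def)
    also have "\<dots> = (\<integral>x. indicator B x * ?p (x - c) \<partial>lborel)"
      using lborel_integral_real_affine[of 1 "\<lambda>x. indicator B x * ?p (x - c)" c] by (simp add: add.commute)
    finally show ?thesis .
  qed
  have ii: "integrable lborel (\<lambda>x. indicator B x * ?p x)" "integrable lborel (\<lambda>x. indicator B x * ?p (x - c))"
    if [measurable]: "B \<in> sets borel" for B
    using integrable_mult_indicator[OF _ i, of B] integrable_mult_indicator[OF _ ic, of B] by auto
  define H where "H = {c/2..}"
  have [measurable]: "H \<in> sets borel" unfolding H_def by simp
  have pc: "?p (x - c) \<ge> ?p x \<longleftrightarrow> x \<in> H \<or> c = 0" for x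
  proof -
    have "?p (x - c) \<ge> ?p x \<longleftrightarrow> (x - c)\<^sup>2 \<le> x\<^sup>2" by (simp add: normal_density_def field_simps)
    also have "\<dots> \<longleftrightarrow> c * c \<le> c * (2 * x)" by (auto simp: power2_eq_square algebra_simps)
    finally show ?thesis using c by (auto simp: H_def mult_le_cancel_left)
  qed
  have "measure ?N {x. x + c \<in> A} - measure ?N A = (\<integral>x. indicator A x * ?p (x - c) - indicator A x * ?p x \<partial>lborel)"
    unfolding Nc[OF A] N[OF A] by (simp add: ii)
  also have "\<dots> \<le> (\<integral>x. indicator H x * ?p (x - c) - indicator H x * ?p x \<partial>lborel)"
  proof (rule integral_mono)
    fix x :: real
    show "indicator A x * ?p (x - c) - indicator A x * ?p x \<le> indicator H x * ?p (x - c) - indicator H x * ?p x"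
      using pc[of x] by (auto simp: indicator_def)
  qed (auto intro!: Bochner_Integration.integrable_diff ii)
  also have "\<dots> = measure ?N {x. x + c \<in> H} - measure ?N H"
    unfolding Nc[OF \<open>H \<in> sets borel\<close>] N[OF \<open>H \<in> sets borel\<close>] by (simp add: ii)
  also have "\<dots> = measure ?N ({x. x + c \<in> H} - H)"
    by (subst N.finite_measure_Diff) (use c in \<open>auto simp: H_def\<close>)
  also have "{x. x + c \<in> H} - H = {-c/2..<c/2}" by (auto simp: H_def field_simps)
  also have "measure ?N {-c/2..<c/2} = (\<integral>x. indicator {-c/2..<c/2} x * ?p x \<partial>lborel)" by (simp add: N)
  also have "\<dots> \<le> (\<integral>x. indicator {-c/2..<c/2} x \<partial>lborel)"
  proof (rule integral_mono)
    fix x :: real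
    have "?p x \<le> 1"
    proof -
      have "?p x = exp (- x\<^sup>2 / 2) / sqrt (2 * pi)" by (simp add: normal_density_def)
      also have "\<dots> \<le> 1 / 1"
        using pi_ge_two by (intro frac_le) auto
      finally show ?thesis by simp
    qed
    then show "indicator {-c/2..<c/2} x * ?p x \<le> indicator {-c/2..<c/2} x" by (auto simp: indicator_def)
  qed (use c in \<open>auto intro!: ii integrable_real_indicator simp: emeasure_lborel_Ico\<close>)
  also have "\<dots> = c" using c by (simp add: measure_def emeasure_lborel_Ico)
  finally show ?thesis by simp
qed

text \<open>The opposite inequality comes from the complement of \<open>A\<close>; for negative
  \<open>c\<close> the roles of \<open>A\<close> and its translate are exchanged.\<close>

lemma std_normal_shift:
  assumes A[measurable]: "A \<in> sets borel"
  shows "\<bar>measure std_normal_distribution {x. x + c \<in> A} - measure std_normal_distribution A\<bar> \<le> \<bar>c\<bar>"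
proof -
  let ?N = "std_normal_distribution"
  interpret N: real_distribution ?N by (rule real_dist_normal_dist)
  have compl: "measure ?N {x. x + c \<in> - B} = 1 - measure ?N {x. x + c \<in> B}" "measure ?N (- B) = 1 - measure ?N B" 
    if [measurable]: "B \<in> sets borel" for B c
    using N.prob_compl[of "{x. x + c \<in> B}"] N.prob_compl[of B] that
    by (auto simp: Collect_neg_eq[symmetric] Compl_eq_Diff_UNIV[symmetric])
  have main: "\<bar>measure ?N {x. x + c \<in> B} - measure ?N B\<bar> \<le> c" if "c \<ge> 0" and [measurable]: "B \<in> sets borel" for c B
    using std_normal_shift_aux[OF that] std_normal_shift_aux[OF that(1), of "- B"] compl[OF that(2)] that by auto
  show ?thesis
  proof (cases "c \<ge> 0")
    case True
    then show ?thesis using main[OF True A] by simp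
  next
    case False
    have [measurable]: "{x. x + c \<in> A} \<in> sets borel" by measurable
    have "{x. x + (- c) \<in> {x. x + c \<in> A}} = A" by auto
    then show ?thesis using main[of "-c" "{x. x + c \<in> A}"] False by auto
  qed
qed

context gaussian_space
begin

text \<open>The Cameron--Martin shift \<open>h\<close> only moves the coordinate \<open>Z0\<close>, so that decoupling it
  from the rest reduces the claim to the one-dimensional normal law.\<close>

lemma shift_bound:
  fixes X :: "'i \<Rightarrow> 'a \<Rightarrow> real"
  assumes J: "finite J" and X: "\<And>i. i \<in> J \<Longrightarrow> X i \<in> S" and Z0: "Z0 \<in> S"
    and h: "\<And>i. i \<in> J \<Longrightarrow> Cov (X i) Z0 = h i"
    and c: "Cov Z0 Z0 = c\<^sup>2" "c \<ge> 0" and E: "E \<in> sets (\<Pi>\<^sub>M i\<in>J. borel)"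
  shows "\<bar>measure M {\<omega>\<in>space M. (\<lambda>i\<in>J. X i \<omega> + h i) \<in> E} - measure M {\<omega>\<in>space M. (\<lambda>i\<in>J. X i \<omega>) \<in> E}\<bar> \<le> c"
proof (cases "c = 0")
  \<comment> \<open>A vanishing second moment forces \<open>Z0 = 0\<close> almost surely, hence
    \<open>h = 0\<close> on \<open>J\<close>: nothing is shifted.\<close>
  case True
  have [measurable]: "Z0 \<in> borel_measurable M" using Z0 meas by auto
  have "AE \<omega> in M. Z0 \<omega> * Z0 \<omega> = 0"
    using c True integral_nonneg_eq_0_iff_AE[OF integrable_mult[OF Z0 Z0]] by auto
  then have ae: "AE \<omega> in M. Z0 \<omega> = 0" by simp
  have "h i = 0" if i: "i \<in> J" for i
  proof -
    have [measurable]: "X i \<in> borel_measurable M" using X[OF i] meas by auto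
    have "h i = (\<integral>\<omega>. 0 \<partial>M)" unfolding h[OF i, symmetric]
      by (intro integral_cong_AE) (use ae in auto)
    then show ?thesis by simp
  qed
  then have "(\<lambda>i\<in>J. X i \<omega> + h i) = (\<lambda>i\<in>J. X i \<omega>)" for \<omega> by auto
  then show ?thesis using c by simp
next
  case False
  then have c0: "c > 0" using c by simp
  interpret P: pair_prob_space M M ..
  define Z where "Z \<omega> = (1/c) * Z0 \<omega>" for \<omega>
  \<comment> \<open>The regression coefficient of \<open>X i\<close> on the normalised variable
    \<open>Z\<close>. Since \<open>m i * c = h i\<close>, adding \<open>h\<close> amounts to
    replacing \<open>Z\<close> by \<open>Z + c\<close>.\<close>
  define m where "m i = h i / c" for i
  define R where "R i \<omega> = X i \<omega> - m i * Z \<omega>" for i \<omega>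
  have ZS: "Z \<in> S" unfolding Z_def by (rule scale_mem[OF Z0])
  have [measurable]: "Z \<in> borel_measurable M" by (rule meas[OF ZS])
  have ZZ: "Cov Z Z = 1"
  proof -
    have "Cov Z Z = (\<integral>\<omega>. (Z0 \<omega> * Z0 \<omega>) / c\<^sup>2 \<partial>M)"
      unfolding Z_def by (intro Bochner_Integration.integral_cong) (auto simp: power2_eq_square)
    then show ?thesis using c c0 by simp
  qed
  have XZ: "Cov (X i) Z = m i" if i: "i \<in> J" for i
  proof -
    have "Cov (X i) Z = (\<integral>\<omega>. (X i \<omega> * Z0 \<omega>) / c \<partial>M)"
      unfolding Z_def by (intro Bochner_Integration.integral_cong) auto
    then show ?thesis using h[OF i] by (simp add: m_def)
  qed
  have RZ: "Cov (R i) Z = 0" if i: "i \<in> J" for i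
  proof -
    have "Cov (R i) Z = (\<integral>\<omega>. X i \<omega> * Z \<omega> - m i * (Z \<omega> * Z \<omega>) \<partial>M)"
      unfolding R_def by (intro Bochner_Integration.integral_cong) (auto simp: algebra_simps)
    also have "\<dots> = 0" using XZ[OF i] ZZ by (simp add: integrable_mult X[OF i] ZS)
    finally show ?thesis .
  qed
  have RS: "R i \<in> S" if "i \<in> J" for i
    unfolding R_def by (intro diff_mem X that scale_mem ZS)
  let ?B = "\<Pi>\<^sub>M i\<in>J. (borel :: real measure)"
  have D: "distr M ?B (\<lambda>\<omega>. \<lambda>i\<in>J. X i \<omega>) =
    distr (M \<Otimes>\<^sub>M M) ?B (\<lambda>p. \<lambda>i\<in>J. m i * Z (fst p) + R i (snd p))"
    using decoupling[OF J, of "{()}" X "\<lambda>_. Z" R "\<lambda>i _. m i"] X ZS RZ by (simp add: R_def)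
  have mX: "(\<lambda>\<omega>. \<lambda>i\<in>J. X i \<omega>) \<in> M \<rightarrow>\<^sub>M ?B" by (intro measurable_restrict meas X)
  note mm = measurable_compose[OF measurable_fst] measurable_compose[OF measurable_snd]
  have mP: "(\<lambda>p. \<lambda>i\<in>J. m i * Z (fst p) + R i (snd p)) \<in> M \<Otimes>\<^sub>M M \<rightarrow>\<^sub>M ?B"
    by (intro measurable_restrict borel_measurable_add borel_measurable_times borel_measurable_const mm(1)[OF meas[OF ZS]] mm(2)[OF meas[OF RS]])
  have prob: "measure M {\<omega>\<in>space M. (\<lambda>i\<in>J. X i \<omega>) \<in> E'} = measure (M \<Otimes>\<^sub>M M) {p\<in>space (M \<Otimes>\<^sub>M M). (\<lambda>i\<in>J. m i * Z (fst p) + R i (snd p)) \<in> E'}"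
    if "E' \<in> sets ?B" for E'
  proof -
    have "measure (distr M ?B (\<lambda>\<omega>. \<lambda>i\<in>J. X i \<omega>)) E' = measure (distr (M \<Otimes>\<^sub>M M) ?B (\<lambda>p. \<lambda>i\<in>J. m i * Z (fst p) + R i (snd p))) E'"
      unfolding D ..
    then show ?thesis unfolding measure_distr[OF mX that] measure_distr[OF mP that] by (simp add: vimage_def Int_def conj_commute)
  qed
  have shE: "{x\<in>space ?B. (\<lambda>i\<in>J. x i + h i) \<in> E} \<in> sets ?B"
  proof -
    have "(\<lambda>x. \<lambda>i\<in>J. x i + h i) \<in> ?B \<rightarrow>\<^sub>M ?B" by (intro measurable_restrict) measurable
    from measurable_sets[OF this E] show ?thesis by (simp add: vimage_def Int_def conj_commute)
  qed
  have sh1: "{\<omega>\<in>space M. (\<lambda>i\<in>J. X i \<omega> + h i) \<in> E} = {\<omega>\<in>space M. (\<lambda>i\<in>J. X i \<omega>) \<in> {x\<in>space ?B. (\<lambda>i\<in>J. x i + h i) \<in> E}}"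
    by (auto simp: space_PiM cong: restrict_cong)
  have sh2: "{p\<in>space (M \<Otimes>\<^sub>M M). (\<lambda>i\<in>J. m i * Z (fst p) + R i (snd p)) \<in> {x\<in>space ?B. (\<lambda>i\<in>J. x i + h i) \<in> E}}
     = {p\<in>space (M \<Otimes>\<^sub>M M). (\<lambda>i\<in>J. m i * (Z (fst p) + c) + R i (snd p)) \<in> E}"
  proof -
    have "(\<lambda>i\<in>J. (\<lambda>i\<in>J. m i * Z (fst p) + R i (snd p)) i + h i) = (\<lambda>i\<in>J. m i * (Z (fst p) + c) + R i (snd p))" for p
      using c0 by (auto simp: m_def field_simps)
    then show ?thesis by (auto simp: space_PiM)
  qed
  define Q where "Q d = {p\<in>space (M \<Otimes>\<^sub>M M). (\<lambda>i\<in>J. m i * (Z (fst p) + d) + R i (snd p)) \<in> E}" for d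
  have mQ: "Q d \<in> sets (M \<Otimes>\<^sub>M M)" for d
  proof -
    have "(\<lambda>p. \<lambda>i\<in>J. m i * (Z (fst p) + d) + R i (snd p)) \<in> M \<Otimes>\<^sub>M M \<rightarrow>\<^sub>M ?B"
      by (intro measurable_restrict borel_measurable_add borel_measurable_times borel_measurable_const mm(1)[OF meas[OF ZS]] mm(2)[OF meas[OF RS]])
    from measurable_sets[OF this E] show ?thesis unfolding Q_def by (simp add: vimage_def Int_def conj_commute)
  qed
  \<comment> \<open>The section of the event at a fixed residual: there the shift concerns a single
    standard normal variable, and the bound \<open>c\<close> survives integration over the
    residual.\<close>
  define A where "A y = {z. (\<lambda>i\<in>J. m i * z + R i y) \<in> E}" for y
  have Ab[measurable]: "A y \<in> sets borel" for y
  proof -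
    have "(\<lambda>z. \<lambda>i\<in>J. m i * z + R i y) \<in> borel \<rightarrow>\<^sub>M ?B" by (intro measurable_restrict) measurable
    from measurable_sets[OF this E] show ?thesis unfolding A_def by (simp add: vimage_def)
  qed
  have dZ: "distr M borel Z = std_normal_distribution"
  proof -
    have "distributed M lborel Z std_normal_density"
      using gaussian_rv_std[OF prob_space_axioms gaussian[OF ZS] centered[OF ZS]] ZZ by (simp add: power2_eq_square)
    from distributed_distr_eq_density[OF this] show ?thesis by (metis distr_cong sets_lborel)
  qed
  have fib: "emeasure M ((\<lambda>x. (x, y)) -` Q d) = ennreal (measure std_normal_distribution {z. z + d \<in> A y})" if "y \<in> space M" for y d
  proof -
    have "(\<lambda>x. (x, y)) -` Q d = Z -` {z. z + d \<in> A y} \<inter> space M"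
      using that unfolding Q_def A_def by (auto simp: space_pair_measure)
    then have "emeasure M ((\<lambda>x. (x, y)) -` Q d) = emeasure (distr M borel Z) {z. z + d \<in> A y}"
      by (subst emeasure_distr) auto
    also have "\<dots> = ennreal (measure (distr M borel Z) {z. z + d \<in> A y})"
      using prob_space_distr[of Z borel] by (simp add: finite_measure.emeasure_eq_measure prob_space_def)
    finally show ?thesis unfolding dZ .
  qed
  have em: "emeasure (M \<Otimes>\<^sub>M M) (Q d) = (\<integral>\<^sup>+y. ennreal (measure std_normal_distribution {z. z + d \<in> A y}) \<partial>M)" for d
    unfolding P.emeasure_pair_measure_alt2[OF mQ] using fib by (intro nn_integral_cong) auto
  have cmp: "measure (M \<Otimes>\<^sub>M M) (Q d) \<le> measure (M \<Otimes>\<^sub>M M) (Q d') + c" 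
    if "\<And>y. measure std_normal_distribution {z. z + d \<in> A y} \<le> measure std_normal_distribution {z. z + d' \<in> A y} + c" for d d'
  proof -
    have mfib: "(\<lambda>y. ennreal (measure std_normal_distribution {z. z + d' \<in> A y})) \<in> borel_measurable M"
      using P.measurable_emeasure_Pair2[OF mQ[of d']] by (rule measurable_cong[THEN iffD1, rotated]) (rule fib)
    have "emeasure (M \<Otimes>\<^sub>M M) (Q d) \<le> (\<integral>\<^sup>+y. ennreal (measure std_normal_distribution {z. z + d' \<in> A y}) + ennreal c \<partial>M)"
      unfolding em using that c0 by (intro nn_integral_mono) (simp add: ennreal_plus[symmetric] del: ennreal_plus)
    also have "\<dots> = emeasure (M \<Otimes>\<^sub>M M) (Q d') + ennreal c"
      unfolding em using mfib by (subst nn_integral_add) (auto simp: emeasure_space_1)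
    finally show ?thesis
      using c0 unfolding P.P.emeasure_eq_measure by (simp add: ennreal_plus[symmetric] del: ennreal_plus)
  qed
  have shift: "\<bar>measure std_normal_distribution {z. z + c \<in> A y} - measure std_normal_distribution {z. z + 0 \<in> A y}\<bar> \<le> c" for y
    using std_normal_shift[OF Ab[of y], of c] c0 unfolding add_0_right Collect_mem_eq by linarith
  have "measure (M \<Otimes>\<^sub>M M) (Q c) \<le> measure (M \<Otimes>\<^sub>M M) (Q 0) + c" "measure (M \<Otimes>\<^sub>M M) (Q 0) \<le> measure (M \<Otimes>\<^sub>M M) (Q c) + c"
    using shift by (intro cmp; simp add: abs_le_iff algebra_simps)+
  moreover have "measure M {\<omega>\<in>space M. (\<lambda>i\<in>J. X i \<omega> + h i) \<in> E} = measure (M \<Otimes>\<^sub>M M) (Q c)"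
    unfolding sh1 prob[OF shE] sh2 Q_def ..
  moreover have "measure M {\<omega>\<in>space M. (\<lambda>i\<in>J. X i \<omega>) \<in> E} = measure (M \<Otimes>\<^sub>M M) (Q 0)"
    unfolding prob[OF E] Q_def by simp
  ultimately show ?thesis by (simp add: abs_le_iff)
qed

end

section \<open>The reproducing kernel norm on finitely many times\<close>

text \<open>Adding a largest point \<open>b\<close> with predecessor \<open>m\<close> only changes the coefficients at \<open>m\<close> and \<open>b\<close>, and
  it raises the quadratic form by \<open>(H b - H m)\<^sup>2 / (q b - q m)\<close>.\<close>

lemma interpolation_coefficients:
  fixes q H e :: "real \<Rightarrow> real"
  assumes q0: "q 0 = 0" and H0: "H 0 = 0" and q: "strict_mono_on {0..1} q"
    and e: "\<And>s t. 0 \<le> s \<Longrightarrow> s \<le> t \<Longrightarrow> t \<le> 1 \<Longrightarrow> (H t - H s)\<^sup>2 \<le> (q t - q s) * (e t - e s)"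
    and K: "finite K" "K \<subseteq> {0<..1}"
  shows "\<exists>a. (\<forall>s\<in>insert 0 K. (\<Sum>t\<in>insert 0 K. a t * q (min s t)) = H s) \<and>
     (\<Sum>t\<in>insert 0 K. a t * H t) \<le> e (Max (insert 0 K)) - e 0"
  using K
proof (induction K rule: finite_linorder_max_induct)
  case empty
  then show ?case using q0 H0 by simp
next
  case (insert b K)
  define m where "m = Max (insert 0 K)"
  let ?K = "insert 0 K"
  have fin: "finite ?K" using insert by auto
  obtain a where a: "\<And>s. s \<in> ?K \<Longrightarrow> (\<Sum>t\<in>?K. a t * q (min s t)) = H s" "(\<Sum>t\<in>?K. a t * H t) \<le> e m - e 0"
    using insert by (auto simp: m_def)
  have m: "m \<in> ?K" unfolding m_def using fin by (intro Max_in) auto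
  have le: "t \<le> m" if "t \<in> ?K" for t unfolding m_def using fin that by (intro Max_ge) auto
  have b01: "0 < b" "b \<le> 1" using insert.prems by auto
  have mb: "m < b" using m insert.hyps b01 by auto
  have m0: "0 \<le> m" using le[of 0] by simp
  have bK: "b \<notin> ?K" using le mb by force
  have qmb: "q m < q b" using mb m0 b01 by (intro strict_mono_onD[OF q]) auto
  \<comment> \<open>Determined by the condition at \<open>s = b\<close>, where the new terms
    contribute \<open>\<alpha> * (q b - q m)\<close>. For \<open>s \<le> m\<close> they cancel, as
    \<open>min s b = min s m = s\<close>.\<close>
  define \<alpha> where "\<alpha> = (H b - H m) / (q b - q m)"
  define a' where "a' t = (if t = b then \<alpha> else if t = m then a m - \<alpha> else a t)" for t
  have sum': "(\<Sum>t\<in>insert b ?K. a' t * g t) = (\<Sum>t\<in>?K. a t * g t) + \<alpha> * (g b - g m)" for g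
  proof -
    have "(\<Sum>t\<in>insert b ?K. a' t * g t) = \<alpha> * g b + (\<Sum>t\<in>?K. a' t * g t)"
      using fin bK by (subst sum.insert) (auto simp: a'_def)
    also have "(\<Sum>t\<in>?K. a' t * g t) = (\<Sum>t\<in>?K. a t * g t + (if t = m then - \<alpha> * g t else 0))"
      using bK mb by (intro sum.cong) (auto simp: a'_def algebra_simps)
    also have "\<dots> = (\<Sum>t\<in>?K. a t * g t) - \<alpha> * g m"
      using fin m by (simp only: sum.distrib sum.delta) simp
    finally show ?thesis by (simp add: algebra_simps)
  qed
  have "(\<Sum>t\<in>insert b ?K. a' t * q (min s t)) = H s" if s: "s \<in> insert b ?K" for s
  proof (cases "s = b")
    case True
    have "(\<Sum>t\<in>?K. a t * q (min b t)) = (\<Sum>t\<in>?K. a t * q (min m t))"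
    proof (rule sum.cong[OF refl])
      fix t assume "t \<in> ?K"
      from le[OF this] have "min b t = t" "min m t = t" using mb by auto
      then show "a t * q (min b t) = a t * q (min m t)" by simp
    qed
    also have "\<dots> = H m" by (rule a(1)[OF m])
    finally show ?thesis unfolding sum' True using mb qmb by (simp add: \<alpha>_def min_def)
  next
    case False
    then have sK: "s \<in> ?K" using s by auto
    then show ?thesis unfolding sum' using a(1)[OF sK] le[OF sK] mb by (simp add: min_absorb1)
  qed
  moreover have "(\<Sum>t\<in>insert b ?K. a' t * H t) \<le> e b - e 0"
  proof -
    have "\<alpha> * (H b - H m) = (H b - H m)\<^sup>2 / (q b - q m)" by (simp add: \<alpha>_def power2_eq_square)
    also have "\<dots> \<le> e b - e m" using e[of m b] m0 mb b01 qmb by (simp add: divide_le_eq mult.commute)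
    finally show ?thesis unfolding sum' using a(2) by simp
  qed
  moreover have "Max (insert b ?K) = b"
    using fin le mb by (intro Max_eqI) force+
  moreover have "insert 0 (insert b K) = insert b ?K" by auto
  ultimately show ?case by (intro exI[of _ a']) (simp only: simp_thms, blast)
qed

subsection \<open>Interpolation on the grid\<close>

abbreviation grid :: "nat \<Rightarrow> nat \<Rightarrow> real" where
  "grid n i \<equiv> real i / real n"

definition clip :: "nat \<Rightarrow> nat \<Rightarrow> real \<Rightarrow> real" where
  "clip n i t = max (grid n (i - 1)) (min t (grid n i))"

text \<open>For increasing \<open>q\<close> each ratio rises from 0 to 1 while \<open>t\<close>
  crosses cell \<open>i\<close>, so this interpolates \<open>w - w 0\<close>. Clipping replaces a
  case distinction on the cell: linearity in \<open>w\<close>, continuity and measurability can be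
  read off, and the ratios reappear as regression coefficients of the process on its grid
  increments.\<close>

definition interp :: "(real \<Rightarrow> real) \<Rightarrow> nat \<Rightarrow> (nat \<Rightarrow> real) \<Rightarrow> real \<Rightarrow> real" where
  "interp q n w t = (\<Sum>i=1..n. (q (clip n i t) - q (grid n (i - 1))) /
     (q (grid n i) - q (grid n (i - 1))) * (w i - w (i - 1)))"

lemma clip_cases:
  assumes t: "t \<in> {grid n (k - 1)..grid n k}" and k: "k \<ge> 1" and n: "n \<ge> 1" and i: "i \<ge> 1"
  shows "clip n i t = (if i < k then grid n i else if i = k then t else grid n (i - 1))"
proof -
  have le: "grid n a \<le> grid n b" if "a \<le> b" for a b using that by (simp add: divide_right_mono)
  consider "i < k" | "i = k" | "i > k" by linarith
  then show ?thesis
  proof cases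
    case 1
    then have "i \<le> k - 1" by simp
    from le[OF this] have "grid n i \<le> t" using t unfolding atLeastAtMost_iff by linarith
    then show ?thesis using 1 le[of "i-1" i] by (simp add: clip_def)
  next
    case 2
    then show ?thesis using t by (simp add: clip_def)
  next
    case 3
    then have "k \<le> i - 1" by simp
    from le[OF this] have "t \<le> grid n (i - 1)" using t unfolding atLeastAtMost_iff by linarith
    then show ?thesis using 3 by (simp add: clip_def)
  qed
qed

lemma interp_cell:
  assumes n: "n \<ge> 1" and k: "1 \<le> k" "k \<le> n" and t: "t \<in> {grid n (k - 1)..grid n k}"
    and q: "\<And>i. 1 \<le> i \<Longrightarrow> i \<le> n \<Longrightarrow> q (grid n i) \<noteq> q (grid n (i - 1))"
  shows "interp q n w t = w (k - 1) - w 0 + (q t - q (grid n (k - 1))) /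
     (q (grid n k) - q (grid n (k - 1))) * (w k - w (k - 1))"
proof -
  let ?g = "\<lambda>i. (q (clip n i t) - q (grid n (i - 1))) / (q (grid n i) - q (grid n (i - 1))) * (w i - w (i - 1))"
  have split: "{1..n} = {1..<k} \<union> {k} \<union> {k<..n}" using k by auto
  have "interp q n w t = (\<Sum>i\<in>{1..<k}. ?g i) + ?g k + (\<Sum>i\<in>{k<..n}. ?g i)"
    unfolding interp_def split by (subst sum.union_disjoint; auto)+
  also have "(\<Sum>i\<in>{k<..n}. ?g i) = 0"
    by (intro sum.neutral) (auto simp: clip_cases[OF t k(1) n])
  also have "(\<Sum>i\<in>{1..<k}. ?g i) = (\<Sum>i\<in>{1..<k}. w i - w (i - 1))"
    using k q by (intro sum.cong) (auto simp: clip_cases[OF t k(1) n])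
  also have "\<dots> = (\<Sum>i<k-1. w (Suc i) - w i)"
    by (rule sum.reindex_bij_witness[of _ Suc "\<lambda>i. i - 1"]) auto
  also have "\<dots> = w (k - 1) - w 0" by (rule sum_lessThan_telescope)
  also have "clip n k t = t" using clip_cases[OF t k(1) n k(1)] by simp
  finally show ?thesis by simp
qed

lemma interp_grid:
  assumes n: "n \<ge> 1" and k: "k \<le> n"
    and q: "\<And>i. 1 \<le> i \<Longrightarrow> i \<le> n \<Longrightarrow> q (grid n i) \<noteq> q (grid n (i - 1))"
  shows "interp q n w (grid n k) = w k - w 0"
proof (cases "k = 0")
  case True
  have "interp q n w (grid n 0) = w (1 - 1) - w 0 + (q (grid n 0) - q (grid n (1 - 1))) /
     (q (grid n 1) - q (grid n (1 - 1))) * (w 1 - w (1 - 1))"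
    by (rule interp_cell) (use n q in auto)
  then show ?thesis using True by simp
next
  case False
  have "interp q n w (grid n k) = w (k - 1) - w 0 + (q (grid n k) - q (grid n (k - 1))) /
     (q (grid n k) - q (grid n (k - 1))) * (w k - w (k - 1))"
    by (rule interp_cell) (use n q k False in \<open>auto simp: divide_right_mono\<close>)
  moreover have "q (grid n k) - q (grid n (k - 1)) \<noteq> 0" using q[of k] k False by auto
  ultimately show ?thesis by simp
qed

lemma clip_in: 
  assumes "n \<ge> 1" "1 \<le> i" "i \<le> n" shows "clip n i t \<in> {0..1}"
proof -
  have m: "max a (min t b) \<in> {0..1}" if "0 \<le> a" "a \<le> b" "b \<le> 1" for a b :: real using that by auto
  show ?thesis unfolding clip_def by (rule m) (use assms in \<open>auto simp: divide_right_mono\<close>)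
qed

lemma continuous_on_interp:
  assumes n: "n \<ge> 1" and q: "continuous_on {0..1} q"
  shows "continuous_on S (interp q n w)"
proof -
  have c: "continuous_on S (clip n i)" for i
    unfolding clip_def by (intro continuous_intros)
  have "continuous_on S (\<lambda>t. q (clip n i t))" if "i \<in> {1..n}" for i
    using clip_in[OF n] that by (intro continuous_on_compose2[OF q c]) auto
  then show ?thesis unfolding interp_def divide_inverse
    by (intro continuous_on_sum continuous_on_mult continuous_on_diff continuous_on_const)
qed

lemma has_integral_grid:
  fixes g :: "real \<Rightarrow> real"
  assumes n: "n \<ge> 1" and g: "\<And>i. 1 \<le> i \<Longrightarrow> i \<le> n \<Longrightarrow> (g has_integral A i) {grid n (i - 1)..grid n i}"
  shows "k \<le> n \<Longrightarrow> (g has_integral (\<Sum>i=1..k. A i)) {0..grid n k}"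
proof (induction k)
  case 0
  then show ?case using has_integral_refl(2)[of g 0] by simp
next
  case (Suc k)
  have "(g has_integral (\<Sum>i=1..k. A i) + A (Suc k)) {0..grid n (Suc k)}"
  proof (rule has_integral_combine)
    show "0 \<le> grid n k" "grid n k \<le> grid n (Suc k)" by (auto simp: divide_right_mono)
    show "(g has_integral (\<Sum>i=1..k. A i)) {0..grid n k}" using Suc by simp
    show "(g has_integral A (Suc k)) {grid n k..grid n (Suc k)}" using g[of "Suc k"] Suc.prems by simp
  qed
  then show ?case by simp
qed

text \<open>The ceiling selects the right end point of the cell, where the function is sampled, and
  makes the cells open on the left; the left end points do not affect integrals.\<close>

definition step_fun :: "nat \<Rightarrow> (real \<Rightarrow> real) \<Rightarrow> real \<Rightarrow> real" where
  "step_fun n f t = f (real_of_int \<lceil>real n * t\<rceil> / real n)"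

lemma step_fun_cell:
  assumes n: "n \<ge> 1" and t: "grid n (k - 1) < t" "t \<le> grid n k" and k: "k \<ge> 1"
  shows "step_fun n f t = f (grid n k)"
proof -
  have "\<lceil>real n * t\<rceil> = int k"
    using t n k by (intro ceiling_unique) (auto simp: field_simps of_nat_diff)
  then show ?thesis by (simp add: step_fun_def)
qed

text \<open>The choice \<open>l = |d| / a\<close> balances the two terms. This replaces the
  Cauchy-Schwarz inequality for integrals: it suffices to integrate the pointwise bound
  \<open>|h| \<le> (l + h^2 / l) / 2\<close> for each \<open>l\<close>.\<close>

lemma sq_le_of_amgm:
  fixes d a E :: real
  assumes a: "a > 0" and le: "\<And>l. l > 0 \<Longrightarrow> \<bar>d\<bar> \<le> (l * a + E / l) / 2" and E: "E \<ge> 0"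
  shows "d\<^sup>2 \<le> a * E"
proof (cases "d = 0")
  case True
  then show ?thesis using a E by simp
next
  case False
  define l where "l = \<bar>d\<bar> / a"
  have l: "l > 0" using False a by (simp add: l_def)
  have "2 * \<bar>d\<bar> \<le> \<bar>d\<bar> + E / l" using le[OF l] a by (simp add: l_def)
  then have "\<bar>d\<bar> * l \<le> E" using l by (simp add: field_simps)
  then have "\<bar>d\<bar> * \<bar>d\<bar> \<le> E * a" using a by (simp add: l_def field_simps)
  then show ?thesis by (simp add: power2_eq_square mult.commute)
qed

section \<open>The error of the interpolated Riemann sums\<close>

text \<open>All that is kept of the ellipsoid: continuity, the uniform bound \<open>A\<close>, and
  the mean square \<open>S\<close> of the increments to the right end points of the cells, for each
  offset \<open>h\<close> separately.\<close>

locale grid_approximation =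
  fixes n :: nat and f :: "real \<Rightarrow> real" and S A :: real
  assumes n: "n \<ge> 1" and f: "continuous_on {0..1} f" and fA: "\<And>t. t \<in> {0..1} \<Longrightarrow> \<bar>f t\<bar> \<le> A"
    and S: "S > 0"
    and incr: "\<And>h. 0 \<le> h \<Longrightarrow> h \<le> 1 / real n \<Longrightarrow>
      (\<Sum>i=1..n. (f (grid n (i - 1) + h) - f (grid n i))\<^sup>2) \<le> real n * S"
begin

abbreviation F :: "real \<Rightarrow> real" where "F t \<equiv> integral {0..t} f"
abbreviation D :: "nat \<Rightarrow> real" where "D i \<equiv> (\<Sum>j=1..i. f (grid n j)) / real n"

lemma A0: "0 \<le> A" using fA[of 0] by auto

lemma cell_sub: "1 \<le> i \<Longrightarrow> i \<le> n \<Longrightarrow> {grid n (i - 1)..grid n i} \<subseteq> {0..1}"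
  using n by (auto simp: field_simps)

lemma cell_width: "1 \<le> i \<Longrightarrow> grid n i - grid n (i - 1) = 1 / real n"
  using n by (simp add: of_nat_diff field_simps)

text \<open>On each cell the integral runs over the offset \<open>h\<close>. Exchanging it with the
  sum over the cells leaves the bound \<open>real n * S\<close>, integrated over an interval of
  length \<open>1 / n\<close>.\<close>

lemma square_integral:
  obtains I where "((\<lambda>t. (f t - step_fun n f t)\<^sup>2) has_integral I) {0..1}" "I \<le> S"
proof -
  let ?t = "grid n"
  define a where "a i = integral {0..1 / real n} (\<lambda>h. (f (?t (i - 1) + h) - f (?t i))\<^sup>2)" for i
  have cf: "continuous_on {0..1 / real n} (\<lambda>h. (f (?t (i - 1) + h) - f (?t i))\<^sup>2)" if i: "1 \<le> i" "i \<le> n" for i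
  proof -
    have m: "?t (i - 1) + h \<in> {0..1}" if "h \<in> {0..1 / real n}" for h
      by (rule subsetD[OF cell_sub[OF i]]) (use cell_width[OF i(1)] that in \<open>unfold atLeastAtMost_iff, linarith\<close>)
    show ?thesis by (intro continuous_intros continuous_on_compose2[OF f] image_subsetI m)
  qed
  have cell: "((\<lambda>t. (f t - step_fun n f t)\<^sup>2) has_integral a i) {?t (i - 1)..?t i}" if i: "1 \<le> i" "i \<le> n" for i
  proof -
    have c: "continuous_on {?t (i - 1)..?t i} (\<lambda>t. (f t - f (?t i))\<^sup>2)"
      by (intro continuous_intros continuous_on_subset[OF f cell_sub[OF i]])
    have e: "{?t (i - 1)..?t i} = {0 + ?t (i - 1)..1 / real n + ?t (i - 1)}"
      using cell_width[OF i(1)] by auto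
    have "integral {?t (i - 1)..?t i} (\<lambda>t. (f t - f (?t i))\<^sup>2) = a i"
      using integral_shift[OF c[unfolded e]] unfolding e a_def by (simp add: o_def add.commute)
    then have "((\<lambda>t. (f t - f (?t i))\<^sup>2) has_integral a i) {?t (i - 1)..?t i}"
      using integrable_integral[OF integrable_continuous_interval[OF c]] by simp
    then show ?thesis
      by (rule has_integral_spike_finite[rotated 2, of _ _ _ "{?t (i - 1)}"]) (use step_fun_cell[OF n _ _ i(1)] in auto)
  qed
  have "((\<lambda>t. (f t - step_fun n f t)\<^sup>2) has_integral (\<Sum>i=1..n. a i)) {0..?t n}"
    by (rule has_integral_grid[OF n cell]) auto
  moreover have "(\<Sum>i=1..n. a i) \<le> S"
  proof -
    have "(\<Sum>i=1..n. a i) = integral {0..1 / real n} (\<lambda>h. \<Sum>i=1..n. (f (?t (i - 1) + h) - f (?t i))\<^sup>2)"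
      unfolding a_def by (rule integral_sum[symmetric]) (simp, rule integrable_continuous_interval[OF cf], simp_all only: atLeastAtMost_iff)
    also have "\<dots> \<le> integral {0..1 / real n} (\<lambda>h. real n * S)"
    proof (rule integral_le)
      show "(\<lambda>h. \<Sum>i=1..n. (f (?t (i - 1) + h) - f (?t i))\<^sup>2) integrable_on {0..1 / real n}"
        by (intro integrable_continuous_interval continuous_on_sum cf; simp only: atLeastAtMost_iff)
    qed (use incr in auto)
    also have "\<dots> = S" using n by simp
    finally show ?thesis .
  qed
  ultimately show ?thesis using that n by simp
qed

lemma step_integral:
  assumes k: "k \<le> n"
  shows "((\<lambda>t. f t - step_fun n f t) has_integral (F (grid n k) - D k)) {0..grid n k}"
proof -
  let ?t = "grid n"
  have cell: "(step_fun n f has_integral f (?t i) / real n) {?t (i - 1)..?t i}" if i: "1 \<le> i" "i \<le> n" for i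
  proof -
    have "?t (i - 1) \<le> ?t i" by (simp add: divide_right_mono)
    then have "((\<lambda>_. f (?t i)) has_integral f (?t i) / real n) {?t (i - 1)..?t i}"
      using has_integral_const_real[of "f (?t i)" "?t (i - 1)" "?t i"] cell_width[OF i(1)] by simp
    then show ?thesis
      by (rule has_integral_spike_finite[rotated 2, of _ _ _ "{?t (i - 1)}"]) (use step_fun_cell[OF n _ _ i(1)] in auto)
  qed
  have "(step_fun n f has_integral (\<Sum>i=1..k. f (?t i) / real n)) {0..?t k}"
    by (rule has_integral_grid[OF n cell k])
  moreover have "(f has_integral F (?t k)) {0..?t k}"
    using k n by (intro integrable_integral integrable_continuous_interval continuous_on_subset[OF f]) auto
  ultimately show ?thesis by (auto intro: has_integral_diff simp: sum_divide_distrib)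
qed

lemma D_near_F:
  assumes k: "k \<le> n"
  shows "\<bar>D k - F (grid n k)\<bar> \<le> sqrt S"
proof -
  obtain I where I: "((\<lambda>t. (f t - step_fun n f t)\<^sup>2) has_integral I) {0..1}" "I \<le> S" by (rule square_integral)
  have k1: "grid n k \<le> 1" using k n by simp
  \<comment> \<open>The parameter that balances \<open>|y| \<le> (s + y^2 / s) / 2\<close> for
    \<open>y = f - step_fun n f\<close>, whose mean square is at most \<open>S\<close>.\<close>
  define s where "s = sqrt S"
  have s: "s > 0" "s * s = S" using S by (auto simp: s_def)
  let ?b = "\<lambda>t. (s + (f t - step_fun n f t)\<^sup>2 / s) / 2"
  have b: "(?b has_integral (s * 1 + I / s) / 2) {0..1}"
    using has_integral_const_real[of s 0 1] by (intro has_integral_divide has_integral_add I(1)) simp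
  have bi: "?b integrable_on {0..grid n k}"
    by (rule integrable_on_subinterval[OF has_integral_integrable[OF b]]) (use k1 in auto)
  have "norm (F (grid n k) - D k) \<le> integral {0..grid n k} ?b"
    unfolding integral_unique[OF step_integral[OF k], symmetric]
  proof (rule integral_norm_bound_integral[OF has_integral_integrable[OF step_integral[OF k]] bi])
    fix x
    let ?y = "f x - step_fun n f x"
    have "2 * s * \<bar>?y\<bar> \<le> s\<^sup>2 + \<bar>?y\<bar>\<^sup>2" by (rule sum_squares_bound)
    then show "norm ?y \<le> ?b x" using s by (simp add: field_simps power2_eq_square)
  qed
  also have "\<dots> \<le> integral {0..1} ?b"
    by (rule integral_subset_le[OF _ bi has_integral_integrable[OF b]]) (use k1 s in auto)
  also have "\<dots> = (s * 1 + I / s) / 2" by (rule integral_unique[OF b])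
  also have "\<dots> \<le> s" using I(2) s by (simp add: field_simps)
  finally show ?thesis by (simp add: s_def abs_minus_commute)
qed

lemma D_bound: assumes "k \<le> n" shows "\<bar>D k\<bar> \<le> A"
proof -
  have "\<bar>\<Sum>j=1..k. f (grid n j)\<bar> \<le> (\<Sum>j=1..k. A)"
    using assms by (intro order.trans[OF sum_abs] sum_mono fA) auto
  also have "\<dots> \<le> real n * A" using assms A0 by (simp add: mult_right_mono)
  finally show ?thesis using n by (simp add: divide_le_eq mult.commute)
qed

lemma F_diff_bound: assumes "0 \<le> s" "s \<le> t" "t \<le> 1" shows "\<bar>F t - F s\<bar> \<le> A * (t - s)"
proof -
  have i: "f integrable_on {a..b}" if "0 \<le> a" "b \<le> 1" for a b
    using that by (intro integrable_continuous_interval continuous_on_subset[OF f]) auto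
  have "F t - F s = integral {s..t} f"
    using Henstock_Kurzweil_Integration.integral_combine[OF assms(1,2) i[of 0 t]] assms by auto
  also have "\<bar>\<dots>\<bar> \<le> A * (t - s)"
    using has_integral_bound_real[OF A0 finite.emptyI integrable_integral[OF i[of s t]]] fA assms by auto
  finally show ?thesis .
qed

lemma F_bound: assumes "t \<in> {0..1}" shows "\<bar>F t\<bar> \<le> A"
  using F_diff_bound[of 0 t] assms A0 mult_left_le[of t A] by auto

end

text \<open>\<open>r\<close> will be \<open>1 / v\<close>. One constant \<open>A\<close> bounds all
  data, including \<open>f\<close> in \<open>weighted_grid\<close>, so that the final constant
  depends on \<open>A\<close> and \<open>c\<close> alone and is uniform over the ellipsoid.\<close>

locale smooth_weights =
  fixes q q' r r' :: "real \<Rightarrow> real" and c A \<gamma> :: real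
  assumes c: "c > 0" and \<gamma>: "0 < \<gamma>" "\<gamma> \<le> 1"
    and q: "\<And>t. t \<in> {0..1} \<Longrightarrow> (q has_real_derivative q' t) (at t within {0..1})"
    and r: "\<And>t. t \<in> {0..1} \<Longrightarrow> (r has_real_derivative r' t) (at t within {0..1})"
    and q'c: "\<And>t. t \<in> {0..1} \<Longrightarrow> c \<le> q' t"
    and rA: "\<And>t. t \<in> {0..1} \<Longrightarrow> \<bar>r t\<bar> \<le> A" and r'A: "\<And>t. t \<in> {0..1} \<Longrightarrow> \<bar>r' t\<bar> \<le> A"
    and q'H: "\<And>s t. s \<in> {0..1} \<Longrightarrow> t \<in> {0..1} \<Longrightarrow> \<bar>q' s - q' t\<bar> \<le> A * \<bar>s - t\<bar> powr \<gamma>"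
    and r'H: "\<And>s t. s \<in> {0..1} \<Longrightarrow> t \<in> {0..1} \<Longrightarrow> \<bar>r' s - r' t\<bar> \<le> A * \<bar>s - t\<bar> powr \<gamma>"
begin

lemma mvt:
  assumes g: "\<And>t. t \<in> {0..1} \<Longrightarrow> (g has_real_derivative g' t) (at t within {0..1})" and st: "0 \<le> s" "s < t" "t \<le> 1"
  obtains x where "s < x" "x < t" "g t - g s = (t - s) * g' x"
proof -
  have "\<exists>x\<in>{s<..<t}. g t - g s = g' x * (t - s)"
  proof (rule mvt_simple[OF st(2)])
    fix x assume x: "s \<le> x" "x \<le> t"
    have "(g has_real_derivative g' x) (at x within {s..t})"
      by (rule DERIV_subset[OF g]) (use x st in auto)
    then show "(g has_derivative (*) (g' x)) (at x within {s..t})" by (simp add: has_field_derivative_def)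
  qed
  then show ?thesis using that by (auto simp: mult.commute)
qed

lemma q_incr: assumes "0 \<le> s" "s \<le> t" "t \<le> 1" shows "c * (t - s) \<le> q t - q s"
proof (cases "s = t")
  case False
  then obtain x where x: "s < x" "x < t" "q t - q s = (t - s) * q' x" using mvt[OF q, of s t] assms by auto
  have "c \<le> q' x" by (rule q'c) (use x assms in auto)
  then show ?thesis using x assms by (simp add: mult.commute mult_left_mono)
qed simp

lemma q_strict: "strict_mono_on {0..1} q"
proof (rule strict_mono_onI)
  fix s t :: real assume st: "s \<in> {0..1}" "t \<in> {0..1}" "s < t"
  then have "0 < c * (t - s)" using c by simp
  then show "q s < q t" using q_incr[of s t] st by auto
qed

lemma q_cont: "continuous_on {0..1} q"
  by (rule DERIV_continuous_on[OF q])

lemma r_cont: "continuous_on {0..1} r"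
  by (rule DERIV_continuous_on[OF r])

end

locale weighted_grid = grid_approximation n f S A + smooth_weights q q' r r' c A \<gamma>
  for n f S A q q' r r' c \<gamma>
begin

text \<open>Collects the coefficients of \<open>\<delta>\<close> in \<open>H_derivative\<close>:
  \<open>2 * A^3 / c\<close> from the quotient of two values of \<open>q'\<close>, the rest from the
  increments of \<open>r\<close> and \<open>r'\<close> and from replacing Riemann sums by
  integrals.\<close>

definition K where "K = 2 * A^3 / c + 3 * A\<^sup>2 + A"
text \<open>Dominates the three small quantities \<open>sqrt S\<close>,
  \<open>n powr (- \<gamma>)\<close> and \<open>1 / n\<close>, the last one because
  \<open>\<gamma> \<le> 1\<close>.\<close>

definition \<delta> where "\<delta> = sqrt S + real n powr (- \<gamma>)"
text \<open>With \<open>r = 1 / v\<close> this is the shift divided by \<open>v\<close>: the Riemann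
  sums are divided at the nodes before interpolation, whereas \<open>F\<close> is divided at time
  \<open>t\<close>.\<close>

definition H where "H t = interp q n (\<lambda>i. D i * r (grid n i)) t - F t * r t"

lemma \<delta>0: "0 < \<delta>" using S n by (auto simp: \<delta>_def intro!: add_pos_pos)

lemma powr_le_\<delta>: assumes "\<bar>x\<bar> \<le> 1 / real n" shows "\<bar>x\<bar> powr \<gamma> \<le> \<delta>"
proof -
  have "\<bar>x\<bar> powr \<gamma> \<le> (1 / real n) powr \<gamma>" using assms \<gamma> by (intro powr_mono2) auto
  also have "\<dots> = real n powr (- \<gamma>)" using n by (simp add: powr_divide powr_minus divide_simps)
  also have "\<dots> \<le> \<delta>" using S by (simp add: \<delta>_def)
  finally show ?thesis .
qed

lemma inverse_n_le_\<delta>: "1 / real n \<le> \<delta>"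
proof -
  have "1 / real n = real n powr (- 1)" using n by (simp add: powr_minus divide_simps)
  also have "\<dots> \<le> real n powr (- \<gamma>)" using n \<gamma> by (intro powr_mono) auto
  also have "\<dots> \<le> \<delta>" using S by (simp add: \<delta>_def)
  finally show ?thesis .
qed

lemma q_grid: "1 \<le> i \<Longrightarrow> i \<le> n \<Longrightarrow> q (grid n i) \<noteq> q (grid n (i - 1))"
proof -
  assume i: "1 \<le> i" "i \<le> n"
  have "c * (1 / real n) \<le> q (grid n i) - q (grid n (i - 1))"
    unfolding cell_width[OF i(1), symmetric] using i n by (intro q_incr) (auto simp: divide_right_mono)
  moreover have "0 < c * (1 / real n)" using c n by simp
  ultimately show ?thesis by linarith
qed

text \<open>Inside a cell the interpolation is affine in \<open>q\<close>, with slope a quotient of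
  two increments. The mean value points \<open>\<xi>\<close> and \<open>\<eta>\<close> turn it into
  an expression in derivatives, to be compared with the derivative \<open>f * r + F * r'\<close> of
  \<open>F * r\<close> at the nearby point \<open>t\<close>.\<close>

lemma H_derivative:
  assumes k: "1 \<le> k" "k \<le> n" and t: "grid n (k - 1) < t" "t < grid n k"
  shows "\<exists>d. (H has_real_derivative d) (at t) \<and> \<bar>d\<bar> \<le> K * (\<bar>f t - step_fun n f t\<bar> + \<delta>)"
proof -
  define a where "a = grid n (k - 1)"
  define b where "b = grid n k"
  have ab: "a < t" "t < b" "b - a = 1 / real n" using t cell_width[OF k(1)] by (auto simp: a_def b_def)
  have a01: "0 \<le> a" "b \<le> 1" using k n by (auto simp: a_def b_def)
  have cell: "x \<in> {0..1}" if "a \<le> x" "x \<le> b" for x using that a01 by auto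
  have close: "\<bar>x - y\<bar> \<le> 1 / real n" if "a \<le> x" "x \<le> b" "a \<le> y" "y \<le> b" for x y
    using that ab by (auto simp: abs_le_iff)
  have abl: "a < b" using ab by linarith
  obtain \<xi> where \<xi>: "a < \<xi>" "\<xi> < b" "q b - q a = (b - a) * q' \<xi>" using mvt[OF q a01(1) abl a01(2)] by blast
  obtain \<eta> where \<eta>: "a < \<eta>" "\<eta> < b" "r b - r a = (b - a) * r' \<eta>" using mvt[OF r a01(1) abl a01(2)] by blast
  \<comment> \<open>\<open>n\<close> times the increment of \<open>D * r\<close> over the cell, by
    the discrete product rule; it approximates \<open>f t * r t + F t * r' t\<close>.\<close>
  define X where "X = f b * r b + D (k - 1) * r' \<eta>"
  define \<kappa> where "\<kappa> = X / q' \<xi>"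
  have q\<xi>: "c \<le> q' \<xi>" by (rule q'c) (use \<xi> cell in auto)
  define w where "w i = D i * r (grid n i)" for i
  have wd: "w k - w (k - 1) = X / real n"
  proof -
    have "D k = D (k - 1) + f b / real n" using k unfolding b_def by (cases k) (auto simp: add_divide_distrib)
    then have "w k - w (k - 1) = f b / real n * r b + D (k - 1) * (r b - r a)"
      by (simp add: w_def a_def b_def algebra_simps add_divide_distrib diff_divide_distrib)
    also have "\<dots> = X / real n" unfolding \<eta>(3) ab(3) X_def by (simp add: add_divide_distrib)
    finally show ?thesis .
  qed
  have H_eq: "H x = w (k - 1) - w 0 + (q x - q a) * \<kappa> - F x * r x" if "x \<in> {a..b}" for x
  proof -
    have "interp q n w x = w (k - 1) - w 0 + (q x - q a) / (q b - q a) * (w k - w (k - 1))"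
      unfolding a_def b_def by (rule interp_cell[OF n k]) (use that q_grid in \<open>auto simp: a_def b_def\<close>)
    also have "(q x - q a) / (q b - q a) * (w k - w (k - 1)) = (q x - q a) * \<kappa>"
      using q\<xi> c n unfolding wd \<xi>(3) ab(3) \<kappa>_def by (simp add: field_simps)
    finally show ?thesis unfolding H_def w_def by simp
  qed
  have t01: "t \<in> {0..1}" "t \<in> interior {0..1}" using ab a01 by (auto simp: interior_atLeastAtMost_real)
  have at: "at t within {0..1} = at t" using at_within_interior[OF t01(2)] .
  have dq: "(q has_real_derivative q' t) (at t)" and dr: "(r has_real_derivative r' t) (at t)"
    using q[OF t01(1)] r[OF t01(1)] at by auto
  have dF: "(F has_real_derivative f t) (at t)"
    using integral_has_real_derivative[OF f t01(1)] at by simp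
  define d where "d = q' t * \<kappa> - (f t * r t + F t * r' t)"
  have "((\<lambda>x. w (k - 1) - w 0 + (q x - q a) * \<kappa> - F x * r x) has_real_derivative d) (at t)"
    unfolding d_def by (auto intro!: derivative_eq_intros dq dr dF simp: algebra_simps)
  then have dH: "(H has_real_derivative d) (at t)"
    by (rule has_field_derivative_transform_within_open[of _ _ _ "{a<..<b}"]) (use ab H_eq in auto)
  have fn: "step_fun n f t = f b" using step_fun_cell[OF n t(1) _ k(1)] t by (simp add: b_def)
  have q't: "\<bar>q' t / q' \<xi> - 1\<bar> \<le> A * \<delta> / c"
  proof -
    have "\<bar>q' t - q' \<xi>\<bar> \<le> A * \<bar>t - \<xi>\<bar> powr \<gamma>" by (rule q'H) (use ab \<xi> cell in auto)
    also have "\<dots> \<le> A * \<delta>" using ab \<xi> by (intro mult_left_mono powr_le_\<delta> close A0) auto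
    finally have *: "\<bar>q' t - q' \<xi>\<bar> \<le> A * \<delta>" .
    have "\<bar>q' t / q' \<xi> - 1\<bar> = \<bar>q' t - q' \<xi>\<bar> / q' \<xi>" 
    proof -
      have "q' t / q' \<xi> - 1 = (q' t - q' \<xi>) / q' \<xi>" using q\<xi> c by (simp add: diff_divide_distrib)
      then show ?thesis using q\<xi> c by simp
    qed
    also have "\<dots> \<le> A * \<delta> / c" using * q\<xi> c by (intro frac_le) auto
    finally show ?thesis .
  qed
  have AX: "\<bar>X\<bar> \<le> 2 * A\<^sup>2"
  proof -
    have "\<bar>f b * r b\<bar> \<le> A * A" unfolding abs_mult using abl by (intro mult_mono fA rA cell A0) auto
    moreover have "\<bar>D (k - 1) * r' \<eta>\<bar> \<le> A * A" unfolding abs_mult using k \<eta> by (intro mult_mono D_bound r'A cell A0) auto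
    ultimately show ?thesis unfolding X_def power2_eq_square by linarith
  qed
  have rl: "\<bar>r b - r t\<bar> \<le> A * \<delta>"
  proof -
    obtain x where x: "t < x" "x < b" "r b - r t = (b - t) * r' x" using mvt[OF r, of t b] ab a01 by auto
    have "\<bar>r b - r t\<bar> = (b - t) * \<bar>r' x\<bar>" using x ab by (simp add: abs_mult)
    also have "\<dots> \<le> \<delta> * A" using ab x close[of b t] inverse_n_le_\<delta> \<delta>0 by (intro mult_mono r'A cell) auto
    finally show ?thesis by (simp add: mult.commute)
  qed
  have DF: "\<bar>D (k - 1) - F t\<bar> \<le> \<delta> + A * \<delta>"
  proof -
    have "\<bar>D (k - 1) - F a\<bar> \<le> sqrt S" unfolding a_def using k by (intro D_near_F) auto
    moreover have "\<bar>F t - F a\<bar> \<le> A * (t - a)" using ab a01 by (intro F_diff_bound) auto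
    moreover have "A * (t - a) \<le> A * \<delta>" using close[of t a] ab inverse_n_le_\<delta> by (intro mult_left_mono A0) auto
    moreover have "sqrt S \<le> \<delta>" by (simp add: \<delta>_def)
    ultimately show ?thesis by linarith
  qed
  have r'd: "\<bar>r' \<eta> - r' t\<bar> \<le> A * \<delta>"
  proof -
    have "\<bar>r' \<eta> - r' t\<bar> \<le> A * \<bar>\<eta> - t\<bar> powr \<gamma>" by (rule r'H) (use ab \<eta> cell in auto)
    also have "\<dots> \<le> A * \<delta>" using ab \<eta> by (intro mult_left_mono powr_le_\<delta> close A0) auto
    finally show ?thesis .
  qed
  \<comment> \<open>Five errors: the slope of \<open>q\<close>, and then \<open>f\<close>,
    \<open>r\<close>, \<open>F\<close> and \<open>r'\<close> exchanged one after the other. The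
    second is not bounded by a multiple of \<open>\<delta>\<close> pointwise and is controlled in
    mean square.\<close>
  have "d = (q' t / q' \<xi> - 1) * X + (f b - f t) * r b + f t * (r b - r t) + (D (k - 1) - F t) * r' \<eta> + F t * (r' \<eta> - r' t)"
  proof -
    have "d = (q' t / q' \<xi> - 1) * X + (X - (f t * r t + F t * r' t))"
      unfolding d_def \<kappa>_def by (simp add: left_diff_distrib)
    moreover have "fb * rb + D1 * r1 - (f0 * r0 + F0 * r2) = (fb - f0) * rb + f0 * (rb - r0) + (D1 - F0) * r1 + F0 * (r1 - r2)"
      for fb rb D1 r1 f0 r0 F0 r2 :: real by (simp add: algebra_simps)
    ultimately show ?thesis by (simp only: X_def add.assoc)
  qed
  then have "\<bar>d\<bar> \<le> \<bar>(q' t / q' \<xi> - 1) * X\<bar> + \<bar>(f b - f t) * r b\<bar> + \<bar>f t * (r b - r t)\<bar> + \<bar>(D (k - 1) - F t) * r' \<eta>\<bar> + \<bar>F t * (r' \<eta> - r' t)\<bar>"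
  proof -
    have "\<bar>x1 + x2 + x3 + x4 + x5\<bar> \<le> \<bar>x1\<bar> + \<bar>x2\<bar> + \<bar>x3\<bar> + \<bar>x4\<bar> + \<bar>x5\<bar>" for x1 x2 x3 x4 x5 :: real by linarith
    then show "d = (q' t / q' \<xi> - 1) * X + (f b - f t) * r b + f t * (r b - r t) + (D (k - 1) - F t) * r' \<eta> + F t * (r' \<eta> - r' t) \<Longrightarrow> ?thesis"
      by (simp only:)
  qed
  also have "\<dots> \<le> A * \<delta> / c * (2 * A\<^sup>2) + \<bar>f t - step_fun n f t\<bar> * A + A * (A * \<delta>) + (\<delta> + A * \<delta>) * A + A * (A * \<delta>)"
    unfolding abs_mult fn abs_minus_commute[of "f t" "f b"]
    using ab \<eta> t01 A0 \<delta>0 c 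
    by (intro add_mono mult_mono q't AX rl DF r'd fA rA r'A F_bound cell) auto
  also have "\<dots> = A * \<bar>f t - step_fun n f t\<bar> + K * \<delta>"
    by (simp add: K_def power2_eq_square power3_eq_cube algebra_simps)
  also have "\<dots> \<le> K * \<bar>f t - step_fun n f t\<bar> + K * \<delta>"
  proof -
    have "A \<le> K" unfolding K_def using A0 c by simp
    then show ?thesis by (intro add_right_mono mult_right_mono) auto
  qed
  finally show ?thesis using dH by (auto simp: ring_distribs)
qed

text \<open>\<open>e\<close> is the integral of a majorant of the squared derivative of
  \<open>H\<close>, divided by \<open>c\<close>. Cauchy-Schwarz yields the factor
  \<open>t - s\<close>, and \<open>c * (t - s) \<le> q t - q s\<close> passes to the time scale
  \<open>q\<close>. Thus \<open>e 1 - e 0\<close> bounds the squared reproducing kernel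
  norm.\<close>

lemma energy:
  obtains e where "\<And>s t. 0 \<le> s \<Longrightarrow> s \<le> t \<Longrightarrow> t \<le> 1 \<Longrightarrow> (H t - H s)\<^sup>2 \<le> (q t - q s) * (e t - e s)"
    "e 1 - e 0 \<le> 6 * K\<^sup>2 / c * (S + real n powr (- 2 * \<gamma>))"
proof -
  obtain I where I: "((\<lambda>t. (f t - step_fun n f t)\<^sup>2) has_integral I) {0..1}" "I \<le> S" by (rule square_integral)
  define g where "g t = 2 * K\<^sup>2 * ((f t - step_fun n f t)\<^sup>2 + \<delta>\<^sup>2)" for t
  have gI: "(g has_integral 2 * K\<^sup>2 * (I + \<delta>\<^sup>2)) {0..1}"
    using has_integral_const_real[of "\<delta>\<^sup>2" 0 1] unfolding g_def
    by (intro has_integral_mult_right has_integral_add I(1)) simp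
  have gi: "g integrable_on {s..t}" if "0 \<le> s" "t \<le> 1" for s t
    by (rule integrable_on_subinterval[OF has_integral_integrable[OF gI]]) (use that in auto)
  have g0: "0 \<le> g t" for t unfolding g_def by simp
  define e where "e t = integral {0..t} g / c" for t
  have Hc: "continuous_on {0..1} H"
  proof -
    have "continuous_on {0..1} F" using f by (intro indefinite_integral_continuous_1 integrable_continuous_interval)
    then show ?thesis unfolding H_def by (intro continuous_intros continuous_on_interp n q_cont r_cont)
  qed
  define G where "G = (\<lambda>i. grid n i) ` {0..n}"
  have dH: "\<exists>d. (H has_real_derivative d) (at t) \<and> d\<^sup>2 \<le> g t" if t: "t \<in> {0<..<1}" "t \<notin> G" for t
  proof -
    define k where "k = nat \<lceil>real n * t\<rceil>"
    have kt: "grid n (k - 1) < t" "t \<le> grid n k" and k: "1 \<le> k" "k \<le> n"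
    proof -
      have nt: "0 < real n * t" "real n * t \<le> real n" using t n by auto
      have k1: "int k = \<lceil>real n * t\<rceil>" using nt by (simp add: k_def)
      have kk: "real k - 1 < real n * t" "real n * t \<le> real k" using k1 by linarith+
      show "1 \<le> k" using kk nt by (cases k) auto
      then have "real (k - 1) = real k - 1" by simp
      then show "grid n (k - 1) < t" "t \<le> grid n k"
        using kk n by (auto simp: field_simps)
      have "\<lceil>real n * t\<rceil> \<le> int n" using nt by (simp add: ceiling_le_iff)
      then show "k \<le> n" using k1 by linarith
    qed
    have "t \<noteq> grid n k" using t(2) k by (auto simp: G_def)
    then obtain d where d: "(H has_real_derivative d) (at t)" "\<bar>d\<bar> \<le> K * (\<bar>f t - step_fun n f t\<bar> + \<delta>)"
      using H_derivative[OF k kt(1)] kt(2) by auto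
    have "d\<^sup>2 \<le> (K * (\<bar>f t - step_fun n f t\<bar> + \<delta>))\<^sup>2"
      using d(2) by (metis abs_ge_zero power2_abs power_mono)
    also have "\<dots> = K\<^sup>2 * (\<bar>f t - step_fun n f t\<bar> + \<delta>)\<^sup>2" by (simp add: power_mult_distrib)
    also have "\<dots> \<le> K\<^sup>2 * (2 * ((f t - step_fun n f t)\<^sup>2 + \<delta>\<^sup>2))"
    proof (intro mult_left_mono)
      have "(\<bar>x\<bar> + y)\<^sup>2 \<le> 2 * (x\<^sup>2 + y\<^sup>2)" for x y :: real
        using sum_squares_bound[of "\<bar>x\<bar>" y] by (simp add: power2_sum)
      then show "(\<bar>f t - step_fun n f t\<bar> + \<delta>)\<^sup>2 \<le> 2 * ((f t - step_fun n f t)\<^sup>2 + \<delta>\<^sup>2)" .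
    qed simp
    also have "\<dots> = g t" by (simp add: g_def)
    finally show ?thesis using d(1) by blast
  qed
  \<comment> \<open>A derivative chosen off the grid and extended by 0: finitely many points are
    harmless in the fundamental theorem of calculus, and \<open>h^2 \<le> g\<close> holds
    everywhere.\<close>
  define h where "h x = (if x \<in> {0<..<1} \<and> x \<notin> G then (SOME d. (H has_real_derivative d) (at x) \<and> d\<^sup>2 \<le> g x) else 0)" for x
  have h: "(H has_real_derivative h x) (at x)" if "x \<in> {0<..<1}" "x \<notin> G" for x
    using someI_ex[OF dH[OF that]] that by (simp add: h_def)
  have hg: "(h x)\<^sup>2 \<le> g x" for x
    using someI_ex[OF dH[of x]] g0[of x] by (auto simp: h_def)
  have main: "(H t - H s)\<^sup>2 \<le> (q t - q s) * (e t - e s)" if st: "0 \<le> s" "s \<le> t" "t \<le> 1" for s t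
  proof (cases "s = t")
    case False
    then have lt: "s < t" using st by simp
    have hi: "(h has_integral (H t - H s)) {s..t}"
    proof (rule fundamental_theorem_of_calculus_interior_strong[of "G"])
      show "finite G" by (simp add: G_def)
      show "continuous_on {s..t} H" by (rule continuous_on_subset[OF Hc]) (use st in auto)
      show "(H has_vector_derivative h x) (at x)" if "x \<in> {s<..<t} - G" for x
        using h[of x] that st by (auto simp: has_real_derivative_iff_has_vector_derivative)
    qed (use st in auto)
    define E where "E = integral {s..t} g"
    have E0: "E \<ge> 0" unfolding E_def by (rule integral_nonneg[OF gi]) (use st g0 in auto)
    have "\<bar>H t - H s\<bar> \<le> (l * (t - s) + E / l) / 2" if l: "l > 0" for l
    proof -
      have bi: "((\<lambda>x. (l + g x / l) / 2) has_integral (l * (t - s) + E / l) / 2) {s..t}"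
        using has_integral_const_real[of l s t] st integrable_integral[OF gi[of s t]] unfolding E_def
        by (intro has_integral_divide has_integral_add) (auto simp: mult.commute)
      have "norm (integral {s..t} h) \<le> integral {s..t} (\<lambda>x. (l + g x / l) / 2)"
      proof (rule integral_norm_bound_integral[OF has_integral_integrable[OF hi] has_integral_integrable[OF bi]])
        fix x
        have "2 * l * \<bar>h x\<bar> \<le> l\<^sup>2 + \<bar>h x\<bar>\<^sup>2" by (rule sum_squares_bound)
        also have "\<dots> \<le> l\<^sup>2 + g x" using hg[of x] by simp
        finally show "norm (h x) \<le> (l + g x / l) / 2" using l by (simp add: field_simps power2_eq_square)
      qed
      then show ?thesis unfolding integral_unique[OF hi] integral_unique[OF bi] by simp
    qed
    then have "(H t - H s)\<^sup>2 \<le> (t - s) * E" by (intro sq_le_of_amgm E0) (use lt in auto)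
    also have "\<dots> = (c * (t - s)) * (E / c)" using c by simp
    also have "\<dots> \<le> (q t - q s) * (E / c)" using q_incr[OF st] E0 c by (intro mult_right_mono) auto
    also have "E / c = e t - e s"
      using Henstock_Kurzweil_Integration.integral_combine[OF st(1,2) gi[of 0 t]] st unfolding E_def e_def 
      by (simp add: diff_divide_distrib[symmetric])
    finally show ?thesis .
  qed simp
  have "e 1 - e 0 \<le> 6 * K\<^sup>2 / c * (S + real n powr (- 2 * \<gamma>))"
  proof -
    \<comment> \<open>With \<open>I \<le> S\<close> this makes a factor 3, and with the 2 in
      \<open>g\<close> the constant 6.\<close>
    have "\<delta>\<^sup>2 \<le> 2 * (S + real n powr (- 2 * \<gamma>))"
    proof -
      have "2 * sqrt S * real n powr (- \<gamma>) \<le> (sqrt S)\<^sup>2 + (real n powr (- \<gamma>))\<^sup>2" by (rule sum_squares_bound)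
      moreover have "(real n powr (- \<gamma>))\<^sup>2 = real n powr (- 2 * \<gamma>)" 
        unfolding power2_eq_square powr_add[symmetric] by simp
      ultimately show ?thesis using S unfolding \<delta>_def by (simp add: power2_sum)
    qed
    then have "I + \<delta>\<^sup>2 \<le> 3 * (S + real n powr (- 2 * \<gamma>))"
      using I(2) powr_ge_zero[of "real n" "- 2 * \<gamma>"] by argo
    then have "2 * K\<^sup>2 * (I + \<delta>\<^sup>2) \<le> 2 * K\<^sup>2 * (3 * (S + real n powr (- 2 * \<gamma>)))"
      by (intro mult_left_mono) auto
    then have "2 * K\<^sup>2 * (I + \<delta>\<^sup>2) / c \<le> 2 * K\<^sup>2 * (3 * (S + real n powr (- 2 * \<gamma>))) / c"
      using c by (intro divide_right_mono) auto
    also have "\<dots> = 6 * K\<^sup>2 / c * (S + real n powr (- 2 * \<gamma>))" by simp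
    finally show ?thesis unfolding e_def integral_unique[OF gI] by simp
  qed
  with main that show ?thesis by blast
qed

end

subsection \<open>Processes with a triangular covariance kernel\<close>

text \<open>Turns an event about signal plus scaled noise into one about the noise itself, the form
  in which shift and decoupling are available.\<close>

lemma affine_preimage:
  fixes E :: "('i \<Rightarrow> real) set"
  assumes E: "E \<in> sets (\<Pi>\<^sub>M t\<in>J. borel)"
  obtains E' where "E' \<in> sets (\<Pi>\<^sub>M t\<in>J. borel)" "\<And>y. (\<lambda>t\<in>J. y t) \<in> E' \<longleftrightarrow> (\<lambda>t\<in>J. g t + b * y t) \<in> E"
proof
  let ?B = "\<Pi>\<^sub>M t\<in>J. (borel :: real measure)"
  have "(\<lambda>x. \<lambda>t\<in>J. g t + b * x t) \<in> ?B \<rightarrow>\<^sub>M ?B" by (intro measurable_restrict) measurable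
  from measurable_sets[OF this E]
  show "(\<lambda>x. \<lambda>t\<in>J. g t + b * x t) -` E \<inter> space ?B \<in> sets ?B" .
  show "(\<lambda>t\<in>J. y t) \<in> (\<lambda>x. \<lambda>t\<in>J. g t + b * x t) -` E \<inter> space ?B \<longleftrightarrow> (\<lambda>t\<in>J. g t + b * y t) \<in> E" for y
    by (simp add: space_PiM cong: restrict_cong)
qed

locale gauss_markov_kernel = gaussian_space M S for M :: "'a measure" and S +
  fixes \<Xi> :: "real \<Rightarrow> 'a \<Rightarrow> real" and v q :: "real \<Rightarrow> real"
  assumes mem: "t \<in> {0..1} \<Longrightarrow> \<Xi> t \<in> S"
    and cov: "s \<in> {0..1} \<Longrightarrow> t \<in> {0..1} \<Longrightarrow> Cov (\<Xi> s) (\<Xi> t) = v s * v t * q (min s t)"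
    and v_pos: "t \<in> {0..1} \<Longrightarrow> 0 < v t" and v_cont: "continuous_on {0..1} v"
    and q_zero: "q 0 = 0" and q_mono: "strict_mono_on {0..1} q" and q_continuous: "continuous_on {0..1} q"
    and paths: "\<omega> \<in> space M \<Longrightarrow> continuous_on {0..1} (\<lambda>t. \<Xi> t \<omega>)"
    and start: "AE \<omega> in M. \<Xi> 0 \<omega> = 0"
begin

lemma process_measurable [measurable]: "t \<in> {0..1} \<Longrightarrow> \<Xi> t \<in> borel_measurable M"
  using meas mem by blast

abbreviation signal_prob :: "nat \<Rightarrow> (real \<Rightarrow> real) \<Rightarrow> real set \<Rightarrow> (real \<Rightarrow> real) set \<Rightarrow> real" where
  "signal_prob n g J E \<equiv> measure M {\<omega>\<in>space M. (\<lambda>t\<in>J. g t + 1 / sqrt (real n) * \<Xi> t \<omega>) \<in> E}"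

text \<open>The Cameron-Martin direction is a combination \<open>Z\<close> of finitely many values
  whose covariance with \<open>\<Xi> s\<close> is \<open>v s * H s\<close>; the interpolation
  coefficients divided by \<open>v\<close> provide it. Its variance is their quadratic form, bounded
  by the energy up to the last time.\<close>

lemma shift_process:
  assumes J: "finite J" "J \<subseteq> {0..1}" and E: "E \<in> sets (\<Pi>\<^sub>M t\<in>J. borel)"
    and H0: "H 0 = 0"
    and e: "\<And>s t. 0 \<le> s \<Longrightarrow> s \<le> t \<Longrightarrow> t \<le> 1 \<Longrightarrow> (H t - H s)\<^sup>2 \<le> (q t - q s) * (e t - e s)"
  shows "\<bar>measure M {\<omega>\<in>space M. (\<lambda>t\<in>J. \<Xi> t \<omega> + v t * H t) \<in> E} - measure M {\<omega>\<in>space M. (\<lambda>t\<in>J. \<Xi> t \<omega>) \<in> E}\<bar>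
     \<le> sqrt (e 1 - e 0)"
proof -
  define K where "K = J - {0}"
  let ?K = "insert 0 K"
  have K: "finite K" "K \<subseteq> {0<..1}" using J by (auto simp: K_def)
  have K01: "t \<in> {0..1}" if "t \<in> ?K" for t using K that by auto
  obtain a where a: "\<And>s. s \<in> ?K \<Longrightarrow> (\<Sum>t\<in>?K. a t * q (min s t)) = H s"
    "(\<Sum>t\<in>?K. a t * H t) \<le> e (Max ?K) - e 0"
    using interpolation_coefficients[OF q_zero H0 q_mono e K] by blast
  define Z where "Z \<omega> = (\<Sum>t\<in>?K. (a t / v t) * \<Xi> t \<omega>)" for \<omega>
  have ZS: "Z \<in> S" unfolding Z_def using K K01 by (intro sum_mem mem) auto
  have XZ: "Cov (\<Xi> s) Z = v s * H s" if s: "s \<in> ?K" for s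
  proof -
    have "Cov (\<Xi> s) Z = Cov Z (\<Xi> s)" by (simp add: mult.commute)
    also have "\<dots> = (\<Sum>t\<in>?K. (a t / v t) * Cov (\<Xi> t) (\<Xi> s))"
      unfolding Z_def using K K01 s by (intro inner_sum_left mem) auto
    also have "\<dots> = (\<Sum>t\<in>?K. v s * (a t * q (min s t)))"
    proof (rule sum.cong[OF refl])
      fix t assume t: "t \<in> ?K"
      show "(a t / v t) * Cov (\<Xi> t) (\<Xi> s) = v s * (a t * q (min s t))"
        using v_pos[OF K01[OF t]] cov[OF K01[OF t] K01[OF s]] by (simp add: min.commute)
    qed
    also have "\<dots> = v s * H s" by (simp only: sum_distrib_left[symmetric] a(1)[OF s])
    finally show ?thesis .
  qed
  define Q where "Q = (\<Sum>t\<in>?K. a t * H t)"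
  have ZZ: "Cov Z Z = Q"
  proof -
    have "Cov Z Z = (\<Sum>t\<in>?K. (a t / v t) * Cov (\<Xi> t) Z)"
      by (subst (1) Z_def) (use K K01 in \<open>intro inner_sum_left mem ZS; auto\<close>)
    also have "\<dots> = Q" unfolding Q_def
    proof (rule sum.cong[OF refl])
      fix t assume t: "t \<in> ?K"
      show "(a t / v t) * Cov (\<Xi> t) Z = a t * H t" using v_pos[OF K01[OF t]] XZ[OF t] by simp
    qed
    finally show ?thesis .
  qed
  have Q0: "0 \<le> Q" unfolding ZZ[symmetric] by (intro Bochner_Integration.integral_nonneg) simp
  have m: "Max ?K \<in> ?K" using K by (intro Max_in) auto
  \<comment> \<open>That \<open>e\<close> increases is implied by its inequality: squares are
    nonnegative and \<open>q\<close> increases strictly.\<close>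
  have "e (Max ?K) \<le> e 1"
  proof (cases "Max ?K = 1")
    case False
    then have lt: "0 \<le> Max ?K" "Max ?K < 1" using K01[OF m] by auto
    have "0 \<le> (q 1 - q (Max ?K)) * (e 1 - e (Max ?K))" 
      by (rule order.trans[OF zero_le_power2 e]) (use lt in auto)
    moreover have "0 < q 1 - q (Max ?K)" using strict_mono_onD[OF q_mono, of "Max ?K" 1] lt by auto
    ultimately show ?thesis by (simp add: zero_le_mult_iff)
  qed simp
  then have Qe: "Q \<le> e 1 - e 0" using a(2) unfolding Q_def by linarith
  have "\<bar>measure M {\<omega>\<in>space M. (\<lambda>t\<in>J. \<Xi> t \<omega> + v t * H t) \<in> E} - measure M {\<omega>\<in>space M. (\<lambda>t\<in>J. \<Xi> t \<omega>) \<in> E}\<bar> \<le> sqrt Q"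
  proof (rule shift_bound[OF J(1) _ ZS _ _ _ E])
    show "Cov Z Z = (sqrt Q)\<^sup>2" using ZZ Q0 by simp
    show "Cov (\<Xi> t) Z = v t * H t" if "t \<in> J" for t
      by (rule XZ) (use that in \<open>auto simp: K_def\<close>)
  qed (use J mem Q0 in auto)
  also have "\<dots> \<le> sqrt (e 1 - e 0)" using Qe by simp
  finally show ?thesis .
qed

text \<open>Dividing the noise by \<open>sqrt n\<close> magnifies the shift relative to it by
  \<open>sqrt n\<close>, hence the energy by \<open>n\<close>.\<close>

lemma shift_signal:
  assumes J: "finite J" "J \<subseteq> {0..1}" and E: "E \<in> sets (\<Pi>\<^sub>M t\<in>J. borel)"
    and n: "n \<ge> (1::nat)" and H0: "H 0 = 0" and g: "\<And>t. t \<in> {0..1} \<Longrightarrow> g1 t - g2 t = v t * H t"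
    and e: "\<And>s t. 0 \<le> s \<Longrightarrow> s \<le> t \<Longrightarrow> t \<le> 1 \<Longrightarrow> (H t - H s)\<^sup>2 \<le> (q t - q s) * (e t - e s)"
  shows "\<bar>signal_prob n g1 J E - 
      signal_prob n g2 J E\<bar>
     \<le> sqrt (real n * (e 1 - e 0))"
proof -
  let ?b = "1 / sqrt (real n)"
  have sn: "sqrt (real n) > 0" using n by simp
  obtain E' where E': "E' \<in> sets (\<Pi>\<^sub>M t\<in>J. borel)"
    "\<And>y. (\<lambda>t\<in>J. y t) \<in> E' \<longleftrightarrow> (\<lambda>t\<in>J. g2 t + ?b * y t) \<in> E" using affine_preimage[OF E] by blast
  have g1: "(\<lambda>t\<in>J. g1 t + ?b * \<Xi> t \<omega>) = (\<lambda>t\<in>J. g2 t + ?b * (\<Xi> t \<omega> + v t * (sqrt (real n) * H t)))" for \<omega>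
  proof (rule restrict_ext)
    fix t assume "t \<in> J"
    then have "t \<in> {0..1}" using J by auto
    from g[OF this] show "g1 t + ?b * \<Xi> t \<omega> = g2 t + ?b * (\<Xi> t \<omega> + v t * (sqrt (real n) * H t))"
      using sn by (simp add: add_divide_distrib)
  qed
  have "\<bar>measure M {\<omega>\<in>space M. (\<lambda>t\<in>J. \<Xi> t \<omega> + v t * (sqrt (real n) * H t)) \<in> E'} - measure M {\<omega>\<in>space M. (\<lambda>t\<in>J. \<Xi> t \<omega>) \<in> E'}\<bar>
     \<le> sqrt (real n * e 1 - real n * e 0)"
  proof (rule shift_process[OF J E'(1)])
    fix s t :: real assume st: "0 \<le> s" "s \<le> t" "t \<le> 1"
    have "(sqrt (real n) * H t - sqrt (real n) * H s)\<^sup>2 = real n * (H t - H s)\<^sup>2"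
      by (simp add: right_diff_distrib[symmetric] power_mult_distrib)
    also have "\<dots> \<le> real n * ((q t - q s) * (e t - e s))" by (intro mult_left_mono e st) simp
    finally show "(sqrt (real n) * H t - sqrt (real n) * H s)\<^sup>2 \<le> (q t - q s) * (real n * e t - real n * e s)"
      by (simp add: algebra_simps)
  qed (simp add: H0)
  then show ?thesis unfolding E'(2) g1 by (simp add: right_diff_distrib)
qed

section \<open>The bridge between the grid points\<close>

text \<open>The increments of \<open>\<Xi> / v\<close> over disjoint intervals are uncorrelated,
  with variances given by \<open>q\<close>. Regression of \<open>\<Xi> t\<close> on the grid
  increments is therefore interpolation linear in \<open>q\<close>, and the bridge is the
  residual.\<close>

definition bridge :: "nat \<Rightarrow> real \<Rightarrow> 'a \<Rightarrow> real" where
  "bridge n t \<omega> = \<Xi> t \<omega> - v t * interp q n (\<lambda>i. \<Xi> (grid n i) \<omega> / v (grid n i)) t"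

lemma grid_in: "n \<ge> 1 \<Longrightarrow> i \<le> n \<Longrightarrow> grid n i \<in> {0..1}"
  by (auto simp: divide_le_eq_1)

lemma grid_less:
  assumes "n \<ge> 1" "1 \<le> i" "i \<le> n"
  shows "q (grid n (i - 1)) < q (grid n i)"
  using assms grid_in[of n i] grid_in[of n "i - 1"] 
  by (intro strict_mono_onD[OF q_mono] divide_strict_right_mono) auto

text \<open>Only the part of the cell before \<open>t\<close> is shared with \<open>\<Xi> t\<close>;
  its right end point is the clipped time.\<close>

lemma cov_increment:
  assumes n: "n \<ge> 1" and k: "1 \<le> k" "k \<le> n" and t: "t \<in> {0..1}"
  shows "(\<integral>\<omega>. \<Xi> t \<omega> * (\<Xi> (grid n k) \<omega> / v (grid n k) - \<Xi> (grid n (k - 1)) \<omega> / v (grid n (k - 1))) \<partial>M)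
    = v t * (q (clip n k t) - q (grid n (k - 1)))"
proof -
  let ?a = "grid n (k - 1)" and ?b = "grid n k"
  have ab: "?a \<in> {0..1}" "?b \<in> {0..1}" using grid_in[OF n] k by auto
  have le: "?a \<le> ?b" by (simp add: divide_right_mono)
  have "(\<integral>\<omega>. \<Xi> t \<omega> * (\<Xi> ?b \<omega> / v ?b - \<Xi> ?a \<omega> / v ?a) \<partial>M) = (\<integral>\<omega>. (\<Xi> t \<omega> * \<Xi> ?b \<omega>) / v ?b - (\<Xi> t \<omega> * \<Xi> ?a \<omega>) / v ?a \<partial>M)"
    by (simp only: right_diff_distrib times_divide_eq_right)
  also have "\<dots> = Cov (\<Xi> t) (\<Xi> ?b) / v ?b - Cov (\<Xi> t) (\<Xi> ?a) / v ?a"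
    using integrable_mult[OF mem[OF t] mem[OF ab(1)]] integrable_mult[OF mem[OF t] mem[OF ab(2)]]
    by (subst Bochner_Integration.integral_diff) auto
  also have "\<dots> = v t * (q (min t ?b) - q (min t ?a))"
    using v_pos[OF ab(1)] v_pos[OF ab(2)] unfolding cov[OF t ab(1)] cov[OF t ab(2)] by (simp add: algebra_simps)
  also have "q (min t ?b) - q (min t ?a) = q (clip n k t) - q ?a"
    using le unfolding clip_def by (cases "t \<le> ?a") (simp_all add: min_def max_def del: of_nat_diff)
  finally show ?thesis .
qed

text \<open>The cell increments \<open>Z k\<close> of \<open>\<Xi> / v\<close> are orthogonal with
  variance \<open>d k\<close>, and \<open>a t k\<close> is the covariance of \<open>\<Xi> t\<close>
  with \<open>Z k\<close> divided by \<open>d k\<close>. The residual is thus orthogonal to all of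
  them, and \<open>decoupling\<close> lets it come from the second factor.\<close>

lemma bridge_decoupling:
  assumes n: "n \<ge> 1" and J: "finite J" "J \<subseteq> {0..1}" and E: "E \<in> sets (\<Pi>\<^sub>M t\<in>J. borel)"
  shows "measure M {\<omega>\<in>space M. (\<lambda>t\<in>J. g t + b * \<Xi> t \<omega>) \<in> E} =
    measure (M \<Otimes>\<^sub>M M) {p\<in>space (M \<Otimes>\<^sub>M M). 
      (\<lambda>t\<in>J. g t + b * (v t * interp q n (\<lambda>i. \<Xi> (grid n i) (fst p) / v (grid n i)) t) + b * bridge n t (snd p)) \<in> E}"
proof -
  let ?t = "grid n"
  let ?B = "\<Pi>\<^sub>M t\<in>J. (borel :: real measure)"
  define W where "W i \<omega> = \<Xi> (?t i) \<omega> / v (?t i)" for i \<omega>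
  define Z where "Z k \<omega> = W k \<omega> - W (k - 1) \<omega>" for k :: nat and \<omega>
  define d where "d k = q (?t k) - q (?t (k - 1))" for k
  define a where "a t k = v t * ((q (clip n k t) - q (?t (k - 1))) / d k)" for t k
  have d0: "d k > 0" if "k \<in> {1..n}" for k using grid_less[OF n] that by (simp add: d_def)
  have WS: "W i \<in> S" if "i \<le> n" for i
    using scale_mem[OF mem[OF grid_in[OF n that]], of "1 / v (?t i)"] unfolding W_def by simp
  have ZS: "Z k \<in> S" if "k \<in> {1..n}" for k unfolding Z_def by (intro diff_mem WS) (use that in auto)
  have interp: "v t * interp q n (\<lambda>i. W i \<omega>) t = (\<Sum>k\<in>{1..n}. a t k * Z k \<omega>)" for t \<omega>
    by (simp add: interp_def a_def d_def Z_def sum_distrib_left mult.assoc)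
  have R: "bridge n t \<omega> = \<Xi> t \<omega> - (\<Sum>k\<in>{1..n}. a t k * Z k \<omega>)" for t \<omega>
    unfolding interp[symmetric] by (simp add: bridge_def W_def)
  have XZ: "Cov (\<Xi> t) (Z k) = v t * (q (clip n k t) - q (?t (k - 1)))" if "t \<in> {0..1}" "k \<in> {1..n}" for t k
    using cov_increment[OF n _ _ that(1), of k] that(2) by (simp add: Z_def W_def)
  have ZZ: "Cov (Z j) (Z k) = (if j = k then d k else 0)" if jk: "j \<in> {1..n}" "k \<in> {1..n}" for j k
  proof -
    have j: "?t j \<in> {0..1}" "?t (j - 1) \<in> {0..1}" using grid_in[OF n] jk by auto
    have le: "grid n x \<le> grid n y \<longleftrightarrow> x \<le> y" for x y using n by (simp add: divide_le_cancel)
    have "Cov (Z j) (Z k) = (\<integral>\<omega>. (\<Xi> (?t j) \<omega> * Z k \<omega>) / v (?t j) - (\<Xi> (?t (j - 1)) \<omega> * Z k \<omega>) / v (?t (j - 1)) \<partial>M)"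
      unfolding Z_def[of j] W_def by (simp only: left_diff_distrib times_divide_eq_left)
    also have "\<dots> = Cov (\<Xi> (?t j)) (Z k) / v (?t j) - Cov (\<Xi> (?t (j - 1))) (Z k) / v (?t (j - 1))"
      by (subst Bochner_Integration.integral_diff) (use j ZS jk in \<open>auto intro!: integrable_divide_zero integrable_mult mem simp del: of_nat_diff\<close>)
    also have "\<dots> = q (clip n k (?t j)) - q (clip n k (?t (j - 1)))"
      using v_pos[OF j(1)] v_pos[OF j(2)] unfolding XZ[OF j(1) jk(2)] XZ[OF j(2) jk(2)] by simp
    also have "\<dots> = (if j = k then d k else 0)"
    proof -
      consider "j < k" | "j = k" | "k < j" by linarith
      then show ?thesis
      proof cases
        case 1
        then have "clip n k (?t j) = ?t (k - 1)" "clip n k (?t (j - 1)) = ?t (k - 1)"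
          unfolding clip_def using le[of j "k-1"] le[of "j-1" "k-1"] le[of j k] le[of "j-1" k] by (auto simp del: of_nat_diff)
        then show ?thesis using 1 by simp
      next
        case 2
        then have "clip n k (?t j) = ?t k" "clip n k (?t (j - 1)) = ?t (k - 1)"
          unfolding clip_def using le[of "k-1" k] by (auto simp del: of_nat_diff)
        then show ?thesis using 2 by (simp add: d_def)
      next
        case 3
        then have "clip n k (?t j) = ?t k" "clip n k (?t (j - 1)) = ?t k"
          unfolding clip_def using le[of k j] le[of k "j-1"] le[of "k-1" k] by (auto simp del: of_nat_diff)
        then show ?thesis using 3 by simp
      qed
    qed
    finally show ?thesis .
  qed
  have orth: "Cov (bridge n t) (Z k) = 0" if t: "t \<in> J" and k: "k \<in> {1..n}" for t k
  proof -
    have t01: "t \<in> {0..1}" using t J by auto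
    have sS: "(\<lambda>\<omega>. \<Sum>k\<in>{1..n}. a t k * Z k \<omega>) \<in> S" by (rule sum_mem[OF _ ZS]) auto
    have "Cov (bridge n t) (Z k) = (\<integral>\<omega>. \<Xi> t \<omega> * Z k \<omega> - (\<Sum>k\<in>{1..n}. a t k * Z k \<omega>) * Z k \<omega> \<partial>M)"
      unfolding R by (simp only: left_diff_distrib)
    also have "\<dots> = Cov (\<Xi> t) (Z k) - (\<integral>\<omega>. (\<Sum>k\<in>{1..n}. a t k * Z k \<omega>) * Z k \<omega> \<partial>M)"
      by (intro Bochner_Integration.integral_diff integrable_mult mem ZS sS t01 k)
    also have "(\<integral>\<omega>. (\<Sum>k\<in>{1..n}. a t k * Z k \<omega>) * Z k \<omega> \<partial>M) = (\<Sum>j\<in>{1..n}. a t j * Cov (Z j) (Z k))"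
      by (rule inner_sum_left[OF _ ZS ZS[OF k]]) auto
    also have "\<dots> = (\<Sum>j\<in>{1..n}. if j = k then a t k * d k else 0)"
      using k by (intro sum.cong refl) (auto simp: ZZ)
    also have "\<dots> = a t k * d k" using k by simp
    also have "Cov (\<Xi> t) (Z k) = a t k * d k" using d0[OF k] by (simp add: XZ[OF t01 k] a_def)
    finally show ?thesis by simp
  qed
  have D: "distr M ?B (\<lambda>\<omega>. \<lambda>t\<in>J. \<Xi> t \<omega>) =
    distr (M \<Otimes>\<^sub>M M) ?B (\<lambda>p. \<lambda>t\<in>J. (\<Sum>k\<in>{1..n}. a t k * Z k (fst p)) + bridge n t (snd p))"
    by (rule decoupling[OF J(1) _ mem ZS R orth]) (use J in auto)
  have bS: "bridge n t \<in> S" if "t \<in> {0..1}" for t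
  proof -
    have "bridge n t = (\<lambda>\<omega>. \<Xi> t \<omega> - (\<Sum>k\<in>{1..n}. a t k * Z k \<omega>))" using R by (rule ext)
    then show ?thesis using diff_mem[OF mem[OF that] sum_mem[OF _ ZS, of "{1..n}", where c="a t"]] by simp
  qed
  obtain E' where E': "E' \<in> sets ?B"
    "\<And>y. (\<lambda>t\<in>J. y t) \<in> E' \<longleftrightarrow> (\<lambda>t\<in>J. g t + b * y t) \<in> E" using affine_preimage[OF E] by blast
  have mX: "(\<lambda>\<omega>. \<lambda>t\<in>J. \<Xi> t \<omega>) \<in> M \<rightarrow>\<^sub>M ?B" using J by (intro measurable_restrict meas mem) auto
  note mm = measurable_compose[OF measurable_fst] measurable_compose[OF measurable_snd]
  have mP: "(\<lambda>p. \<lambda>t\<in>J. (\<Sum>k\<in>{1..n}. a t k * Z k (fst p)) + bridge n t (snd p)) \<in> M \<Otimes>\<^sub>M M \<rightarrow>\<^sub>M ?B"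
    using J by (intro measurable_restrict borel_measurable_add borel_measurable_sum borel_measurable_times borel_measurable_const 
       mm(1)[OF meas[OF ZS]] mm(2)[OF meas[OF bS]]) auto
  have "measure (distr M ?B (\<lambda>\<omega>. \<lambda>t\<in>J. \<Xi> t \<omega>)) E' = measure (distr (M \<Otimes>\<^sub>M M) ?B (\<lambda>p. \<lambda>t\<in>J. (\<Sum>k\<in>{1..n}. a t k * Z k (fst p)) + bridge n t (snd p))) E'"
    unfolding D ..
  then have "measure M {\<omega>\<in>space M. (\<lambda>t\<in>J. \<Xi> t \<omega>) \<in> E'} =
      measure (M \<Otimes>\<^sub>M M) {p\<in>space (M \<Otimes>\<^sub>M M). (\<lambda>t\<in>J. (\<Sum>k\<in>{1..n}. a t k * Z k (fst p)) + bridge n t (snd p)) \<in> E'}"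
    unfolding measure_distr[OF mX E'(1)] measure_distr[OF mP E'(1)] by (simp add: vimage_def Int_def conj_commute)
  then show ?thesis
    unfolding E'(2) interp[symmetric] W_def by (simp add: algebra_simps cong: restrict_cong)
qed

end

subsection \<open>Markov kernels between the two experiments\<close>

lemma interp_cong:
  assumes "\<And>i. i \<le> n \<Longrightarrow> w i = w' i"
  shows "interp q n w t = interp q n w' t"
  unfolding interp_def using assms by (intro sum.cong) auto

lemma interp_add: "interp q n (\<lambda>i. w1 i + b * w2 i) t = interp q n w1 t + b * interp q n w2 t"
proof -
  have "c * (x1 + b * y1 - (x0 + b * y0)) = c * (x1 - x0) + b * (c * (y1 - y0))" for c x1 y1 x0 y0 :: real
    by (simp add: algebra_simps)
  then show ?thesis unfolding interp_def sum_distrib_left sum.distrib[symmetric] by (simp only:)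
qed

lemma total_variation_le:
  assumes "\<And>A. A \<in> sets P \<Longrightarrow> \<bar>measure P A - measure Q A\<bar> \<le> c"
  shows "total_variation P Q \<le> ennreal c"
  unfolding total_variation_def using assms by (intro SUP_least ennreal_leI)

context gauss_markov_kernel
begin

lemma signal_measurable:
  assumes "continuous_on {0..1} g"
  shows "(\<lambda>\<omega>. \<lambda>t\<in>{0..1}. g t + b * \<Xi> t \<omega>) \<in> M \<rightarrow>\<^sub>M C01_borel"
proof (rule C01_measurableI)
  fix \<omega> assume "\<omega> \<in> space M"
  then have "continuous_on {0..1} (\<lambda>t. g t + b * \<Xi> t \<omega>)" using assms paths by (intro continuous_intros)
  then have "continuous_on {0..1} (\<lambda>t\<in>{0..1}. g t + b * \<Xi> t \<omega>)" by (rule continuous_on_eq) auto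
  then show "(\<lambda>t\<in>{0..1}. g t + b * \<Xi> t \<omega>) \<in> mspace C01_metric" by (simp add: mspace_C01)
next
  fix t :: real assume t: "t \<in> {0..1}"
  have "(\<lambda>\<omega>. g t + b * \<Xi> t \<omega>) \<in> borel_measurable M" using process_measurable[OF t] by measurable
  then show "(\<lambda>\<omega>. (\<lambda>t\<in>{0..1}. g t + b * \<Xi> t \<omega>) t) \<in> borel_measurable M" using t by simp
qed

text \<open>Applied to the samples \<open>f (j / n)\<close> this is the interpolated Riemann sum;
  applied to the data it also carries interpolated noise. Interpolating after division by
  \<open>v\<close> makes that noise term exactly the one subtracted in
  \<open>bridge\<close>.\<close>

definition drift :: "nat \<Rightarrow> (nat \<Rightarrow> real) \<Rightarrow> real \<Rightarrow> real" where
  "drift n y t = v t * interp q n (\<lambda>i. (\<Sum>j=1..i. y j) / real n / v (grid n i)) t"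

definition reconstruct :: "nat \<Rightarrow> (nat \<Rightarrow> real) \<Rightarrow> 'a \<Rightarrow> real \<Rightarrow> real" where
  "reconstruct n y \<omega> = (\<lambda>t\<in>{0..1}. drift n y t + 1 / sqrt (real n) * bridge n t \<omega>)"

lemma drift_cont: "n \<ge> 1 \<Longrightarrow> continuous_on {0..1} (drift n y)"
  unfolding drift_def by (intro continuous_intros v_cont continuous_on_interp q_continuous)

lemma drift_grid:
  assumes n: "n \<ge> 1" and i: "i \<le> n"
  shows "drift n y (grid n i) = (\<Sum>j=1..i. y j) / real n"
proof -
  have "interp q n (\<lambda>i. (\<Sum>j=1..i. y j) / real n / v (grid n i)) (grid n i) = (\<Sum>j=1..i. y j) / real n / v (grid n i) - (\<Sum>j=1..0. y j) / real n / v (grid n 0)"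
    by (rule interp_grid[OF n i]) (use grid_less[OF n] in fastforce)
  then show ?thesis using v_pos[OF grid_in[OF n i]] unfolding drift_def by simp
qed

lemma bridge_cont:
  assumes "n \<ge> 1" "\<omega> \<in> space M"
  shows "continuous_on {0..1} (\<lambda>t. bridge n t \<omega>)"
  unfolding bridge_def using assms by (intro continuous_intros v_cont continuous_on_interp q_continuous paths)

lemma bridge_measurable:
  assumes n: "n \<ge> 1" and t: "t \<in> {0..1}"
  shows "bridge n t \<in> borel_measurable M"
proof -
  have "(\<lambda>\<omega>. \<Xi> (grid n i) \<omega> / v (grid n i)) \<in> borel_measurable M" if "i \<le> n" for i
    by (intro borel_measurable_divide process_measurable grid_in n that) simp
  then have "(\<lambda>\<omega>. \<Xi> t \<omega> - v t * interp q n (\<lambda>i. \<Xi> (grid n i) \<omega> / v (grid n i)) t) \<in> borel_measurable M"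
    unfolding interp_def
    by (intro borel_measurable_diff borel_measurable_times borel_measurable_sum borel_measurable_const process_measurable t) auto
  then show ?thesis unfolding bridge_def[abs_def] by simp
qed

lemma drift_measurable: "(\<lambda>y. drift n y t) \<in> borel_measurable (\<Pi>\<^sub>M i\<in>{1..n}. (borel :: real measure))"
proof -
  have m: "(\<lambda>y. (\<Sum>j=1..i. y j) / real n / v (grid n i)) \<in> borel_measurable (\<Pi>\<^sub>M i\<in>{1..n}. (borel :: real measure))" if "i \<le> n" for i
    by (intro borel_measurable_divide borel_measurable_sum borel_measurable_const measurable_component_singleton) (use that in auto)
  show ?thesis
    unfolding drift_def interp_def
    by (intro borel_measurable_diff borel_measurable_times borel_measurable_sum borel_measurable_const m) auto
qed

lemma reconstruct_measurable:
  assumes n: "n \<ge> 1"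
  shows "(\<lambda>p. reconstruct n (fst p) (snd p)) \<in> (\<Pi>\<^sub>M i\<in>{1..n}. (borel :: real measure)) \<Otimes>\<^sub>M M \<rightarrow>\<^sub>M C01_borel"
proof (rule C01_measurableI)
  fix p assume "p \<in> space ((\<Pi>\<^sub>M i\<in>{1..n}. (borel :: real measure)) \<Otimes>\<^sub>M M)"
  then have "snd p \<in> space M" by (auto simp: space_pair_measure)
  then have "continuous_on {0..1} (\<lambda>t. drift n (fst p) t + 1 / sqrt (real n) * bridge n t (snd p))" 
    by (intro continuous_on_add continuous_on_mult continuous_on_const drift_cont bridge_cont n)
  then have "continuous_on {0..1} (reconstruct n (fst p) (snd p))" 
    unfolding reconstruct_def by (rule continuous_on_eq) auto
  then show "reconstruct n (fst p) (snd p) \<in> mspace C01_metric" by (simp add: mspace_C01 reconstruct_def)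
next
  fix t :: real assume t: "t \<in> {0..1}"
  have "(\<lambda>p. drift n (fst p) t + 1 / sqrt (real n) * bridge n t (snd p)) \<in> borel_measurable ((\<Pi>\<^sub>M i\<in>{1..n}. (borel :: real measure)) \<Otimes>\<^sub>M M)"
    by (intro borel_measurable_add borel_measurable_times borel_measurable_const 
       measurable_compose[OF measurable_fst drift_measurable] measurable_compose[OF measurable_snd bridge_measurable] n t)
  then show "(\<lambda>p. reconstruct n (fst p) (snd p) t) \<in> borel_measurable ((\<Pi>\<^sub>M i\<in>{1..n}. (borel :: real measure)) \<Otimes>\<^sub>M M)"
    using t by (simp add: reconstruct_def)
qed

lemma kernel_measurable:
  assumes n: "n \<ge> 1"
  shows "(\<lambda>y. distr M C01_borel (reconstruct n y)) \<in> (\<Pi>\<^sub>M i\<in>{1..n}. (borel :: real measure)) \<rightarrow>\<^sub>M prob_algebra C01_borel"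
proof (rule measurable_prob_algebraI)
  show "prob_space (distr M C01_borel (reconstruct n y))" if "y \<in> space (\<Pi>\<^sub>M i\<in>{1..n}. (borel :: real measure))" for y
    using measurable_compose[OF measurable_Pair1'[OF that, of M] reconstruct_measurable[OF n]]
    by (intro prob_space_distr) simp
  show "(\<lambda>y. distr M C01_borel (reconstruct n y)) \<in> (\<Pi>\<^sub>M i\<in>{1..n}. (borel :: real measure)) \<rightarrow>\<^sub>M subprob_algebra C01_borel"
  proof (rule measurable_distr2)
    show "case_prod (reconstruct n) \<in> (\<Pi>\<^sub>M i\<in>{1..n}. (borel :: real measure)) \<Otimes>\<^sub>M M \<rightarrow>\<^sub>M C01_borel"
      using reconstruct_measurable[OF n] by (simp add: case_prod_beta')
    show "(\<lambda>y. M) \<in> (\<Pi>\<^sub>M i\<in>{1..n}. (borel :: real measure)) \<rightarrow>\<^sub>M subprob_algebra M"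
      by (intro measurable_const) (simp add: space_subprob_algebra prob_space_imp_subprob_space prob_space_axioms)
  qed
qed

abbreviation obs1 :: "nat \<Rightarrow> (real \<Rightarrow> real) \<Rightarrow> 'a \<Rightarrow> nat \<Rightarrow> real" where
  "obs1 n f \<omega> \<equiv> \<lambda>i\<in>{1..n}. f (grid n i) + sqrt (real n) * (\<Xi> (grid n i) \<omega> - \<Xi> (grid n (i - 1)) \<omega>)"

lemma obs1_measurable:
  assumes n: "n \<ge> 1"
  shows "obs1 n f \<in> M \<rightarrow>\<^sub>M (\<Pi>\<^sub>M i\<in>{1..n}. (borel :: real measure))"
  by (intro measurable_restrict borel_measurable_add borel_measurable_times borel_measurable_diff borel_measurable_const 
      process_measurable grid_in n) auto

text \<open>The noise increments telescope to \<open>sqrt n * \<Xi> (i / n)\<close>, and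
  \<open>sqrt n / n = 1 / sqrt n\<close> is the noise level of the continuous model.\<close>

lemma drift_obs1:
  assumes n: "n \<ge> 1" and z: "\<Xi> 0 \<omega> = 0"
  shows "drift n (obs1 n f \<omega>) t = drift n (\<lambda>j. f (grid n j)) t + 
    1 / sqrt (real n) * (v t * interp q n (\<lambda>i. \<Xi> (grid n i) \<omega> / v (grid n i)) t)"
proof -
  let ?t = "grid n"
  have sn: "sqrt (real n) / real n = 1 / sqrt (real n)" using n by (simp add: real_div_sqrt divide_simps)
  have s: "(\<Sum>j=1..i. obs1 n f \<omega> j) = (\<Sum>j=1..i. f (?t j)) + sqrt (real n) * \<Xi> (?t i) \<omega>" if "i \<le> n" for i
    using that
  proof (induction i)
    case 0
    then show ?case using z by simp
  next
    case (Suc i)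
    then show ?case by (simp add: algebra_simps)
  qed
  have "interp q n (\<lambda>i. (\<Sum>j=1..i. obs1 n f \<omega> j) / real n / v (?t i)) t
    = interp q n (\<lambda>i. (\<Sum>j=1..i. f (?t j)) / real n / v (?t i) + 1 / sqrt (real n) * (\<Xi> (?t i) \<omega> / v (?t i))) t"
  proof (rule interp_cong)
    fix i assume "i \<le> n"
    have "((\<Sum>j=1..i. f (?t j)) + sqrt (real n) * \<Xi> (?t i) \<omega>) / real n = (\<Sum>j=1..i. f (?t j)) / real n + (sqrt (real n) / real n) * \<Xi> (?t i) \<omega>"
      by (simp add: add_divide_distrib)
    then show "(\<Sum>j=1..i. obs1 n f \<omega> j) / real n / v (?t i) = (\<Sum>j=1..i. f (?t j)) / real n / v (?t i) + 1 / sqrt (real n) * (\<Xi> (?t i) \<omega> / v (?t i))"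
      unfolding s[OF \<open>i \<le> n\<close>] sn by (simp add: add_divide_distrib)
  qed
  then show ?thesis unfolding drift_def interp_add by (simp add: algebra_simps)
qed

text \<open>The data live on the first copy of \<open>M\<close> and the simulated bridge on the
  second, so Fubini turns the composition of law and kernel into a product measure, which
  \<open>bridge_decoupling\<close> recognises as interpolated signal plus process.\<close>

lemma kernel_law:
  assumes n: "n \<ge> 1" and J: "finite J" "J \<subseteq> {0..1}" and E: "E \<in> sets (\<Pi>\<^sub>M t\<in>J. borel)"
  shows "measure (bind (distr M (\<Pi>\<^sub>M i\<in>{1..n}. (borel :: real measure)) (obs1 n f)) (\<lambda>y. distr M C01_borel (reconstruct n y)))
      {x\<in>mspace C01_metric. restrict x J \<in> E}
    = signal_prob n (drift n (\<lambda>j. f (grid n j))) J E"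
proof -
  interpret P: pair_prob_space M M ..
  let ?B = "\<Pi>\<^sub>M i\<in>{1..n}. (borel :: real measure)"
  let ?C = "{x\<in>mspace C01_metric. restrict x J \<in> E}"
  let ?b = "1 / sqrt (real n)"
  let ?K = "\<lambda>y. distr M C01_borel (reconstruct n y)"
  define G where "G \<omega> t = drift n (\<lambda>j. f (grid n j)) t + 
    ?b * (v t * interp q n (\<lambda>i. \<Xi> (grid n i) \<omega> / v (grid n i)) t)" for \<omega> t
  have C: "?C \<in> sets C01_borel" using cylinders_sets J E unfolding cylinders_def by blast
  have mR: "reconstruct n y \<in> M \<rightarrow>\<^sub>M C01_borel" if "y \<in> space ?B" for y
    using measurable_compose[OF measurable_Pair1'[OF that, of M] reconstruct_measurable[OF n]] by simp
  have spB: "obs1 n f \<omega> \<in> space ?B" for \<omega> by (simp add: space_PiM)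
  have mK: "?K \<in> ?B \<rightarrow>\<^sub>M subprob_algebra C01_borel"
    by (rule measurable_prob_algebraD[OF kernel_measurable[OF n]])
  have mK': "?K \<in> distr M ?B (obs1 n f) \<rightarrow>\<^sub>M subprob_algebra C01_borel" using mK by simp
  define Q where "Q = {p\<in>space (M \<Otimes>\<^sub>M M). (\<lambda>t\<in>J. G (fst p) t + ?b * bridge n t (snd p)) \<in> E}"
  have Q: "Q \<in> sets (M \<Otimes>\<^sub>M M)"
  proof -
    have G: "(\<lambda>\<omega>. G \<omega> t) \<in> borel_measurable M" for t
    proof -
      have "(\<lambda>\<omega>. \<Xi> (grid n i) \<omega> / v (grid n i)) \<in> borel_measurable M" if "i \<le> n" for i
        by (intro borel_measurable_divide process_measurable grid_in n that) simp
      then show ?thesis unfolding G_def interp_def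
        by (intro borel_measurable_add borel_measurable_diff borel_measurable_times borel_measurable_sum borel_measurable_const) auto
    qed
    have "(\<lambda>p. \<lambda>t\<in>J. G (fst p) t + ?b * bridge n t (snd p)) \<in> M \<Otimes>\<^sub>M M \<rightarrow>\<^sub>M (\<Pi>\<^sub>M t\<in>J. borel)"
      using J by (intro measurable_restrict borel_measurable_add borel_measurable_times borel_measurable_const
          measurable_compose[OF measurable_fst G] measurable_compose[OF measurable_snd bridge_measurable] n) auto
    from measurable_sets[OF this E] show ?thesis by (simp add: Q_def vimage_def Int_def conj_commute)
  qed
  have "emeasure (bind (distr M ?B (obs1 n f)) ?K) ?C = (\<integral>\<^sup>+y. emeasure (?K y) ?C \<partial>distr M ?B (obs1 n f))"
    by (rule emeasure_bind[OF _ mK' C]) (simp add: space_PiM PiE_eq_empty_iff)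
  also have "\<dots> = (\<integral>\<^sup>+\<omega>. emeasure (?K (obs1 n f \<omega>)) ?C \<partial>M)"
    by (rule nn_integral_distr[OF obs1_measurable[OF n]]) (rule measurable_emeasure_kernel[OF mK' C])
  also have "\<dots> = (\<integral>\<^sup>+\<omega>. emeasure M (Pair \<omega> -` Q) \<partial>M)"
  proof (rule nn_integral_cong_AE)
    have key: "emeasure (?K (obs1 n f \<omega>)) ?C = emeasure M (Pair \<omega> -` Q)" if z: "\<Xi> 0 \<omega> = 0" and \<omega>: "\<omega> \<in> space M" for \<omega>
    proof -
      have "restrict (reconstruct n (obs1 n f \<omega>) \<omega>') J = (\<lambda>t\<in>J. G \<omega> t + ?b * bridge n t \<omega>')" for \<omega>'
        unfolding reconstruct_def G_def drift_obs1[OF n z] using J by (auto simp: fun_eq_iff restrict_def)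
      moreover have "reconstruct n (obs1 n f \<omega>) \<omega>' \<in> mspace C01_metric" if "\<omega>' \<in> space M" for \<omega>'
        using measurable_space[OF mR[OF spB] that] by (simp add: space_C01)
      ultimately have "reconstruct n (obs1 n f \<omega>) -` ?C \<inter> space M = Pair \<omega> -` Q"
        using \<omega> by (auto simp: Q_def space_pair_measure)
      then show ?thesis using emeasure_distr[OF mR[OF spB] C] by simp
    qed
    \<comment> \<open>The telescoping in \<open>drift_obs1\<close> requires
      \<open>\<Xi> 0 = 0\<close>, which is given almost surely.\<close>
    show "AE \<omega> in M. emeasure (?K (obs1 n f \<omega>)) ?C = emeasure M (Pair \<omega> -` Q)"
      using start AE_space by eventually_elim (rule key)
  qed
  also have "\<dots> = emeasure (M \<Otimes>\<^sub>M M) Q" by (rule emeasure_pair_measure_alt[OF Q, symmetric])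
  finally have "measure (bind (distr M ?B (obs1 n f)) ?K) ?C = measure (M \<Otimes>\<^sub>M M) Q"
    by (simp add: measure_def)
  also have "\<dots> = signal_prob n (drift n (\<lambda>j. f (grid n j))) J E"
    unfolding bridge_decoupling[OF n J E] Q_def G_def ..
  finally show ?thesis .
qed

section \<open>The two deficiencies\<close>

text \<open>On cylinders \<open>kernel_law\<close> gives the law of the reconstructed path, and
  cylinders control the total variation distance. The hypothesis on \<open>c\<close> is shared with
  the other deficiency, so one shift estimate serves both.\<close>

lemma deficiency_12:
  assumes n: "n \<ge> 1" and f: "\<And>f. f \<in> \<Theta> \<Longrightarrow> continuous_on {0..1} f"
    and c: "\<And>f J E. f \<in> \<Theta> \<Longrightarrow> finite J \<Longrightarrow> J \<subseteq> {0..1} \<Longrightarrow> E \<in> sets (\<Pi>\<^sub>M t\<in>J. borel) \<Longrightarrow>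
       \<bar>signal_prob n (drift n (\<lambda>j. f (grid n j))) J E
       - signal_prob n (\<lambda>t. integral {0..t} f) J E\<bar> \<le> c"
  shows "deficiency (experiment1 M \<Xi> n \<Theta>) (experiment2 M \<Xi> n \<Theta>) \<le> ennreal c"
  unfolding deficiency_def
proof (rule INF_lower2)
  let ?B = "\<Pi>\<^sub>M i\<in>{1..n}. (borel :: real measure)"
  let ?K = "\<lambda>y. distr M C01_borel (reconstruct n y)"
  show "?K \<in> sample_space (experiment1 M \<Xi> n \<Theta>) \<rightarrow>\<^sub>M prob_algebra (sample_space (experiment2 M \<Xi> n \<Theta>))"
    using kernel_measurable[OF n] by (simp add: experiment1_def experiment2_def)
  show "(SUP f\<in>parameters (experiment1 M \<Xi> n \<Theta>). total_variation (bind (law (experiment1 M \<Xi> n \<Theta>) f) ?K) (law (experiment2 M \<Xi> n \<Theta>) f)) \<le> ennreal c"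
  proof (rule SUP_least)
    fix f assume "f \<in> parameters (experiment1 M \<Xi> n \<Theta>)"
    then have f\<Theta>: "f \<in> \<Theta>" by (simp add: experiment1_def)
    have cF: "continuous_on {0..1} (\<lambda>t. integral {0..t} f)"
      by (intro indefinite_integral_continuous_1 integrable_continuous_interval f f\<Theta>)
    let ?X = "\<lambda>\<omega>. \<lambda>t\<in>{0..1}. integral {0..t} f + 1 / sqrt (real n) * \<Xi> t \<omega>"
    have mX: "?X \<in> M \<rightarrow>\<^sub>M C01_borel" by (rule signal_measurable[OF cF])
    have mK: "?K \<in> distr M ?B (obs1 n f) \<rightarrow>\<^sub>M subprob_algebra C01_borel"
      using measurable_prob_algebraD[OF kernel_measurable[OF n]] by simp
    interpret Y: prob_space "distr M ?B (obs1 n f)" by (rule prob_space_distr[OF obs1_measurable[OF n]])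
    have "total_variation (bind (distr M ?B (obs1 n f)) ?K) (distr M C01_borel ?X) \<le> ennreal c"
    proof (rule total_variation_C01_le)
      show "prob_space (distr M C01_borel ?X)" by (rule prob_space_distr[OF mX])
      show "prob_space (bind (distr M ?B (obs1 n f)) ?K)"
      proof (rule Y.prob_space_bind[OF _ mK], rule AE_I2)
        fix y assume "y \<in> space (distr M ?B (obs1 n f))"
        then show "prob_space (?K y)"
          using measurable_space[OF kernel_measurable[OF n], of y] by (simp add: space_prob_algebra)
      qed
      show "sets (bind (distr M ?B (obs1 n f)) ?K) = sets C01_borel"
        by (rule sets_bind) (auto simp: space_PiM)
      show "sets (distr M C01_borel ?X) = sets C01_borel" by simp
      fix J :: "real set" and E assume J: "finite J" "J \<subseteq> {0..1}" and E: "E \<in> sets (\<Pi>\<^sub>M i\<in>J. (borel :: real measure))"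
      let ?C = "{x\<in>mspace C01_metric. restrict x J \<in> E}"
      have C: "?C \<in> sets C01_borel" using cylinders_sets J E unfolding cylinders_def by blast
      have "?X -` ?C \<inter> space M = {\<omega>\<in>space M. (\<lambda>t\<in>J. integral {0..t} f + 1 / sqrt (real n) * \<Xi> t \<omega>) \<in> E}"
      proof -
        have "restrict (?X \<omega>) J = (\<lambda>t\<in>J. integral {0..t} f + 1 / sqrt (real n) * \<Xi> t \<omega>)" for \<omega>
          using J by (auto simp: fun_eq_iff restrict_def)
        moreover have "?X \<omega> \<in> mspace C01_metric" if "\<omega> \<in> space M" for \<omega>
          using measurable_space[OF mX that] by (simp add: space_C01)
        ultimately show ?thesis by auto
      qed
      then have "measure (distr M C01_borel ?X) ?C = signal_prob n (\<lambda>t. integral {0..t} f) J E"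
        using measure_distr[OF mX C] by simp
      then show "\<bar>measure (bind (distr M ?B (obs1 n f)) ?K) ?C - measure (distr M C01_borel ?X) ?C\<bar> \<le> c"
        using c[OF f\<Theta> J E] unfolding kernel_law[OF n J E] by simp
    qed
    then show "total_variation (bind (law (experiment1 M \<Xi> n \<Theta>) f) ?K) (law (experiment2 M \<Xi> n \<Theta>) f) \<le> ennreal c"
      by (simp add: experiment1_def experiment2_def)
  qed
qed

text \<open>The kernel is deterministic. An event about grid increments is an event about the path
  at the grid points, so the hypothesis applies directly, without approximation by
  cylinders.\<close>

lemma deficiency_21:
  assumes n: "n \<ge> 1" and f: "\<And>f. f \<in> \<Theta> \<Longrightarrow> continuous_on {0..1} f"
    and c: "\<And>f J E. f \<in> \<Theta> \<Longrightarrow> finite J \<Longrightarrow> J \<subseteq> {0..1} \<Longrightarrow> E \<in> sets (\<Pi>\<^sub>M t\<in>J. borel) \<Longrightarrow>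
       \<bar>signal_prob n (drift n (\<lambda>j. f (grid n j))) J E
       - signal_prob n (\<lambda>t. integral {0..t} f) J E\<bar> \<le> c"
  shows "deficiency (experiment2 M \<Xi> n \<Theta>) (experiment1 M \<Xi> n \<Theta>) \<le> ennreal c"
  unfolding deficiency_def
proof (rule INF_lower2)
  let ?t = "grid n"
  let ?B = "\<Pi>\<^sub>M i\<in>{1..n}. (borel :: real measure)"
  \<comment> \<open>The factor \<open>n\<close> undoes the averaging in the Riemann sums and turns
    the noise level \<open>1 / sqrt n\<close> into \<open>sqrt n\<close>.\<close>
  define \<phi> where "\<phi> x = (\<lambda>i\<in>{1..n}. real n * (x (?t i) - x (?t (i - 1))))" for x :: "real \<Rightarrow> real"
  have m\<phi>: "\<phi> \<in> C01_borel \<rightarrow>\<^sub>M ?B"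
    unfolding \<phi>_def by (intro measurable_restrict borel_measurable_times borel_measurable_diff borel_measurable_const
       C01_eval_measurable grid_in n) auto
  show "(\<lambda>x. return ?B (\<phi> x)) \<in> sample_space (experiment2 M \<Xi> n \<Theta>) \<rightarrow>\<^sub>M prob_algebra (sample_space (experiment1 M \<Xi> n \<Theta>))"
    using measurable_compose[OF m\<phi> measurable_return_prob_space] by (simp add: experiment1_def experiment2_def)
  show "(SUP f\<in>parameters (experiment2 M \<Xi> n \<Theta>). total_variation (bind (law (experiment2 M \<Xi> n \<Theta>) f) (\<lambda>x. return ?B (\<phi> x))) (law (experiment1 M \<Xi> n \<Theta>) f)) \<le> ennreal c"
  proof (rule SUP_least)
    fix f assume "f \<in> parameters (experiment2 M \<Xi> n \<Theta>)"
    then have f\<Theta>: "f \<in> \<Theta>" by (simp add: experiment2_def)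
    have cF: "continuous_on {0..1} (\<lambda>t. integral {0..t} f)"
      by (intro indefinite_integral_continuous_1 integrable_continuous_interval f f\<Theta>)
    let ?X = "\<lambda>\<omega>. \<lambda>t\<in>{0..1}. integral {0..t} f + 1 / sqrt (real n) * \<Xi> t \<omega>"
    have mX: "?X \<in> M \<rightarrow>\<^sub>M C01_borel" by (rule signal_measurable[OF cF])
    have "bind (distr M C01_borel ?X) (\<lambda>x. return ?B (\<phi> x)) = distr (distr M C01_borel ?X) ?B \<phi>"
      by (rule bind_return_distr') (use m\<phi> not_empty measurable_space[OF mX] in auto)
    also have "\<dots> = distr M ?B (\<phi> \<circ> ?X)" by (rule distr_distr[OF m\<phi> mX])
    finally have bind: "bind (distr M C01_borel ?X) (\<lambda>x. return ?B (\<phi> x)) = distr M ?B (\<phi> \<circ> ?X)" .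
    define J where "J = ?t ` {0..n}"
    have J: "finite J" "J \<subseteq> {0..1}" unfolding J_def using grid_in[OF n] by auto
    have tJ: "?t i \<in> J" if "i \<le> n" for i using that by (auto simp: J_def)
    have "total_variation (distr M ?B (\<phi> \<circ> ?X)) (distr M ?B (obs1 n f)) \<le> ennreal c"
    proof (rule total_variation_le)
      fix A assume "A \<in> sets (distr M ?B (\<phi> \<circ> ?X))"
      then have A: "A \<in> sets ?B" by simp
      define E where "E = {x\<in>space (\<Pi>\<^sub>M t\<in>J. (borel :: real measure)). \<phi> x \<in> A}"
      have E: "E \<in> sets (\<Pi>\<^sub>M t\<in>J. borel)"
      proof -
        have "\<phi> \<in> (\<Pi>\<^sub>M t\<in>J. borel) \<rightarrow>\<^sub>M ?B"
          unfolding \<phi>_def by (intro measurable_restrict borel_measurable_times borel_measurable_diff borel_measurable_const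
             measurable_component_singleton tJ) auto
        from measurable_sets[OF this A] show ?thesis by (simp add: E_def vimage_def Int_def conj_commute)
      qed
      have in_E: "(\<lambda>t\<in>J. g t) \<in> E \<longleftrightarrow> \<phi> g \<in> A" for g
      proof -
        have "\<phi> (\<lambda>t\<in>J. g t) = \<phi> g" unfolding \<phi>_def
        proof (rule restrict_ext)
          fix i assume "i \<in> {1..n}"
          then have "?t i \<in> J" "?t (i - 1) \<in> J" by (auto intro!: tJ simp del: of_nat_diff)
          then show "real n * ((\<lambda>t\<in>J. g t) (?t i) - (\<lambda>t\<in>J. g t) (?t (i - 1))) = real n * (g (?t i) - g (?t (i - 1)))"
            by (simp del: of_nat_diff)
        qed
        then show ?thesis by (simp add: E_def space_PiM)
      qed
      have 1: "\<phi> (?X \<omega>) = \<phi> (\<lambda>t. integral {0..t} f + 1 / sqrt (real n) * \<Xi> t \<omega>)" for \<omega>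
        unfolding \<phi>_def
      proof (rule restrict_ext)
        fix i assume "i \<in> {1..n}"
        then have "?t i \<in> {0..1}" "?t (i - 1) \<in> {0..1}" using grid_in[OF n, of i] grid_in[OF n, of "i - 1"] by auto
        then show "real n * (?X \<omega> (?t i) - ?X \<omega> (?t (i - 1))) = 
          real n * (integral {0..?t i} f + 1 / sqrt (real n) * \<Xi> (?t i) \<omega> - (integral {0..?t (i - 1)} f + 1 / sqrt (real n) * \<Xi> (?t (i - 1)) \<omega>))"
          by (simp only: restrict_apply' )
      qed
      \<comment> \<open>An exact identity: at the nodes the drift agrees with the Riemann sums,
        whose increments are \<open>f (i / n) / n\<close>.\<close>
      have 2: "obs1 n f \<omega> = \<phi> (\<lambda>t. drift n (\<lambda>j. f (?t j)) t + 1 / sqrt (real n) * \<Xi> t \<omega>)" for \<omega>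
        unfolding \<phi>_def
      proof (rule restrict_ext)
        fix i assume i: "i \<in> {1..n}"
        then have ii: "i \<le> n" "i - 1 \<le> n" by auto
        have "(\<Sum>j=1..i. f (?t j)) = (\<Sum>j=1..i-1. f (?t j)) + f (?t i)" using i by (cases i) auto
        then have "real n * (drift n (\<lambda>j. f (?t j)) (?t i) - drift n (\<lambda>j. f (?t j)) (?t (i - 1))) = f (?t i)"
          using n unfolding drift_grid[OF n ii(1)] drift_grid[OF n ii(2)] by (simp add: add_divide_distrib)
        moreover have "real n * (1 / sqrt (real n)) = sqrt (real n)" by (simp add: real_div_sqrt)
        then have "real n * (1 / sqrt (real n) * (a - b)) = sqrt (real n) * (a - b)" for a b
          unfolding mult.assoc[symmetric] by simp
        ultimately show "f (?t i) + sqrt (real n) * (\<Xi> (?t i) \<omega> - \<Xi> (?t (i - 1)) \<omega>) =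
          real n * (drift n (\<lambda>j. f (?t j)) (?t i) + 1 / sqrt (real n) * \<Xi> (?t i) \<omega> - (drift n (\<lambda>j. f (?t j)) (?t (i - 1)) + 1 / sqrt (real n) * \<Xi> (?t (i - 1)) \<omega>))"
          by (smt (verit, best) right_diff_distrib distrib_left)
      qed
      have "measure (distr M ?B (\<phi> \<circ> ?X)) A = signal_prob n (\<lambda>t. integral {0..t} f) J E"
        unfolding measure_distr[OF measurable_comp[OF mX m\<phi>] A] in_E 1[symmetric] by (simp add: vimage_def Int_def conj_commute)
      moreover have "measure (distr M ?B (obs1 n f)) A = signal_prob n (drift n (\<lambda>j. f (?t j))) J E"
        unfolding measure_distr[OF obs1_measurable[OF n] A] in_E 2[symmetric] by (simp add: vimage_def Int_def conj_commute)
      ultimately show "\<bar>measure (distr M ?B (\<phi> \<circ> ?X)) A - measure (distr M ?B (obs1 n f)) A\<bar> \<le> c"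
        using c[OF f\<Theta> J E] by (simp add: abs_minus_commute)
    qed
    then show "total_variation (bind (law (experiment2 M \<Xi> n \<Theta>) f) (\<lambda>x. return ?B (\<phi> x))) (law (experiment1 M \<Xi> n \<Theta>) f) \<le> ennreal c"
      using bind by (simp add: experiment1_def experiment2_def)
  qed
qed

end

subsection \<open>Asymptotic equivalence\<close>

text \<open>These are the linear combinations whose normality the definition of a Gaussian process
  asserts.\<close>

definition linear_span :: "real set \<Rightarrow> (real \<Rightarrow> 'a \<Rightarrow> real) \<Rightarrow> ('a \<Rightarrow> real) set" where
  "linear_span T X = {\<lambda>\<omega>. \<Sum>t\<in>J. c t * X t \<omega> |J c. finite J \<and> J \<subseteq> T}"

lemma gaussian_space_linear_span:
  assumes M: "prob_space M" and g: "gaussian_process M T X" and m: "\<And>t. t \<in> T \<Longrightarrow> (\<integral>\<omega>. X t \<omega> \<partial>M) = 0"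
  shows "gaussian_space M (linear_span T X)"
proof -
  interpret prob_space M by fact
  have int: "integrable M (X t)" if "t \<in> T" for t
  proof -
    have "gaussian_rv M (X t)"
      using g[unfolded gaussian_process_def, rule_format, of "{t}" "\<lambda>_. 1"] that by simp
    then show ?thesis by (rule gaussian_rv_integrable[OF M])
  qed
  show ?thesis
  proof unfold_locales
    fix Y assume "Y \<in> linear_span T X"
    then obtain J c where Y: "Y = (\<lambda>\<omega>. \<Sum>t\<in>J. c t * X t \<omega>)" and J: "finite J" "J \<subseteq> T" by (auto simp: linear_span_def)
    show "gaussian_rv M Y" using g J unfolding Y gaussian_process_def by blast
    have "(\<integral>\<omega>. Y \<omega> \<partial>M) = (\<Sum>t\<in>J. c t * (\<integral>\<omega>. X t \<omega> \<partial>M))"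
      unfolding Y using J int by (subst Bochner_Integration.integral_sum) auto
    also have "\<dots> = 0" using m J by (intro sum.neutral) auto
    finally show "(\<integral>\<omega>. Y \<omega> \<partial>M) = 0" .
  next
    show "(\<lambda>_. 0) \<in> linear_span T X" unfolding linear_span_def by (rule CollectI, rule exI[of _ "{}"]) auto
  next
    fix Y Z a b assume "Y \<in> linear_span T X" "Z \<in> linear_span T X"
    then obtain J c J' c' where Y: "Y = (\<lambda>\<omega>. \<Sum>t\<in>J. c t * X t \<omega>)" "finite J" "J \<subseteq> T"
      and Z: "Z = (\<lambda>\<omega>. \<Sum>t\<in>J'. c' t * X t \<omega>)" "finite J'" "J' \<subseteq> T" unfolding linear_span_def by blast
    define d where "d t = a * (if t \<in> J then c t else 0) + b * (if t \<in> J' then c' t else 0)" for t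
    have "a * Y \<omega> + b * Z \<omega> = (\<Sum>t\<in>J \<union> J'. d t * X t \<omega>)" for \<omega>
    proof -
      have "Y \<omega> = (\<Sum>t\<in>J \<union> J'. (if t \<in> J then c t else 0) * X t \<omega>)"
        unfolding Y(1) using Y Z by (intro sum.mono_neutral_cong_left) auto
      moreover have "Z \<omega> = (\<Sum>t\<in>J \<union> J'. (if t \<in> J' then c' t else 0) * X t \<omega>)"
        unfolding Z(1) using Y Z by (intro sum.mono_neutral_cong_left) auto
      ultimately show ?thesis
        by (simp only: sum_distrib_left sum.distrib[symmetric] d_def distrib_right mult.assoc)
    qed
    then show "(\<lambda>\<omega>. a * Y \<omega> + b * Z \<omega>) \<in> linear_span T X"
      unfolding linear_span_def using Y Z by (intro CollectI exI[of _ "J \<union> J'"] exI[of _ d]) auto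
  qed
qed

lemma linear_span_mem: "t \<in> T \<Longrightarrow> X t \<in> linear_span T X"
  unfolding linear_span_def by (rule CollectI, rule exI[of _ "{t}"], rule exI[of _ "\<lambda>_. 1"]) auto

text \<open>Distances in \<open>[0,1]\<close> are at most 1, so lowering the exponent only enlarges
  the power. Exponents up to 1 are wanted so that \<open>1 / n\<close> is dominated by
  \<open>n powr (- \<gamma>)\<close>.\<close>

lemma holder_weaken:
  assumes "holder_continuous_on \<gamma> {0..1} f"
  obtains H where "H \<ge> 0" "\<And>s t. s \<in> {0..1} \<Longrightarrow> t \<in> {0..1} \<Longrightarrow> \<bar>f s - f t\<bar> \<le> H * \<bar>s - t\<bar> powr (min \<gamma> 1)"
proof -
  obtain H where H: "\<And>s t. s \<in> {0..1} \<Longrightarrow> t \<in> {0..1} \<Longrightarrow> \<bar>f s - f t\<bar> \<le> H * \<bar>s - t\<bar> powr \<gamma>"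
    using assms unfolding holder_continuous_on_def by blast
  show ?thesis
  proof (rule that[of "max H 0"])
    fix s t :: real assume st: "s \<in> {0..1}" "t \<in> {0..1}"
    have "\<bar>f s - f t\<bar> \<le> H * \<bar>s - t\<bar> powr \<gamma>" by (rule H[OF st])
    also have "\<dots> \<le> max H 0 * \<bar>s - t\<bar> powr (min \<gamma> 1)"
      using st by (intro mult_mono powr_mono') auto
    finally show "\<bar>f s - f t\<bar> \<le> max H 0 * \<bar>s - t\<bar> powr (min \<gamma> 1)" .
  qed simp
qed

text \<open>The derivative of \<open>1 / v\<close> is \<open>- v'\<close> times the square of
  \<open>1 / v\<close>, and products of bounded Hoelder functions are Hoelder. The free parameter
  \<open>B\<close> lets \<open>A\<close> also dominate the uniform bound on the ellipsoid.\<close>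

lemma smooth_weights_reciprocal:
  assumes c: "c > 0" and cv: "cv > 0" and \<gamma>: "\<gamma> > 0"
    and q: "\<And>t. t \<in> {0..1} \<Longrightarrow> (q has_real_derivative q' t) (at t within {0..1})"
    and v: "\<And>t. t \<in> {0..1} \<Longrightarrow> (v has_real_derivative v' t) (at t within {0..1})"
    and q'c: "\<And>t. t \<in> {0..1} \<Longrightarrow> c \<le> q' t" and vc: "\<And>t. t \<in> {0..1} \<Longrightarrow> cv \<le> v t"
    and hv: "holder_continuous_on \<gamma> {0..1} v'" and hq: "holder_continuous_on \<gamma> {0..1} q'"
  obtains A where "B \<le> A" "smooth_weights q q' (\<lambda>t. 1 / v t) (\<lambda>t. - v' t / (v t)\<^sup>2) c A (min \<gamma> 1)"
proof -
  obtain Hv where Hv: "Hv \<ge> 0" "\<And>s t. s \<in> {0..1} \<Longrightarrow> t \<in> {0..1} \<Longrightarrow> \<bar>v' s - v' t\<bar> \<le> Hv * \<bar>s - t\<bar> powr (min \<gamma> 1)"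
    using holder_weaken[OF hv] by blast
  obtain Hq where Hq: "Hq \<ge> 0" "\<And>s t. s \<in> {0..1} \<Longrightarrow> t \<in> {0..1} \<Longrightarrow> \<bar>q' s - q' t\<bar> \<le> Hq * \<bar>s - t\<bar> powr (min \<gamma> 1)"
    using holder_weaken[OF hq] by blast
  define r where "r t = 1 / v t" for t
  define R where "R = 1 / cv"
  \<comment> \<open>Bounds \<open>v'\<close> through its value at 0 and the Hoelder condition over a
    distance of at most 1; hence it is also a Lipschitz constant of \<open>v\<close>.\<close>
  define V where "V = \<bar>v' 0\<bar> + Hv"
  have R0: "R > 0" using cv by (simp add: R_def)
  have V0: "V \<ge> 0" using Hv by (simp add: V_def)
  have vpos: "0 < v t" if "t \<in> {0..1}" for t using vc[OF that] cv by linarith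
  have rR: "\<bar>r t\<bar> \<le> R" "0 \<le> r t" if "t \<in> {0..1}" for t
    using vc[OF that] cv by (auto simp: r_def R_def frac_le)
  have v'V: "\<bar>v' t\<bar> \<le> V" if t: "t \<in> {0..1}" for t
  proof -
    have "\<bar>v' t - v' 0\<bar> \<le> Hv * \<bar>t - 0\<bar> powr (min \<gamma> 1)" by (rule Hv(2)) (use t in auto)
    also have "\<dots> \<le> Hv * 1" using t \<gamma> Hv by (intro mult_left_mono powr_le1) auto
    finally show ?thesis by (simp add: V_def)
  qed
  have vL: "\<bar>v s - v t\<bar> \<le> V * \<bar>s - t\<bar>" if "s \<in> {0..1}" "t \<in> {0..1}" for s t
    using field_differentiable_bound[of "{0..1}" v v' V s t] v v'V that by auto
  have rL: "\<bar>r s - r t\<bar> \<le> V * R\<^sup>2 * \<bar>s - t\<bar>" if st: "s \<in> {0..1}" "t \<in> {0..1}" for s t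
  proof -
    have "r s - r t = (v t - v s) * (r s * r t)" using vpos[OF st(1)] vpos[OF st(2)] by (simp add: r_def field_simps)
    then have "\<bar>r s - r t\<bar> = \<bar>v s - v t\<bar> * (\<bar>r s\<bar> * \<bar>r t\<bar>)" by (simp add: abs_mult abs_minus_commute)
    also have "\<dots> \<le> (V * \<bar>s - t\<bar>) * (R * R)" using vL[OF st] rR[OF st(1)] rR[OF st(2)] V0 R0 by (intro mult_mono) auto
    finally show ?thesis by (simp add: power2_eq_square mult_ac)
  qed
  have pw: "\<bar>s - t\<bar> \<le> \<bar>s - t\<bar> powr (min \<gamma> 1)" if "s \<in> {0..1}" "t \<in> {0..1}" for s t :: real
  proof -
    have "\<bar>s - t\<bar> powr 1 \<le> \<bar>s - t\<bar> powr (min \<gamma> 1)" using that by (intro powr_mono') auto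
    then show ?thesis by simp
  qed
  have r'_eq: "- v' t / (v t)\<^sup>2 = - v' t * (r t)\<^sup>2" for t by (simp add: r_def power_divide)
  \<comment> \<open>The first summand stems from the variation of \<open>v'\<close>. The second is
    the bound \<open>V\<close> of \<open>v'\<close>, times the Lipschitz constant
    \<open>V * R^2\<close> of \<open>r\<close>, times the bound \<open>2 * R\<close> of
    \<open>r s + r t\<close>.\<close>
  define G where "G = Hv * R\<^sup>2 + 2 * V\<^sup>2 * R^3"
  have r'H: "\<bar>- v' s / (v s)\<^sup>2 - - v' t / (v t)\<^sup>2\<bar> \<le> G * \<bar>s - t\<bar> powr (min \<gamma> 1)" if st: "s \<in> {0..1}" "t \<in> {0..1}" for s t
  proof -
    let ?p = "\<bar>s - t\<bar> powr (min \<gamma> 1)"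
    have "- v' s / (v s)\<^sup>2 - - v' t / (v t)\<^sup>2 = - ((v' s - v' t) * (r s)\<^sup>2) - v' t * ((r s - r t) * (r s + r t))"
      unfolding r'_eq by (simp add: power2_eq_square algebra_simps)
    then have "\<bar>- v' s / (v s)\<^sup>2 - - v' t / (v t)\<^sup>2\<bar> \<le> \<bar>(v' s - v' t) * (r s)\<^sup>2\<bar> + \<bar>v' t * ((r s - r t) * (r s + r t))\<bar>"
      by (simp only:)
    also have "\<bar>(v' s - v' t) * (r s)\<^sup>2\<bar> \<le> (Hv * ?p) * R\<^sup>2"
      unfolding abs_mult using Hv rR[OF st(1)] st by (intro mult_mono Hv(2)) (auto intro: power_mono)
    also have "\<bar>v' t * ((r s - r t) * (r s + r t))\<bar> \<le> V * ((V * R\<^sup>2 * ?p) * (2 * R))"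
    proof -
      have "\<bar>r s - r t\<bar> \<le> V * R\<^sup>2 * ?p"
        using rL[OF st] mult_left_mono[OF pw[OF st], of "V * R\<^sup>2"] V0 by auto
      moreover have "\<bar>r s + r t\<bar> \<le> 2 * R" using rR[OF st(1)] rR[OF st(2)] by auto
      ultimately show ?thesis unfolding abs_mult using v'V[OF st(2)] V0 R0 by (intro mult_mono) auto
    qed
    finally show ?thesis by (simp add: G_def algebra_simps power2_eq_square power3_eq_cube)
  qed
  define A where "A = Max {B, R, V * R\<^sup>2, G, Hq}"
  have A: "B \<le> A" "R \<le> A" "V * R\<^sup>2 \<le> A" "G \<le> A" "Hq \<le> A" by (auto simp: A_def)
  show ?thesis
  proof (rule that[OF A(1)], unfold_locales)
    show "0 < c" "0 < min \<gamma> 1" "min \<gamma> 1 \<le> 1" using c \<gamma> by auto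
    fix t :: real assume t: "t \<in> {0..1}"
    show "(q has_real_derivative q' t) (at t within {0..1})" "c \<le> q' t" using q q'c t by auto
    show "((\<lambda>t. 1 / v t) has_real_derivative - v' t / (v t)\<^sup>2) (at t within {0..1})"
      using vpos[OF t] by (auto intro!: derivative_eq_intros v[OF t] simp: power2_eq_square)
    show "\<bar>1 / v t\<bar> \<le> A" using rR[OF t] A unfolding r_def by linarith
    have "\<bar>- v' t / (v t)\<^sup>2\<bar> = \<bar>v' t\<bar> * \<bar>r t\<bar>\<^sup>2" unfolding r'_eq by (simp add: abs_mult)
    also have "\<dots> \<le> V * R\<^sup>2" using v'V[OF t] rR[OF t] V0 by (intro mult_mono power_mono) auto
    finally show "\<bar>- v' t / (v t)\<^sup>2\<bar> \<le> A" using A by linarith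
  next
    fix s t :: real assume st: "s \<in> {0..1}" "t \<in> {0..1}"
    have "\<bar>q' s - q' t\<bar> \<le> Hq * \<bar>s - t\<bar> powr (min \<gamma> 1)" by (rule Hq(2)[OF st])
    also have "\<dots> \<le> A * \<bar>s - t\<bar> powr (min \<gamma> 1)" by (intro mult_right_mono A) simp
    finally show "\<bar>q' s - q' t\<bar> \<le> A * \<bar>s - t\<bar> powr (min \<gamma> 1)" .
    have "\<bar>- v' s / (v s)\<^sup>2 - - v' t / (v t)\<^sup>2\<bar> \<le> G * \<bar>s - t\<bar> powr (min \<gamma> 1)" by (rule r'H[OF st])
    also have "\<dots> \<le> A * \<bar>s - t\<bar> powr (min \<gamma> 1)" by (intro mult_right_mono A) simp
    finally show "\<bar>- v' s / (v s)\<^sup>2 - - v' t / (v t)\<^sup>2\<bar> \<le> A * \<bar>s - t\<bar> powr (min \<gamma> 1)" .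
  qed
qed

lemma INF_le_continuous:
  fixes g :: "real \<Rightarrow> real"
  assumes "continuous_on {0..1} g" "t \<in> {0..1}"
  shows "(INF t\<in>{0..1}. g t) \<le> g t"
proof (rule cINF_lower[OF _ assms(2)])
  show "bdd_below (g ` {0..1})"
    using compact_continuous_image[OF assms(1) compact_Icc] by (intro bounded_imp_bdd_below compact_imp_bounded)
qed

text \<open>\<open>K\<close> is a function of \<open>A\<close> and \<open>c\<close> only, so the
  energy bound is the same for all \<open>f\<close>, as the supremum in the deficiency
  demands.\<close>

lemma (in gauss_markov_kernel) le_cam_bound:
  assumes w: "smooth_weights q q' (\<lambda>t. 1 / v t) r' c A \<gamma>" and n: "n \<ge> 1"
    and \<beta>: "1/2 < \<beta>" "\<beta> \<le> 1" and L: "L > 0" and A: "(L\<^sup>2 + sobolev_const \<beta>) / 2 \<le> A"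
    and sub: "\<Theta> \<subseteq> sobolev_ellipsoid \<beta> L"
  shows "le_cam_distance (experiment1 M \<Xi> n \<Theta>) (experiment2 M \<Xi> n \<Theta>) \<le> 
    ennreal (sqrt (real n * (6 * (weighted_grid.K A c)\<^sup>2 / c * (36 * pi\<^sup>2 * sobolev_const \<beta> * L\<^sup>2 * real n powr (- 2 * \<beta>) + real n powr (- 2 * \<gamma>)))))"
    (is "_ \<le> ennreal (sqrt ?b)")
proof -
  let ?S = "36 * pi\<^sup>2 * sobolev_const \<beta> * L\<^sup>2 * real n powr (- 2 * \<beta>)"
  have Z: "sobolev_const \<beta> > 0"
    using sobolev_const_ge[OF \<beta>(1), of "{0}"] by simp
  have S0: "?S > 0" using Z L n by simp
  have cont: "continuous_on {0..1} f" if "f \<in> \<Theta>" for f using sobolev_continuous[OF \<beta>] sub that by blast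
  have main: "\<bar>signal_prob n (drift n (\<lambda>j. f (grid n j))) J E
       - signal_prob n (\<lambda>t. integral {0..t} f) J E\<bar> \<le> sqrt ?b"
    if f: "f \<in> \<Theta>" and J: "finite J" "J \<subseteq> {0..1}" and E: "E \<in> sets (\<Pi>\<^sub>M t\<in>J. borel)" for f J E
  proof -
    have fs: "f \<in> sobolev_ellipsoid \<beta> L" using f sub by auto
    interpret weighted_grid n f ?S A q q' "\<lambda>t. 1 / v t" r' c \<gamma>
      unfolding weighted_grid_def grid_approximation_def
      using w n cont[OF f] S0 sobolev_bounded[OF \<beta> fs] A sobolev_increments[OF \<beta> fs n] by fastforce
    obtain e where e: "\<And>s t. 0 \<le> s \<Longrightarrow> s \<le> t \<Longrightarrow> t \<le> 1 \<Longrightarrow> (H t - H s)\<^sup>2 \<le> (q t - q s) * (e t - e s)"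
      "e 1 - e 0 \<le> 6 * K\<^sup>2 / c * (?S + real n powr (- 2 * \<gamma>))" using energy by blast
    have H0: "H 0 = 0"
      using interp_grid[OF n, of 0 q] grid_less[OF n] unfolding H_def by fastforce
    have HD: "drift n (\<lambda>j. f (grid n j)) t - integral {0..t} f = v t * H t" if t: "t \<in> {0..1}" for t
      using v_pos[OF t] unfolding H_def drift_def by (simp add: right_diff_distrib)
    have "\<bar>signal_prob n (drift n (\<lambda>j. f (grid n j))) J E
       - signal_prob n (\<lambda>t. integral {0..t} f) J E\<bar> \<le> sqrt (real n * (e 1 - e 0))"
      by (rule shift_signal[OF J E n H0 HD e(1)])
    also have "\<dots> \<le> sqrt ?b" using e(2) by (intro real_sqrt_le_mono mult_left_mono) auto
    finally show ?thesis .
  qed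
  show ?thesis unfolding le_cam_distance_def
    by (intro max.boundedI deficiency_12[OF n cont main] deficiency_21[OF n cont main])
qed

theorem theorem4p1:
  fixes M :: "'a measure" and \<Xi> :: "real \<Rightarrow> 'a \<Rightarrow> real"
    and u v q q' v' :: "real \<Rightarrow> real"
    and L \<beta> \<gamma> C :: real
  assumes "prob_space M"
    and "gauss_markov_process M {0..1} \<Xi>"
    and "\<And>\<omega>. \<omega> \<in> space M \<Longrightarrow> continuous_on {0..1} (\<lambda>t. \<Xi> t \<omega>)"
    and "\<And>t. t \<in> {0..1} \<Longrightarrow> (\<integral>\<omega>. \<Xi> t \<omega> \<partial>M) = 0"
    and "AE \<omega> in M. \<Xi> 0 \<omega> = 0"
    and "\<And>t. t \<in> {0<..<1} \<Longrightarrow> covariance M (\<Xi> t) (\<Xi> t) > 0"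
    and "\<And>s t. 0 \<le> s \<Longrightarrow> s \<le> t \<Longrightarrow> t \<le> 1 \<Longrightarrow> covariance M (\<Xi> s) (\<Xi> t) = u s * v t"
    and "\<And>t. t \<in> {0..1} \<Longrightarrow> q t = u t / v t"
    and "L > 0" and "\<beta> > 1 / 2"
    and "\<And>t. t \<in> {0..1} \<Longrightarrow> (q has_real_derivative q' t) (at t within {0..1})"
    and "continuous_on {0..1} q'"
    and "0 < (INF t\<in>{0..1}. q' t)" and "(SUP t\<in>{0..1}. q' t) \<le> C"
    and "0 < (INF t\<in>{0..1}. v t)"
    and "\<And>t. t \<in> {0..1} \<Longrightarrow> (v has_real_derivative v' t) (at t within {0..1})"
    and "\<gamma> > 1 / 2"
    and "holder_continuous_on \<gamma> {0..1} v'" and "holder_continuous_on \<gamma> {0..1} q'"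
  shows "(\<lambda>n. le_cam_distance (experiment1 M \<Xi> n (sobolev_ellipsoid \<beta> L))
                               (experiment2 M \<Xi> n (sobolev_ellipsoid \<beta> L)))
           \<longlonglongrightarrow> 0"
proof -
  interpret prob_space M by fact
  have gp: "gaussian_process M {0..1} \<Xi>" using assms(2) by (simp add: gauss_markov_process_def)
  define cv where "cv = (INF t\<in>{0..1}. v t)"
  define cq where "cq = (INF t\<in>{0..1}. q' t)"
  have v_cont: "continuous_on {0..1} v" by (rule DERIV_continuous_on[OF assms(16)])
  have vc: "cv \<le> v t" if "t \<in> {0..1}" for t unfolding cv_def by (rule INF_le_continuous[OF v_cont that])
  have qc: "cq \<le> q' t" if "t \<in> {0..1}" for t unfolding cq_def by (rule INF_le_continuous[OF assms(12) that])
  have cv: "cv > 0" and cq: "cq > 0" using assms(13,15) by (auto simp: cv_def cq_def)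
  \<comment> \<open>Capping the indices at 1 puts them in the range of the estimates; it enlarges
    the ellipsoid and weakens the Hoelder conditions, and the indices still exceed 1/2.\<close>
  define \<beta>' where "\<beta>' = min \<beta> 1"
  define \<gamma>' where "\<gamma>' = min \<gamma> 1"
  have \<beta>': "1/2 < \<beta>'" "\<beta>' \<le> 1" "\<beta>' \<le> \<beta>" using assms(10) by (auto simp: \<beta>'_def)
  have \<gamma>': "1/2 < \<gamma>'" using assms(17) by (auto simp: \<gamma>'_def)
  have "\<gamma> > 0" using assms(17) by simp
  obtain A where A: "(L\<^sup>2 + sobolev_const \<beta>') / 2 \<le> A"
    and w: "smooth_weights q q' (\<lambda>t. 1 / v t) (\<lambda>t. - v' t / (v t)\<^sup>2) cq A \<gamma>'"
    using smooth_weights_reciprocal[OF cq cv \<open>\<gamma> > 0\<close> assms(11,16) qc vc assms(18,19)] unfolding \<gamma>'_def by blast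
  interpret w: smooth_weights q q' "\<lambda>t. 1 / v t" "\<lambda>t. - v' t / (v t)\<^sup>2" cq A \<gamma>' by (rule w)
  interpret G: gaussian_space M "linear_span {0..1} \<Xi>"
    by (rule gaussian_space_linear_span[OF assms(1) gp assms(4)])
  have vpos: "0 < v t" if "t \<in> {0..1}" for t using vc[OF that] cv by linarith
  have cov_eq: "covariance M (\<Xi> s) (\<Xi> t) = (\<integral>\<omega>. \<Xi> s \<omega> * \<Xi> t \<omega> \<partial>M)" if "s \<in> {0..1}" "t \<in> {0..1}" for s t
    unfolding covariance_def using assms(4) that by simp
  have cov: "(\<integral>\<omega>. \<Xi> s \<omega> * \<Xi> t \<omega> \<partial>M) = v s * v t * q s" if st: "0 \<le> s" "s \<le> t" "t \<le> 1" for s t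
    using assms(7)[OF st] assms(8)[of s] cov_eq[of s t] vpos[of s] st by simp
  \<comment> \<open>\<open>v 0 * v 0 * q 0\<close> is the second moment of \<open>\<Xi> 0\<close>,
    which vanishes.\<close>
  have q0: "q 0 = 0"
  proof -
    have [measurable]: "\<Xi> 0 \<in> borel_measurable M" by (rule G.meas[OF linear_span_mem]) simp
    have "(\<integral>\<omega>. \<Xi> 0 \<omega> * \<Xi> 0 \<omega> \<partial>M) = (\<integral>\<omega>. 0 \<partial>M)"
      by (rule integral_cong_AE) (use assms(5) in auto)
    then show ?thesis using cov[of 0 0] vpos[of 0] by simp
  qed
  interpret gauss_markov_kernel M "linear_span {0..1} \<Xi>" \<Xi> v q
  proof unfold_locales
    fix s t :: real assume st: "s \<in> {0..1}" "t \<in> {0..1}"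
    show "(\<integral>\<omega>. \<Xi> s \<omega> * \<Xi> t \<omega> \<partial>M) = v s * v t * q (min s t)"
    proof (cases "s \<le> t")
      case True
      then show ?thesis using cov[of s t] st by simp
    next
      case False
      then show ?thesis using cov[of t s] st by (simp add: mult.commute)
    qed
  qed (use vpos v_cont q0 w.q_strict w.q_cont assms(3,5) in \<open>auto intro!: linear_span_mem\<close>)
  define b where "b n = sqrt (real n * (6 * (weighted_grid.K A cq)\<^sup>2 / cq * (36 * pi\<^sup>2 * sobolev_const \<beta>' * L\<^sup>2 * real n powr (- 2 * \<beta>') + real n powr (- 2 * \<gamma>'))))" for n
  have bound: "le_cam_distance (experiment1 M \<Xi> n (sobolev_ellipsoid \<beta> L)) (experiment2 M \<Xi> n (sobolev_ellipsoid \<beta> L)) \<le> ennreal (b n)"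
    if "n \<ge> 1" for n
    unfolding b_def by (rule le_cam_bound[OF w that \<beta>'(1,2) assms(9) A sobolev_ellipsoid_mono[OF \<beta>'(3)]])
  \<comment> \<open>Here both indices have to exceed 1/2: the squared rates must beat the factor
    \<open>n\<close> that comes from the noise level.\<close>
  have pw: "(\<lambda>n. real n * real n powr (- 2 * a)) \<longlonglongrightarrow> 0" if "1/2 < a" for a
  proof -
    have "(\<lambda>n. real n powr (1 - 2 * a)) \<longlonglongrightarrow> 0"
      using that by (intro tendsto_neg_powr filterlim_real_sequentially) auto
    moreover have "real n powr (1 - 2 * a) = real n * real n powr (- 2 * a)" if "n \<ge> 1" for n
      using that powr_add[of "real n" 1 "- 2 * a"] by simp
    ultimately show ?thesis
      by (rule Lim_transform_eventually[OF _ eventually_sequentiallyI[of 1]])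
  qed
  have "b \<longlonglongrightarrow> sqrt (6 * (weighted_grid.K A cq)\<^sup>2 / cq * (36 * pi\<^sup>2 * sobolev_const \<beta>' * L\<^sup>2 * 0 + 0))"
  proof -
    have b_eq: "b = (\<lambda>n. sqrt (6 * (weighted_grid.K A cq)\<^sup>2 / cq * (36 * pi\<^sup>2 * sobolev_const \<beta>' * L\<^sup>2 * (real n * real n powr (- 2 * \<beta>')) + real n * real n powr (- 2 * \<gamma>'))))"
      by (simp add: fun_eq_iff b_def algebra_simps)
    show ?thesis
      unfolding b_eq by (intro tendsto_real_sqrt tendsto_mult tendsto_add tendsto_const pw \<beta>' \<gamma>')
  qed
  then have "b \<longlonglongrightarrow> 0" unfolding mult_zero_right add_0_right real_sqrt_zero .
  then have lim: "(\<lambda>n. ennreal (b n)) \<longlonglongrightarrow> 0" using tendsto_ennrealI by fastforce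
  show ?thesis
    by (rule tendsto_sandwich[OF _ eventually_sequentiallyI[OF bound] tendsto_const lim]) simp
qed

end
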